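(* Let $B$ be a commutative algebra and let $\mathbb{J}:\mathbb{N}\to{}_B\mathcal{M}_B$ be the pro-object $\mathbb{J}(i)=B^e/\mu^i$, where $B^e=B\otimes B$ and $\mu=\ker(B\otimes B\to B)$ is the kernel of the product. Then $\mathbb{J}$, with the structure maps induced from the pair Hopf algebroid $B\otimes\overline B$, is a pro-Hopf algebroid over $B$.
   Context: All algebras are unital over a field $\mathbb K$; $\overline B$ is the opposite algebra of $B$, $b\mapsto\overline b$; $B^e=B\otimes\overline B$. Standing assumption: all $B$-module and $\overline B$-module structures are faithfully flat. Pro-objects. A pro-object in a category $\mathcal{C}$ is a functor $F:I\to\mathcal{C}$ from a cofiltered category $I$; $\mathrm{Hom}_{\mathrm{Pro}(\mathcal C)}(F,G)=\varprojlim_k\varinjlim_i\mathrm{Hom}_{\mathcal C}(F(i),G(k))$. A morphism is represented by data $\{(\varrho(k),\phi_k:F(\varrho(k))\to G(k))\}_k$, and $\sim$ means that two such data define the same element. $\mathbb N$ is cofiltered with one morphism $k'\to k$ when $k'\ge k$; $\mathbb{J}$ sends it to the quotient map. An object of $\mathcal C$ is identified with the constant pro-object. For pro-objects over the same $I$ in bimodule categories, tensor products ($\otimes_B$, $\otimes_{\overline B}$, $\otimes_{B^e}$, $\diamond_B$, and the Takeuchi product $\times_B$) are taken levelwise, where $P\diamond_BQ=P\otimes Q/\langle\overline bp\otimes q-p\otimes bq\rangle$ and $P\times_BQ=\{\sum p_i\diamond q_i:\sum p_i\overline b\diamond q_i=\sum p_i\diamond q_ib\ \forall b\in B\}\subseteq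 P\diamond_BQ$; tensor products of pro-morphisms are defined levelwise up to reindexing along cofinal functors. A pro-$B$-ring is a pro-object $\mathbb A$ in ${}_B\mathcal{M}_B$ with morphisms $m:\mathbb A\otimes_B\mathbb A\to\mathbb A$ and $\eta:B\to\mathbb A$ satisfying associativity and unitality up to $\sim$; a pro-$B^e$-ring is defined by replacing $B$ by $B^e$, and has source $s=\eta|_{B\otimes1}$ and target $t=\eta|_{1\otimes\overline B}$. If $\mathbb A$ is a pro-$B^e$-ring, so is $\mathbb A\times_B\mathbb A$ with factorwise multiplication. A pro-$B$-coring is a pro-object $\mathbb D$ in ${}_B\mathcal{M}_B$ with morphisms $\Delta:\mathbb D\to\mathbb D\otimes_B\mathbb D$, $\varepsilon:\mathbb D\to B$ satisfying coassociativity and counitality up to $\sim$. A pro-left bialgebroid over $B$ is a pro-$B^e$-ring $\mathbb L:I\to{}_{B^e}\mathcal{M}_{B^e}$ such that the pro-object in ${}_B\mathcal{M}_B$ derived from the left $B^e$-module structure ($a.X.b=a\overline bX$) is a pro-$B$-coring with coproduct $\Delta:\mathbb L\to\mathbb L\diamond_B\mathbb L$ and counit $\varepsilon:\mathbb L\to B$, with (1) $\Delta\in\mathrm{Hom}_{\mathrm{Pro}}(\mathbb L,\mathbb L\times_B\mathbb L)$; (2) $\Delta\circ m_{\mathbb L}\sim m_{\mathbb L\times_B\mathbb L}\circ(\Delta\otimes_{B^e}\Delta)$; (3) $\varepsilon\circ m_{\mathbb L}\sim\varepsilon\circ m_{\mathbb L}\circ(\mathrm{id}\otimes s\circ\varepsilon)\sim\varepsilon\circ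 m_{\mathbb L}\circ(\mathrm{id}\otimes t\circ\varepsilon)$. It is a pro-left Hopf algebroid if $(\mathrm{id}\diamond_Bm_{\mathbb L})\circ(\Delta\otimes_{\overline B}\mathrm{id}):\mathbb L\otimes_{\overline B}\mathbb L\to\mathbb L\diamond_B\mathbb L$ (formally $X\otimes Y\mapsto X_{(1)}\diamond X_{(2)}Y$) is invertible as a pro-morphism, a pro-anti-left Hopf algebroid if the pro-morphism $\mathbb L\otimes_B\mathbb L\to\mathbb L\diamond_B\mathbb L$ (formally $X\otimes Y\mapsto X_{(1)}Y\diamond X_{(2)}$) is invertible, and a pro-Hopf algebroid if it is both. Pair Hopf algebroid: $B\otimes\overline B$ with $s(a)=a\otimes1$, $t(a)=1\otimes a$, $(a\otimes a')(b\otimes b')=ab\otimes b'a'$, $\Delta(a\otimes a')=(a\otimes1)\diamond_B(1\otimes a')$, $\varepsilon(a\otimes a')=aa'$. Structure on $\mathbb J$: product, $s$, $t$ and $\varepsilon$ are induced levelwise on the quotients by $\mu^i$; the coproduct is represented by the maps $B^e/\mu^{2k}\to(B^e/\mu^k)\diamond_B(B^e/\mu^k)$ induced by $\Delta$. *)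

theory Defs
  imports "HOL-Algebra.Free_Abelian_Groups" "HOL-Algebra.Ideal_Product" "HOL-Algebra.QuotRing" "HOL-Algebra.Module"
begin

section \<open>Algebras and bimodules\<close>

text \<open>Not necessarily commutative unital algebras over a field; the locale \<^locale>\<open>algebra\<close> of the
  library is the commutative case.\<close>

definition k_algebra :: "('k, 'x) ring_scheme \<Rightarrow> ('k, 'a, 'y) module_scheme \<Rightarrow> bool" where
  "k_algebra K A \<longleftrightarrow> field K \<and> ring A \<and> module K A \<and>
     (\<forall>k \<in> carrier K. \<forall>x \<in> carrier A. \<forall>y \<in> carrier A.
        (k \<odot>\<^bsub>A\<^esub> x) \<otimes>\<^bsub>A\<^esub> y = k \<odot>\<^bsub>A\<^esub> (x \<otimes>\<^bsub>A\<^esub> y) \<and>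
        x \<otimes>\<^bsub>A\<^esub> (k \<odot>\<^bsub>A\<^esub> y) = k \<odot>\<^bsub>A\<^esub> (x \<otimes>\<^bsub>A\<^esub> y))"

definition op_alg :: "('k, 'a, 'y) module_scheme \<Rightarrow> ('k, 'a, 'y) module_scheme" where
  "op_alg A = A\<lparr>mult := (\<lambda>x y. y \<otimes>\<^bsub>A\<^esub> x)\<rparr>"

text \<open>\<open>smult\<close> is the left and \<open>rsmult\<close> the right action. As for \<^locale>\<open>module\<close>, the fields \<open>mult\<close>
  and \<open>one\<close> are irrelevant for a bimodule.\<close>

record ('r, 'm, 's) bimod = "('r, 'm) module" +
  rsmult :: "'m \<Rightarrow> 's \<Rightarrow> 'm"

definition bimodule ::
  "('k, 'x) ring_scheme \<Rightarrow> ('k, 'r, 'y) module_scheme \<Rightarrow> ('k, 's, 'z) module_scheme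
    \<Rightarrow> ('r, 'm, 's) bimod \<Rightarrow> bool" where
  "bimodule K R S M \<longleftrightarrow> k_algebra K R \<and> k_algebra K S \<and> abelian_group M \<and>
     (\<forall>r \<in> carrier R. \<forall>x \<in> carrier M. r \<odot>\<^bsub>M\<^esub> x \<in> carrier M) \<and>
     (\<forall>s \<in> carrier S. \<forall>x \<in> carrier M. rsmult M x s \<in> carrier M) \<and>
     (\<forall>r \<in> carrier R. \<forall>r' \<in> carrier R. \<forall>x \<in> carrier M.
        (r \<oplus>\<^bsub>R\<^esub> r') \<odot>\<^bsub>M\<^esub> x = r \<odot>\<^bsub>M\<^esub> x \<oplus>\<^bsub>M\<^esub> r' \<odot>\<^bsub>M\<^esub> x \<and>
        (r \<otimes>\<^bsub>R\<^esub> r') \<odot>\<^bsub>M\<^esub> x = r \<odot>\<^bsub>M\<^esub> (r' \<odot>\<^bsub>M\<^esub> x)) \<and>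
     (\<forall>s \<in> carrier S. \<forall>s' \<in> carrier S. \<forall>x \<in> carrier M.
        rsmult M x (s \<oplus>\<^bsub>S\<^esub> s') = rsmult M x s \<oplus>\<^bsub>M\<^esub> rsmult M x s' \<and>
        rsmult M x (s \<otimes>\<^bsub>S\<^esub> s') = rsmult M (rsmult M x s) s') \<and>
     (\<forall>r \<in> carrier R. \<forall>x \<in> carrier M. \<forall>y \<in> carrier M.
        r \<odot>\<^bsub>M\<^esub> (x \<oplus>\<^bsub>M\<^esub> y) = r \<odot>\<^bsub>M\<^esub> x \<oplus>\<^bsub>M\<^esub> r \<odot>\<^bsub>M\<^esub> y) \<and>
     (\<forall>s \<in> carrier S. \<forall>x \<in> carrier M. \<forall>y \<in> carrier M.
        rsmult M (x \<oplus>\<^bsub>M\<^esub> y) s = rsmult M x s \<oplus>\<^bsub>M\<^esub> rsmult M y s) \<and>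
     (\<forall>x \<in> carrier M. \<one>\<^bsub>R\<^esub> \<odot>\<^bsub>M\<^esub> x = x \<and> rsmult M x \<one>\<^bsub>S\<^esub> = x) \<and>
     (\<forall>r \<in> carrier R. \<forall>s \<in> carrier S. \<forall>x \<in> carrier M.
        rsmult M (r \<odot>\<^bsub>M\<^esub> x) s = r \<odot>\<^bsub>M\<^esub> (rsmult M x s)) \<and>
     (\<forall>k \<in> carrier K. \<forall>x \<in> carrier M.
        (k \<odot>\<^bsub>R\<^esub> \<one>\<^bsub>R\<^esub>) \<odot>\<^bsub>M\<^esub> x = rsmult M x (k \<odot>\<^bsub>S\<^esub> \<one>\<^bsub>S\<^esub>))"

definition bimod_hom ::
  "('r, 'y) ring_scheme \<Rightarrow> ('s, 'z) ring_scheme \<Rightarrow> ('r, 'm, 's) bimod \<Rightarrow> ('r, 'n, 's) bimod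
    \<Rightarrow> ('m \<Rightarrow> 'n) set" where
  "bimod_hom R S M N = {f. (\<forall>x \<in> carrier M. f x \<in> carrier N) \<and>
     (\<forall>x \<in> carrier M. \<forall>y \<in> carrier M. f (x \<oplus>\<^bsub>M\<^esub> y) = f x \<oplus>\<^bsub>N\<^esub> f y) \<and>
     (\<forall>r \<in> carrier R. \<forall>x \<in> carrier M. f (r \<odot>\<^bsub>M\<^esub> x) = r \<odot>\<^bsub>N\<^esub> f x) \<and>
     (\<forall>s \<in> carrier S. \<forall>x \<in> carrier M. f (rsmult M x s) = rsmult N (f x) s)}"

text \<open>A ring \<open>A\<close> as a bimodule by means of a ring homomorphism \<open>h : R \<rightarrow> A\<close>.\<close>

definition ring_bimod :: "('r \<Rightarrow> 'a) \<Rightarrow> ('a, 'y) ring_scheme \<Rightarrow> ('r, 'a, 'r) bimod" where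
  "ring_bimod h A = \<lparr>carrier = carrier A, mult = mult A, one = one A, zero = zero A, add = add A,
     smult = (\<lambda>r x. h r \<otimes>\<^bsub>A\<^esub> x), rsmult = (\<lambda>x r. x \<otimes>\<^bsub>A\<^esub> h r)\<rparr>"

abbreviation regular :: "('a, 'y) ring_scheme \<Rightarrow> ('a, 'a, 'a) bimod" where
  "regular A \<equiv> ring_bimod (\<lambda>x. x) A"

definition vs_bimod :: "('k, 'm, 'y) module_scheme \<Rightarrow> ('k, 'm, 'k) bimod" where
  "vs_bimod M = \<lparr>carrier = carrier M, mult = mult M, one = one M, zero = zero M, add = add M,
     smult = smult M, rsmult = (\<lambda>x k. k \<odot>\<^bsub>M\<^esub> x)\<rparr>"

definition restr ::
  "('r' \<Rightarrow> 'r) \<Rightarrow> ('s' \<Rightarrow> 's) \<Rightarrow> ('r, 'm, 's) bimod \<Rightarrow> ('r', 'm, 's') bimod" where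
  "restr f g M = \<lparr>carrier = carrier M, mult = mult M, one = one M, zero = zero M, add = add M,
     smult = (\<lambda>r x. f r \<odot>\<^bsub>M\<^esub> x), rsmult = (\<lambda>x s. rsmult M x (g s))\<rparr>"


section \<open>Tensor products\<close>

text \<open>\<open>P \<otimes>\<^sub>S Q\<close> is the free abelian group on \<open>P \<times> Q\<close> modulo the subgroup generated by the relators,
  so its elements are cosets of formal integral combinations of pairs.\<close>

type_synonym ('p, 'q) tens = "(('p \<times> 'q) \<Rightarrow>\<^sub>0 int) set"

definition tensor_relators ::
  "('s, 'y) ring_scheme \<Rightarrow> ('r, 'p, 's) bimod \<Rightarrow> ('s, 'q, 't) bimod \<Rightarrow> ('p, 'q) tens" where
  "tensor_relators S P Q =
     {frag_of (p \<oplus>\<^bsub>P\<^esub> p', q) - frag_of (p, q) - frag_of (p', q) | p p' q.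
        p \<in> carrier P \<and> p' \<in> carrier P \<and> q \<in> carrier Q} \<union>
     {frag_of (p, q \<oplus>\<^bsub>Q\<^esub> q') - frag_of (p, q) - frag_of (p, q') | p q q'.
        p \<in> carrier P \<and> q \<in> carrier Q \<and> q' \<in> carrier Q} \<union>
     {frag_of (rsmult P p s, q) - frag_of (p, s \<odot>\<^bsub>Q\<^esub> q) | p s q.
        p \<in> carrier P \<and> s \<in> carrier S \<and> q \<in> carrier Q}"

definition tensor_null ::
  "('s, 'y) ring_scheme \<Rightarrow> ('r, 'p, 's) bimod \<Rightarrow> ('s, 'q, 't) bimod \<Rightarrow> ('p, 'q) tens" where
  "tensor_null S P Q =
     generate (free_Abelian_group (carrier P \<times> carrier Q)) (tensor_relators S P Q)"

text \<open>Additive notation for the quotient group; the fields \<open>mult\<close> and \<open>one\<close> carry no meaning.\<close>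

definition tensor_group ::
  "('s, 'y) ring_scheme \<Rightarrow> ('r, 'p, 's) bimod \<Rightarrow> ('s, 'q, 't) bimod \<Rightarrow> ('p, 'q) tens ring" where
  "tensor_group S P Q =
     (let G = free_Abelian_group (carrier P \<times> carrier Q) Mod tensor_null S P Q
      in \<lparr>carrier = carrier G, mult = undefined, one = undefined,
          zero = \<one>\<^bsub>G\<^esub>, add = mult G\<rparr>)"

definition tensor ::
  "('s, 'y) ring_scheme \<Rightarrow> ('r, 'p, 's) bimod \<Rightarrow> ('s, 'q, 't) bimod \<Rightarrow> 'p \<Rightarrow> 'q \<Rightarrow> ('p, 'q) tens"
  where
  "tensor S P Q p q =
     r_coset (free_Abelian_group (carrier P \<times> carrier Q)) (tensor_null S P Q) (frag_of (p, q))"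

text \<open>The additive map \<open>p \<otimes> q \<mapsto> f p q\<close> into \<open>M\<close> determined by a biadditive balanced map \<open>f\<close>. For such
  an \<open>f\<close> the choice of the representative does not matter.\<close>

definition tlift :: "('n, 'y) ring_scheme \<Rightarrow> ('p \<Rightarrow> 'q \<Rightarrow> 'n) \<Rightarrow> ('p, 'q) tens \<Rightarrow> 'n" where
  "tlift M f X =
     (let c = SOME c. c \<in> X
      in \<Oplus>\<^bsub>M\<^esub>pq \<in> Poly_Mapping.keys c.
           [Poly_Mapping.lookup c pq] \<cdot>\<^bsub>M\<^esub> f (fst pq) (snd pq))"

definition tensor_bimod ::
  "('s, 'y) ring_scheme \<Rightarrow> ('r, 'p, 's) bimod \<Rightarrow> ('s, 'q, 't) bimod
    \<Rightarrow> ('r, ('p, 'q) tens, 't) bimod" where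
  "tensor_bimod S P Q =
     (let G = tensor_group S P Q
      in \<lparr>carrier = carrier G, mult = mult G, one = one G, zero = zero G, add = add G,
          smult = (\<lambda>r. tlift G (\<lambda>p q. tensor S P Q (r \<odot>\<^bsub>P\<^esub> p) q)),
          rsmult = (\<lambda>X t. tlift G (\<lambda>p q. tensor S P Q p (rsmult Q q t)) X)\<rparr>)"

text \<open>The map \<open>f \<otimes>\<^sub>S g\<close> into \<open>P \<otimes>\<^sub>S Q\<close>.\<close>

definition tensor_map ::
  "('s, 'y) ring_scheme \<Rightarrow> ('r, 'p, 's) bimod \<Rightarrow> ('s, 'q, 't) bimod
    \<Rightarrow> ('p' \<Rightarrow> 'p) \<Rightarrow> ('q' \<Rightarrow> 'q) \<Rightarrow> ('p', 'q') tens \<Rightarrow> ('p, 'q) tens" where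
  "tensor_map S P Q f g = tlift (tensor_group S P Q) (\<lambda>p q. tensor S P Q (f p) (g q))"

text \<open>The rebracketing maps \<open>(p \<otimes> q) \<otimes> r \<mapsto> p \<otimes> (q \<otimes> r)\<close> and \<open>(p \<otimes> q) \<otimes> r \<mapsto> (p \<otimes> r) \<otimes> q\<close> into
  \<open>P \<otimes>\<^sub>S V\<close> and \<open>V \<otimes>\<^sub>S Q\<close> respectively, where \<open>V\<close> is the inner tensor product on the right hand side
  (with whichever bimodule structure is needed) and \<open>\<tau>\<close> its universal balanced map.\<close>

definition assoc_map ::
  "('s, 'y) ring_scheme \<Rightarrow> ('r, 'p, 's) bimod \<Rightarrow> ('s, 'v, 't) bimod \<Rightarrow> ('q \<Rightarrow> 'w \<Rightarrow> 'v)
    \<Rightarrow> (('p, 'q) tens, 'w) tens \<Rightarrow> ('p, 'v) tens" where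
  "assoc_map S P V \<tau> =
     tlift (tensor_group S P V) (\<lambda>X r. tlift (tensor_group S P V) (\<lambda>p q. tensor S P V p (\<tau> q r)) X)"

definition flip_assoc_map ::
  "('s, 'y) ring_scheme \<Rightarrow> ('r, 'v, 's) bimod \<Rightarrow> ('s, 'q, 't) bimod \<Rightarrow> ('p \<Rightarrow> 'w \<Rightarrow> 'v)
    \<Rightarrow> (('p, 'q) tens, 'w) tens \<Rightarrow> ('v, 'q) tens" where
  "flip_assoc_map S V Q \<tau> =
     tlift (tensor_group S V Q) (\<lambda>X r. tlift (tensor_group S V Q) (\<lambda>p q. tensor S V Q (\<tau> p r) q) X)"


section \<open>Enveloping algebra\<close>

definition alg_tensor ::
  "('k, 'x) ring_scheme \<Rightarrow> ('k, 'a, 'y) module_scheme \<Rightarrow> ('k, 'c, 'z) module_scheme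
    \<Rightarrow> ('k, ('a, 'c) tens) module" where
  "alg_tensor K A C =
     (let V = tensor_bimod K (vs_bimod A) (vs_bimod C);
          t = tensor K (vs_bimod A) (vs_bimod C)
      in \<lparr>carrier = carrier V,
          mult = (\<lambda>X Y. tlift V (\<lambda>a c. tlift V (\<lambda>a' c'. t (a \<otimes>\<^bsub>A\<^esub> a') (c \<otimes>\<^bsub>C\<^esub> c')) Y) X),
          one = t \<one>\<^bsub>A\<^esub> \<one>\<^bsub>C\<^esub>, zero = zero V, add = add V, smult = smult V\<rparr>)"

definition env :: "('k, 'x) ring_scheme \<Rightarrow> ('k, 'b, 'y) module_scheme \<Rightarrow> ('k, ('b, 'b) tens) module"
  where "env K B = alg_tensor K B (op_alg B)"

definition env_elem ::
  "('k, 'x) ring_scheme \<Rightarrow> ('k, 'b, 'y) module_scheme \<Rightarrow> 'b \<Rightarrow> 'b \<Rightarrow> ('b, 'b) tens" where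
  "env_elem K B a b = tensor K (vs_bimod B) (vs_bimod (op_alg B)) a b"

definition src ::
  "('k, 'x) ring_scheme \<Rightarrow> ('k, 'b, 'y) module_scheme \<Rightarrow> 'b \<Rightarrow> ('b, 'b) tens" where
  "src K B b = env_elem K B b \<one>\<^bsub>B\<^esub>"

definition tgt ::
  "('k, 'x) ring_scheme \<Rightarrow> ('k, 'b, 'y) module_scheme \<Rightarrow> 'b \<Rightarrow> ('b, 'b) tens" where
  "tgt K B b = env_elem K B \<one>\<^bsub>B\<^esub> b"

definition scal ::
  "('k, 'x) ring_scheme \<Rightarrow> ('k, 'b, 'y) module_scheme \<Rightarrow> 'k \<Rightarrow> ('b, 'b) tens" where
  "scal K B k = k \<odot>\<^bsub>env K B\<^esub> \<one>\<^bsub>env K B\<^esub>"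

text \<open>The \<open>B\<close>-bimodule \<open>a.X.b = a \<langle>b\<rangle> X\<close> derived from the left action of the enveloping algebra, where
  \<open>\<langle>b\<rangle> = 1 \<otimes> b\<close>.\<close>

definition left_view ::
  "('k, 'x) ring_scheme \<Rightarrow> ('k, 'b, 'y) module_scheme \<Rightarrow> (('b, 'b) tens, 'm, 't) bimod
    \<Rightarrow> ('b, 'm, 'b) bimod" where
  "left_view K B M = \<lparr>carrier = carrier M, mult = mult M, one = one M, zero = zero M, add = add M,
     smult = (\<lambda>a x. src K B a \<odot>\<^bsub>M\<^esub> x), rsmult = (\<lambda>x b. tgt K B b \<odot>\<^bsub>M\<^esub> x)\<rparr>"

text \<open>\<open>P \<diamond> Q\<close> is \<open>P \<otimes>\<^sub>B Q\<close> for the derived bimodules. It is considered with the actions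
  \<open>a \<langle>b\<rangle> (p \<diamond> q) = a p \<diamond> \<langle>b\<rangle> q\<close> and \<open>(p \<diamond> q) a \<langle>b\<rangle> = p a \<diamond> q \<langle>b\<rangle>\<close> of the enveloping algebra.\<close>

definition dia ::
  "('k, 'x) ring_scheme \<Rightarrow> ('k, 'b, 'y) module_scheme
    \<Rightarrow> (('b, 'b) tens, 'p, ('b, 'b) tens) bimod \<Rightarrow> (('b, 'b) tens, 'q, ('b, 'b) tens) bimod
    \<Rightarrow> (('b, 'b) tens, ('p, 'q) tens, ('b, 'b) tens) bimod" where
  "dia K B P Q =
     (let G = tensor_group B (left_view K B P) (left_view K B Q);
          t = tensor B (left_view K B P) (left_view K B Q)
      in \<lparr>carrier = carrier G, mult = mult G, one = one G, zero = zero G, add = add G,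
          smult = (\<lambda>Z X. tlift G (\<lambda>a b.
             tlift G (\<lambda>p q. t (src K B a \<odot>\<^bsub>P\<^esub> p) (tgt K B b \<odot>\<^bsub>Q\<^esub> q)) X) Z),
          rsmult = (\<lambda>X Z. tlift G (\<lambda>a b.
             tlift G (\<lambda>p q. t (rsmult P p (src K B a)) (rsmult Q q (tgt K B b))) X) Z)\<rparr>)"

text \<open>The Takeuchi product.\<close>

definition takeuchi ::
  "('k, 'x) ring_scheme \<Rightarrow> ('k, 'b, 'y) module_scheme
    \<Rightarrow> (('b, 'b) tens, 'p, ('b, 'b) tens) bimod \<Rightarrow> (('b, 'b) tens, 'q, ('b, 'b) tens) bimod
    \<Rightarrow> (('b, 'b) tens, ('p, 'q) tens, ('b, 'b) tens) bimod" where
  "takeuchi K B P Q =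
     (let D = dia K B P Q; t = tensor B (left_view K B P) (left_view K B Q)
      in D\<lparr>carrier := {X \<in> carrier D. \<forall>b \<in> carrier B.
             tlift D (\<lambda>p q. t (rsmult P p (tgt K B b)) q) X =
             tlift D (\<lambda>p q. t p (rsmult Q q (src K B b))) X}\<rparr>)"


section \<open>Pro-objects\<close>

record ('i, 'a) cat =
  Ob :: "'i set"
  Arr :: "'a set"
  Dom :: "'a \<Rightarrow> 'i"
  Cod :: "'a \<Rightarrow> 'i"
  Ident :: "'i \<Rightarrow> 'a"
  Cmp :: "'a \<Rightarrow> 'a \<Rightarrow> 'a"

definition category :: "('i, 'a) cat \<Rightarrow> bool" where
  "category I \<longleftrightarrow>
     (\<forall>u \<in> Arr I. Dom I u \<in> Ob I \<and> Cod I u \<in> Ob I) \<and>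
     (\<forall>i \<in> Ob I. Ident I i \<in> Arr I \<and> Dom I (Ident I i) = i \<and> Cod I (Ident I i) = i) \<and>
     (\<forall>u \<in> Arr I. \<forall>v \<in> Arr I. Cod I u = Dom I v \<longrightarrow>
        Cmp I v u \<in> Arr I \<and> Dom I (Cmp I v u) = Dom I u \<and> Cod I (Cmp I v u) = Cod I v) \<and>
     (\<forall>u \<in> Arr I. Cmp I u (Ident I (Dom I u)) = u \<and> Cmp I (Ident I (Cod I u)) u = u) \<and>
     (\<forall>u \<in> Arr I. \<forall>v \<in> Arr I. \<forall>w \<in> Arr I. Cod I u = Dom I v \<and> Cod I v = Dom I w \<longrightarrow>
        Cmp I w (Cmp I v u) = Cmp I (Cmp I w v) u)"

definition arrows :: "('i, 'a) cat \<Rightarrow> 'i \<Rightarrow> 'i \<Rightarrow> 'a set" where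
  "arrows I i j = {u \<in> Arr I. Dom I u = i \<and> Cod I u = j}"

definition cofiltered :: "('i, 'a) cat \<Rightarrow> bool" where
  "cofiltered I \<longleftrightarrow> category I \<and> Ob I \<noteq> {} \<and>
     (\<forall>i \<in> Ob I. \<forall>j \<in> Ob I. \<exists>k \<in> Ob I. arrows I k i \<noteq> {} \<and> arrows I k j \<noteq> {}) \<and>
     (\<forall>i \<in> Ob I. \<forall>j \<in> Ob I. \<forall>u \<in> arrows I i j. \<forall>v \<in> arrows I i j.
        \<exists>k \<in> Ob I. \<exists>w \<in> arrows I k i. Cmp I u w = Cmp I v w)"

record ('i, 'a, 'r, 'm, 's) proobj =
  Idx :: "('i, 'a) cat"
  Obj :: "'i \<Rightarrow> ('r, 'm, 's) bimod"
  Map :: "'a \<Rightarrow> 'm \<Rightarrow> 'm"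

definition pro_object ::
  "('k, 'x) ring_scheme \<Rightarrow> ('k, 'r, 'y) module_scheme \<Rightarrow> ('k, 's, 'z) module_scheme
    \<Rightarrow> ('i, 'a, 'r, 'm, 's) proobj \<Rightarrow> bool" where
  "pro_object K R S F \<longleftrightarrow> (let I = Idx F in cofiltered I \<and>
     (\<forall>i \<in> Ob I. bimodule K R S (Obj F i)) \<and>
     (\<forall>u \<in> Arr I. Map F u \<in> bimod_hom R S (Obj F (Dom I u)) (Obj F (Cod I u))) \<and>
     (\<forall>i \<in> Ob I. \<forall>x \<in> carrier (Obj F i). Map F (Ident I i) x = x) \<and>
     (\<forall>u \<in> Arr I. \<forall>v \<in> Arr I. Cod I u = Dom I v \<longrightarrow>
        (\<forall>x \<in> carrier (Obj F (Dom I u)). Map F (Cmp I v u) x = Map F v (Map F u x))))"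

text \<open>Data \<open>(\<rho>, \<phi>)\<close> with \<open>\<phi> k : F (\<rho> k) \<rightarrow> G k\<close>. Elements of \<open>pro_mor\<close> are the data that represent
  elements of \<open>lim\<^sub>k colim\<^sub>i Hom (F i) (G k)\<close>: the classes of the \<open>\<phi> k\<close> in the filtered colimits are
  compatible with the arrows between the \<open>k\<close>. \<open>pro_eq\<close> is equality of the represented elements.\<close>

type_synonym ('i, 'j, 'm, 'n) promor = "('j \<Rightarrow> 'i) \<times> ('j \<Rightarrow> 'm \<Rightarrow> 'n)"

definition pro_mor ::
  "('r, 'y) ring_scheme \<Rightarrow> ('s, 'z) ring_scheme
    \<Rightarrow> ('i, 'a, 'r, 'm, 's) proobj \<Rightarrow> ('j, 'c, 'r, 'n, 's) proobj \<Rightarrow> ('i, 'j, 'm, 'n) promor set"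
  where
  "pro_mor R S F G = {(\<rho>, \<phi>).
     (\<forall>k \<in> Ob (Idx G). \<rho> k \<in> Ob (Idx F) \<and> \<phi> k \<in> bimod_hom R S (Obj F (\<rho> k)) (Obj G k)) \<and>
     (\<forall>w \<in> Arr (Idx G). \<exists>i \<in> Ob (Idx F).
        \<exists>u \<in> arrows (Idx F) i (\<rho> (Dom (Idx G) w)). \<exists>v \<in> arrows (Idx F) i (\<rho> (Cod (Idx G) w)).
          \<forall>x \<in> carrier (Obj F i).
            Map G w (\<phi> (Dom (Idx G) w) (Map F u x)) = \<phi> (Cod (Idx G) w) (Map F v x))}"

definition pro_eq ::
  "('i, 'a, 'r, 'm, 's) proobj \<Rightarrow> ('j, 'c, 'r', 'n, 's') proobj
    \<Rightarrow> ('i, 'j, 'm, 'n) promor \<Rightarrow> ('i, 'j, 'm, 'n) promor \<Rightarrow> bool" where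
  "pro_eq F G f g \<longleftrightarrow> (\<forall>k \<in> Ob (Idx G). \<exists>i \<in> Ob (Idx F).
     \<exists>u \<in> arrows (Idx F) i (fst f k). \<exists>v \<in> arrows (Idx F) i (fst g k).
       \<forall>x \<in> carrier (Obj F i). snd f k (Map F u x) = snd g k (Map F v x))"

text \<open>\<open>pro_level \<alpha>\<close> is given by a family of maps \<open>F k \<rightarrow> G k\<close>.\<close>

definition pro_level :: "('i \<Rightarrow> 'm \<Rightarrow> 'n) \<Rightarrow> ('i, 'i, 'm, 'n) promor" where
  "pro_level \<alpha> = ((\<lambda>k. k), \<alpha>)"

abbreviation pro_id :: "('i, 'i, 'm, 'm) promor" where
  "pro_id \<equiv> pro_level (\<lambda>k x. x)"

definition pro_comp ::
  "('j, 'l, 'n, 'o) promor \<Rightarrow> ('i, 'j, 'm, 'n) promor \<Rightarrow> ('i, 'l, 'm, 'o) promor" where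
  "pro_comp g f = ((\<lambda>k. fst f (fst g k)), (\<lambda>k x. snd g k (snd f (fst g k) x)))"

definition pro_invertible ::
  "('r, 'y) ring_scheme \<Rightarrow> ('s, 'z) ring_scheme
    \<Rightarrow> ('i, 'a, 'r, 'm, 's) proobj \<Rightarrow> ('j, 'c, 'r, 'n, 's) proobj \<Rightarrow> ('i, 'j, 'm, 'n) promor \<Rightarrow> bool"
  where
  "pro_invertible R S F G f \<longleftrightarrow> f \<in> pro_mor R S F G \<and>
     (\<exists>g \<in> pro_mor R S G F. pro_eq F F (pro_comp g f) pro_id \<and> pro_eq G G (pro_comp f g) pro_id)"

definition const_pro :: "('i, 'a) cat \<Rightarrow> ('r, 'm, 's) bimod \<Rightarrow> ('i, 'a, 'r, 'm, 's) proobj" where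
  "const_pro I M = \<lparr>Idx = I, Obj = (\<lambda>i. M), Map = (\<lambda>u x. x)\<rparr>"

definition pro_restr ::
  "('r' \<Rightarrow> 'r) \<Rightarrow> ('s' \<Rightarrow> 's) \<Rightarrow> ('i, 'a, 'r, 'm, 's) proobj \<Rightarrow> ('i, 'a, 'r', 'm, 's') proobj" where
  "pro_restr f g F = \<lparr>Idx = Idx F, Obj = (\<lambda>i. restr f g (Obj F i)), Map = Map F\<rparr>"

definition pro_left_view ::
  "('k, 'x) ring_scheme \<Rightarrow> ('k, 'b, 'y) module_scheme \<Rightarrow> ('i, 'a, ('b, 'b) tens, 'm, 't) proobj
    \<Rightarrow> ('i, 'a, 'b, 'm, 'b) proobj" where
  "pro_left_view K B F = \<lparr>Idx = Idx F, Obj = (\<lambda>i. left_view K B (Obj F i)), Map = Map F\<rparr>"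

text \<open>The levelwise products are meant for pro-objects over the same index category.\<close>

definition pro_tensor ::
  "('s, 'y) ring_scheme \<Rightarrow> ('i, 'a, 'r, 'p, 's) proobj \<Rightarrow> ('i, 'a, 's, 'q, 't) proobj
    \<Rightarrow> ('i, 'a, 'r, ('p, 'q) tens, 't) proobj" where
  "pro_tensor S F G = \<lparr>Idx = Idx F, Obj = (\<lambda>i. tensor_bimod S (Obj F i) (Obj G i)),
     Map = (\<lambda>u. tensor_map S (Obj F (Cod (Idx F) u)) (Obj G (Cod (Idx F) u)) (Map F u) (Map G u))\<rparr>"

definition pro_dia ::
  "('k, 'x) ring_scheme \<Rightarrow> ('k, 'b, 'y) module_scheme
    \<Rightarrow> ('i, 'a, ('b, 'b) tens, 'p, ('b, 'b) tens) proobj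
    \<Rightarrow> ('i, 'a, ('b, 'b) tens, 'q, ('b, 'b) tens) proobj
    \<Rightarrow> ('i, 'a, ('b, 'b) tens, ('p, 'q) tens, ('b, 'b) tens) proobj" where
  "pro_dia K B F G = \<lparr>Idx = Idx F, Obj = (\<lambda>i. dia K B (Obj F i) (Obj G i)),
     Map = Map (pro_tensor B (pro_left_view K B F) (pro_left_view K B G))\<rparr>"

definition pro_takeuchi ::
  "('k, 'x) ring_scheme \<Rightarrow> ('k, 'b, 'y) module_scheme
    \<Rightarrow> ('i, 'a, ('b, 'b) tens, 'p, ('b, 'b) tens) proobj
    \<Rightarrow> ('i, 'a, ('b, 'b) tens, 'q, ('b, 'b) tens) proobj
    \<Rightarrow> ('i, 'a, ('b, 'b) tens, ('p, 'q) tens, ('b, 'b) tens) proobj" where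
  "pro_takeuchi K B F G = \<lparr>Idx = Idx F, Obj = (\<lambda>i. takeuchi K B (Obj F i) (Obj G i)),
     Map = Map (pro_dia K B F G)\<rparr>"

text \<open>The tensor product of \<open>f : F \<rightarrow> G\<close> and \<open>f' : F' \<rightarrow> G'\<close>: at \<open>k\<close>, the two maps are first pulled
  back along arrows \<open>i \<rightarrow> \<rho> k\<close> and \<open>i \<rightarrow> \<rho>' k\<close> to a common index \<open>i\<close>. Up to \<open>pro_eq\<close> the result does
  not depend on the choice of these arrows.\<close>

definition common_arrows :: "('i, 'a) cat \<Rightarrow> 'i \<Rightarrow> 'i \<Rightarrow> 'a \<times> 'a" where
  "common_arrows I i j =
     (SOME uv. fst uv \<in> Arr I \<and> snd uv \<in> Arr I \<and> Dom I (fst uv) = Dom I (snd uv) \<and>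
        Cod I (fst uv) = i \<and> Cod I (snd uv) = j)"

definition pro_tensor_mor ::
  "('s, 'y) ring_scheme
    \<Rightarrow> ('i, 'a, 'r, 'p, 's) proobj \<Rightarrow> ('i, 'a, 's, 'q, 't) proobj
    \<Rightarrow> ('j, 'c, 'r, 'p', 's) proobj \<Rightarrow> ('j, 'c, 's, 'q', 't) proobj
    \<Rightarrow> ('i, 'j, 'p, 'p') promor \<Rightarrow> ('i, 'j, 'q, 'q') promor
    \<Rightarrow> ('i, 'j, ('p, 'q) tens, ('p', 'q') tens) promor" where
  "pro_tensor_mor S F F' G G' f f' =
     (let c = (\<lambda>k. common_arrows (Idx F) (fst f k) (fst f' k))
      in ((\<lambda>k. Dom (Idx F) (fst (c k))),
          (\<lambda>k. tensor_map S (Obj G k) (Obj G' k)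
             (\<lambda>x. snd f k (Map F (fst (c k)) x)) (\<lambda>x. snd f' k (Map F' (snd (c k)) x)))))"


section \<open>Pro-rings and pro-corings\<close>

definition pro_assoc ::
  "('s, 'y) ring_scheme \<Rightarrow> ('i, 'a, 's, 'p, 's) proobj
    \<Rightarrow> ('i, 'i, (('p, 'p) tens, 'p) tens, ('p, ('p, 'p) tens) tens) promor" where
  "pro_assoc R A = pro_level (\<lambda>k. assoc_map R (Obj A k) (Obj (pro_tensor R A A) k)
     (tensor R (Obj A k) (Obj A k)))"

text \<open>The unit isomorphisms \<open>R \<otimes>\<^sub>R A \<rightarrow> A\<close> and \<open>A \<otimes>\<^sub>R R \<rightarrow> A\<close>.\<close>

definition pro_lunit ::
  "('i, 'a, 'r, 'm, 's) proobj \<Rightarrow> ('i, 'i, ('r, 'm) tens, 'm) promor" where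
  "pro_lunit A = pro_level (\<lambda>k. tlift (Obj A k) (\<lambda>r x. r \<odot>\<^bsub>Obj A k\<^esub> x))"

definition pro_runit ::
  "('i, 'a, 'r, 'm, 's) proobj \<Rightarrow> ('i, 'i, ('m, 's) tens, 'm) promor" where
  "pro_runit A = pro_level (\<lambda>k. tlift (Obj A k) (\<lambda>x s. rsmult (Obj A k) x s))"

definition pro_ring ::
  "('k, 'x) ring_scheme \<Rightarrow> ('k, 'r, 'y) module_scheme \<Rightarrow> ('i, 'a, 'r, 'm, 'r) proobj
    \<Rightarrow> ('i, 'i, ('m, 'm) tens, 'm) promor \<Rightarrow> ('i, 'i, 'r, 'm) promor \<Rightarrow> bool" where
  "pro_ring K R A m \<eta> \<longleftrightarrow>
     (let AA = pro_tensor R A A; U = const_pro (Idx A) (regular R)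
      in pro_object K R R A \<and> m \<in> pro_mor R R AA A \<and> \<eta> \<in> pro_mor R R U A \<and>
         pro_eq (pro_tensor R AA A) A
           (pro_comp m (pro_tensor_mor R AA A A A m pro_id))
           (pro_comp m (pro_comp (pro_tensor_mor R A AA A A pro_id m) (pro_assoc R A))) \<and>
         pro_eq (pro_tensor R U A) A
           (pro_comp m (pro_tensor_mor R U A A A \<eta> pro_id)) (pro_lunit A) \<and>
         pro_eq (pro_tensor R A U) A
           (pro_comp m (pro_tensor_mor R A U A A pro_id \<eta>)) (pro_runit A))"

definition pro_coring ::
  "('k, 'x) ring_scheme \<Rightarrow> ('k, 'r, 'y) module_scheme \<Rightarrow> ('i, 'a, 'r, 'm, 'r) proobj
    \<Rightarrow> ('i, 'i, 'm, ('m, 'm) tens) promor \<Rightarrow> ('i, 'i, 'm, 'r) promor \<Rightarrow> bool" where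
  "pro_coring K R D \<Delta> \<epsilon> \<longleftrightarrow>
     (let DD = pro_tensor R D D; U = const_pro (Idx D) (regular R)
      in pro_object K R R D \<and> \<Delta> \<in> pro_mor R R D DD \<and> \<epsilon> \<in> pro_mor R R D U \<and>
         pro_eq D (pro_tensor R D DD)
           (pro_comp (pro_assoc R D) (pro_comp (pro_tensor_mor R D D DD D \<Delta> pro_id) \<Delta>))
           (pro_comp (pro_tensor_mor R D D D DD pro_id \<Delta>) \<Delta>) \<and>
         pro_eq D D
           (pro_comp (pro_lunit D) (pro_comp (pro_tensor_mor R D D U D \<epsilon> pro_id) \<Delta>)) pro_id \<and>
         pro_eq D D
           (pro_comp (pro_runit D) (pro_comp (pro_tensor_mor R D D D U pro_id \<epsilon>) \<Delta>)) pro_id)"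


section \<open>Pro-Hopf algebroids\<close>

text \<open>The factorwise product \<open>(p \<diamond> q) (p' \<diamond> q') = p p' \<diamond> q q'\<close> of the Takeuchi product. The inner
  sum has to run over the left factor \<open>X\<close>: for a fixed right factor, the expression is balanced in
  \<open>p, q\<close>, but it is balanced in \<open>p', q'\<close> only after summation over an \<open>X\<close> in the Takeuchi product.\<close>

definition takeuchi_mult ::
  "('k, 'x) ring_scheme \<Rightarrow> ('k, 'b, 'y) module_scheme
    \<Rightarrow> ('i, 'a, ('b, 'b) tens, 'm, ('b, 'b) tens) proobj \<Rightarrow> ('i, 'i, ('m, 'm) tens, 'm) promor
    \<Rightarrow> ('i, 'i, (('m, 'm) tens, ('m, 'm) tens) tens, ('m, 'm) tens) promor" where
  "takeuchi_mult K B L m =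
     (fst m, \<lambda>k. let M = Obj L (fst m k); V = left_view K B (Obj L k); G = tensor_group B V V;
                    prod = (\<lambda>x y. snd m k (tensor (env K B) M M x y))
       in tlift G (\<lambda>X Y. tlift G (\<lambda>p' q'. tlift G (\<lambda>p q. tensor B V V (prod p p') (prod q q')) X) Y))"

text \<open>For a homomorphism \<open>f\<close> from an algebra \<open>S\<close> to the enveloping algebra (source, target, or the
  scalars), \<open>L \<otimes>\<^sub>S L\<close> formed with the right action on the first and the left action on the second factor,
  and the product as a morphism on \<open>L \<otimes>\<^sub>S L\<close>. The remaining structure is the left action on the first
  and the right action on the second factor.\<close>

definition pro_tensor_along ::
  "('s, 'y) ring_scheme \<Rightarrow> ('s \<Rightarrow> 'e) \<Rightarrow> ('i, 'a, 'e, 'm, 'e) proobj \<Rightarrow> ('i, 'a, 'e, ('m, 'm) tens, 'e) proobj"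
  where
  "pro_tensor_along S f L = pro_tensor S (pro_restr (\<lambda>x. x) f L) (pro_restr f (\<lambda>x. x) L)"

definition mult_along ::
  "('e, 'y) ring_scheme \<Rightarrow> ('i, 'a, 'e, 'm, 'e) proobj \<Rightarrow> ('i, 'i, ('m, 'm) tens, 'm) promor
    \<Rightarrow> ('i, 'i, ('m, 'm) tens, 'm) promor" where
  "mult_along E L m = pro_comp m (pro_level (\<lambda>k.
     tlift (tensor_group E (Obj L k) (Obj L k)) (tensor E (Obj L k) (Obj L k))))"

text \<open>\<open>\<Delta> \<in> Hom (L, L \<times>\<^sub>B L)\<close> is read in bimodules over the enveloping algebra, as is necessary for
  \<open>\<Delta> \<otimes> \<Delta>\<close> to make sense; the representative \<open>\<Delta>\<close> itself is required to take values in the Takeuchi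
  product, which is no restriction on the represented morphism. No flatness is imposed on modules.
  In the last two clauses \<open>\<otimes>\<close> is the tensor product over the ground field: \<open>s \<circ> \<epsilon>\<close> and \<open>t \<circ> \<epsilon>\<close> are not
  linear over the enveloping algebra.\<close>

definition pro_left_bialgebroid ::
  "('k, 'x) ring_scheme \<Rightarrow> ('k, 'b, 'y) module_scheme
    \<Rightarrow> ('i, 'a, ('b, 'b) tens, 'm, ('b, 'b) tens) proobj
    \<Rightarrow> ('i, 'i, ('m, 'm) tens, 'm) promor \<Rightarrow> ('i, 'i, ('b, 'b) tens, 'm) promor
    \<Rightarrow> ('i, 'i, 'm, ('m, 'm) tens) promor \<Rightarrow> ('i, 'i, 'm, 'b) promor \<Rightarrow> bool" where
  "pro_left_bialgebroid K B L m \<eta> \<Delta> \<epsilon> \<longleftrightarrow>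
     (let E = env K B; T = pro_takeuchi K B L L;
          s = pro_comp \<eta> (pro_level (\<lambda>k. src K B)); t = pro_comp \<eta> (pro_level (\<lambda>k. tgt K B));
          RK = pro_restr (\<lambda>x. x) (scal K B) L; LK = pro_restr (scal K B) (\<lambda>x. x) L;
          LL = pro_tensor_along K (scal K B) L; U = const_pro (Idx L) (regular B);
          \<epsilon>m = pro_comp \<epsilon> (mult_along E L m)
      in k_algebra K B \<and> pro_ring K E L m \<eta> \<and> pro_coring K B (pro_left_view K B L) \<Delta> \<epsilon> \<and>
         \<Delta> \<in> pro_mor E E L T \<and>
         pro_eq (pro_tensor E L L) T
           (pro_comp \<Delta> m)
           (pro_comp (takeuchi_mult K B L m) (pro_tensor_mor E L L T T \<Delta> \<Delta>)) \<and>
         pro_eq LL U \<epsilon>m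
           (pro_comp \<epsilon>m (pro_tensor_mor K RK LK RK LK pro_id (pro_comp s \<epsilon>))) \<and>
         pro_eq LL U
           (pro_comp \<epsilon>m (pro_tensor_mor K RK LK RK LK pro_id (pro_comp s \<epsilon>)))
           (pro_comp \<epsilon>m (pro_tensor_mor K RK LK RK LK pro_id (pro_comp t \<epsilon>))))"

text \<open>\<open>X \<otimes> Y \<mapsto> X\<^sub>1 \<diamond> X\<^sub>2 Y\<close>: the composition of \<open>\<Delta> \<otimes> id\<close>, the rebracketing
  \<open>(p \<diamond> q) \<otimes> Y \<mapsto> p \<diamond> (q \<otimes> Y)\<close> and \<open>id \<diamond> m\<close>.\<close>

definition hopf_map ::
  "('k, 'x) ring_scheme \<Rightarrow> ('k, 'b, 'y) module_scheme
    \<Rightarrow> ('i, 'a, ('b, 'b) tens, 'm, ('b, 'b) tens) proobj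
    \<Rightarrow> ('i, 'i, ('m, 'm) tens, 'm) promor \<Rightarrow> ('i, 'i, 'm, ('m, 'm) tens) promor
    \<Rightarrow> ('i, 'i, ('m, 'm) tens, ('m, 'm) tens) promor" where
  "hopf_map K B L m \<Delta> =
     (let Bo = op_alg B;
          R = pro_restr (\<lambda>x. x) (tgt K B) L;
          RD = pro_restr (\<lambda>x. x) (tgt K B) (pro_dia K B L L);
          F = pro_restr (tgt K B) (\<lambda>x. x) L;
          V = pro_left_view K B L;
          W = pro_left_view K B (pro_tensor_along Bo (tgt K B) L)
      in pro_comp (pro_tensor_mor B V W V V pro_id (mult_along (env K B) L m))
           (pro_comp
             (pro_level (\<lambda>k. assoc_map B (Obj V k) (Obj W k) (tensor Bo (Obj R k) (Obj F k))))
             (pro_tensor_mor Bo R F RD F \<Delta> pro_id)))"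

text \<open>\<open>X \<otimes> Y \<mapsto> X\<^sub>1 Y \<diamond> X\<^sub>2\<close>: the composition of \<open>\<Delta> \<otimes> id\<close>, the rebracketing
  \<open>(p \<diamond> q) \<otimes> Y \<mapsto> (p \<otimes> Y) \<diamond> q\<close> and \<open>m \<diamond> id\<close>.\<close>

definition anti_hopf_map ::
  "('k, 'x) ring_scheme \<Rightarrow> ('k, 'b, 'y) module_scheme
    \<Rightarrow> ('i, 'a, ('b, 'b) tens, 'm, ('b, 'b) tens) proobj
    \<Rightarrow> ('i, 'i, ('m, 'm) tens, 'm) promor \<Rightarrow> ('i, 'i, 'm, ('m, 'm) tens) promor
    \<Rightarrow> ('i, 'i, ('m, 'm) tens, ('m, 'm) tens) promor" where
  "anti_hopf_map K B L m \<Delta> =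
     (let R = pro_restr (\<lambda>x. x) (src K B) L;
          RD = pro_restr (\<lambda>x. x) (src K B) (pro_dia K B L L);
          F = pro_restr (src K B) (\<lambda>x. x) L;
          V = pro_left_view K B L;
          W = pro_left_view K B (pro_tensor_along B (src K B) L)
      in pro_comp (pro_tensor_mor B W V V V (mult_along (env K B) L m) pro_id)
           (pro_comp
             (pro_level (\<lambda>k. flip_assoc_map B (Obj W k) (Obj V k) (tensor B (Obj R k) (Obj F k))))
             (pro_tensor_mor B R F RD F \<Delta> pro_id)))"

text \<open>Invertibility is taken among \<open>B\<close>-bimodules with the actions by left multiplication,
  \<open>a.(X \<otimes> Y).b = a \<langle>b\<rangle> X \<otimes> Y\<close> and \<open>a.(p \<diamond> q).b = a p \<diamond> \<langle>b\<rangle> q\<close>.\<close>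

definition pro_left_Hopf_algebroid ::
  "('k, 'x) ring_scheme \<Rightarrow> ('k, 'b, 'y) module_scheme
    \<Rightarrow> ('i, 'a, ('b, 'b) tens, 'm, ('b, 'b) tens) proobj
    \<Rightarrow> ('i, 'i, ('m, 'm) tens, 'm) promor \<Rightarrow> ('i, 'i, ('b, 'b) tens, 'm) promor
    \<Rightarrow> ('i, 'i, 'm, ('m, 'm) tens) promor \<Rightarrow> ('i, 'i, 'm, 'b) promor \<Rightarrow> bool" where
  "pro_left_Hopf_algebroid K B L m \<eta> \<Delta> \<epsilon> \<longleftrightarrow> pro_left_bialgebroid K B L m \<eta> \<Delta> \<epsilon> \<and>
     pro_invertible B B (pro_left_view K B (pro_tensor_along (op_alg B) (tgt K B) L))
       (pro_tensor B (pro_left_view K B L) (pro_left_view K B L)) (hopf_map K B L m \<Delta>)"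

definition pro_anti_left_Hopf_algebroid ::
  "('k, 'x) ring_scheme \<Rightarrow> ('k, 'b, 'y) module_scheme
    \<Rightarrow> ('i, 'a, ('b, 'b) tens, 'm, ('b, 'b) tens) proobj
    \<Rightarrow> ('i, 'i, ('m, 'm) tens, 'm) promor \<Rightarrow> ('i, 'i, ('b, 'b) tens, 'm) promor
    \<Rightarrow> ('i, 'i, 'm, ('m, 'm) tens) promor \<Rightarrow> ('i, 'i, 'm, 'b) promor \<Rightarrow> bool" where
  "pro_anti_left_Hopf_algebroid K B L m \<eta> \<Delta> \<epsilon> \<longleftrightarrow> pro_left_bialgebroid K B L m \<eta> \<Delta> \<epsilon> \<and>
     pro_invertible B B (pro_left_view K B (pro_tensor_along B (src K B) L))
       (pro_tensor B (pro_left_view K B L) (pro_left_view K B L)) (anti_hopf_map K B L m \<Delta>)"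

definition pro_Hopf_algebroid ::
  "('k, 'x) ring_scheme \<Rightarrow> ('k, 'b, 'y) module_scheme
    \<Rightarrow> ('i, 'a, ('b, 'b) tens, 'm, ('b, 'b) tens) proobj
    \<Rightarrow> ('i, 'i, ('m, 'm) tens, 'm) promor \<Rightarrow> ('i, 'i, ('b, 'b) tens, 'm) promor
    \<Rightarrow> ('i, 'i, 'm, ('m, 'm) tens) promor \<Rightarrow> ('i, 'i, 'm, 'b) promor \<Rightarrow> bool" where
  "pro_Hopf_algebroid K B L m \<eta> \<Delta> \<epsilon> \<longleftrightarrow>
     pro_left_Hopf_algebroid K B L m \<eta> \<Delta> \<epsilon> \<and> pro_anti_left_Hopf_algebroid K B L m \<eta> \<Delta> \<epsilon>"


section \<open>The pair Hopf algebroid and its pro-quotient\<close>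

text \<open>Underlying ring and unit map of the pair Hopf algebroid are \<open>env K B\<close> and the identity.\<close>

definition pair_coproduct ::
  "('k, 'x) ring_scheme \<Rightarrow> ('k, 'b, 'y) module_scheme
    \<Rightarrow> ('b, 'b) tens \<Rightarrow> (('b, 'b) tens, ('b, 'b) tens) tens" where
  "pair_coproduct K B =
     (let V = left_view K B (regular (env K B))
      in tlift (tensor_group B V V) (\<lambda>a a'. tensor B V V (src K B a) (tgt K B a')))"

definition pair_counit ::
  "('k, 'x) ring_scheme \<Rightarrow> ('k, 'b, 'y) module_scheme \<Rightarrow> ('b, 'b) tens \<Rightarrow> 'b" where
  "pair_counit K B = tlift B (\<lambda>a a'. a \<otimes>\<^bsub>B\<^esub> a')"

text \<open>For commutative \<open>B\<close>, \<open>pair_counit\<close> is also the product map whose kernel is \<open>\<mu>\<close>.\<close>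

definition mu_ideal ::
  "('k, 'x) ring_scheme \<Rightarrow> ('k, 'b, 'y) module_scheme \<Rightarrow> ('b, 'b) tens set" where
  "mu_ideal K B = a_kernel (env K B) B (pair_counit K B)"

definition mu_power ::
  "('k, 'x) ring_scheme \<Rightarrow> ('k, 'b, 'y) module_scheme \<Rightarrow> nat \<Rightarrow> ('b, 'b) tens set" where
  "mu_power K B i = mu_ideal K B [^]\<^bsub>ideals_set (env K B)\<^esub> i"

definition nat_cat :: "(nat, nat \<times> nat) cat" where
  "nat_cat = \<lparr>Ob = UNIV, Arr = {(k', k). k \<le> k'}, Dom = fst, Cod = snd,
     Ident = (\<lambda>k. (k, k)), Cmp = (\<lambda>v u. (fst u, snd v))\<rparr>"

definition quot ::
  "('k, 'x) ring_scheme \<Rightarrow> ('k, 'b, 'y) module_scheme \<Rightarrow> nat \<Rightarrow> ('b, 'b) tens \<Rightarrow> ('b, 'b) tens set"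
  where
  "quot K B i x = mu_power K B i +>\<^bsub>env K B\<^esub> x"

text \<open>The quotient map along \<open>k' \<rightarrow> k\<close> adds the larger ideal to a coset of the smaller one.\<close>

definition JJ ::
  "('k, 'x) ring_scheme \<Rightarrow> ('k, 'b, 'y) module_scheme
    \<Rightarrow> (nat, nat \<times> nat, ('b, 'b) tens, ('b, 'b) tens set, ('b, 'b) tens) proobj" where
  "JJ K B = \<lparr>Idx = nat_cat,
     Obj = (\<lambda>i. ring_bimod (quot K B i) (env K B Quot mu_power K B i)),
     Map = (\<lambda>u X. mu_power K B (snd u) <+>\<^bsub>env K B\<^esub> X)\<rparr>"

definition JJ_mult ::
  "('k, 'x) ring_scheme \<Rightarrow> ('k, 'b, 'y) module_scheme
    \<Rightarrow> (nat, nat, (('b, 'b) tens set, ('b, 'b) tens set) tens, ('b, 'b) tens set) promor" where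
  "JJ_mult K B = pro_level (\<lambda>k. let Q = env K B Quot mu_power K B k in tlift Q (\<lambda>x y. x \<otimes>\<^bsub>Q\<^esub> y))"

definition JJ_unit ::
  "('k, 'x) ring_scheme \<Rightarrow> ('k, 'b, 'y) module_scheme
    \<Rightarrow> (nat, nat, ('b, 'b) tens, ('b, 'b) tens set) promor" where
  "JJ_unit K B = pro_level (quot K B)"

definition JJ_coproduct ::
  "('k, 'x) ring_scheme \<Rightarrow> ('k, 'b, 'y) module_scheme
    \<Rightarrow> (nat, nat, ('b, 'b) tens set, (('b, 'b) tens set, ('b, 'b) tens set) tens) promor" where
  "JJ_coproduct K B =
     ((\<lambda>k. 2 * k),
      (\<lambda>k X. let V = left_view K B (Obj (JJ K B) k)
             in tensor_map B V V (quot K B k) (quot K B k) (pair_coproduct K B (SOME x. x \<in> X))))"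

text \<open>The counit descends to the quotient by \<open>\<mu>\<^sup>i\<close> for \<open>i \<ge> 1\<close> but not to the zero ring at \<open>i = 0\<close>.
  As its target is constant, level \<open>1\<close> represents it at \<open>k = 0\<close>.\<close>

definition JJ_counit ::
  "('k, 'x) ring_scheme \<Rightarrow> ('k, 'b, 'y) module_scheme
    \<Rightarrow> (nat, nat, ('b, 'b) tens set, 'b) promor" where
  "JJ_counit K B = ((\<lambda>k. max k 1), (\<lambda>k X. pair_counit K B (SOME x. x \<in> X)))"

end

theory Submission
  imports Defs
begin

text \<open>As \<open>B\<close> is commutative, the enveloping algebra \<open>E = B \<otimes> B\<close>, its quotients \<open>J(k) = E/\<mu>\<^sup>k\<close> and all
  tensor products of two such quotients are commutative rings, and \<open>E\<close> is additively generated by the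
  elements \<open>s(a) t(b)\<close>. Each law of a pro-Hopf algebroid compares two additive maps between iterated
  tensor products of the \<open>J(k)\<close>, so that it has only to be verified on classes of elements \<open>s(a) t(b)\<close>,
  where it is the corresponding law of the pair Hopf algebroid.

  What needs an argument is that the structure maps exist on the quotients. The product and the counit
  descend because \<open>\<mu>\<^sup>k\<close> is an ideal contained in \<open>\<mu>\<close> for \<open>k \<ge> 1\<close>. The coproduct and the inverses of the two Hopf maps
  come from ring homomorphisms \<open>\<psi>\<close> from \<open>E\<close> to the tensor product \<open>T\<close> of two copies of \<open>J(k)\<close>, given by
  their values on \<open>s(a)\<close> and \<open>t(a)\<close>. In each case \<open>\<psi>(s(a)) - \<psi>(t(a)) = u \<otimes> 1 + 1 \<otimes> v\<close> with \<open>u\<close> and \<open>v\<close> in \<open>\<mu>\<close>: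
  one passes from \<open>\<psi>(s(a))\<close> to \<open>\<psi>(t(a))\<close> by exchanging \<open>s\<close> and \<open>t\<close> in one factor, moving the element across the
  tensor sign and exchanging them again. A product of \<open>2k\<close> such sums expands into terms that have at least \<open>k\<close>
  factors on one side and therefore vanish, so \<open>\<psi>\<close> factors through \<open>J(2k)\<close> (\<open>vanish_mu_double\<close>). This is why
  these maps lower the level from \<open>2k\<close> to \<open>k\<close> and live on the pro-object.

  For the coproduct, \<open>\<psi>\<close> is \<open>s(a) t(b) \<mapsto> s(a) \<diamond> t(b)\<close> (\<open>psiD_vanish\<close>). Both actions of \<open>E\<close> on \<open>J \<diamond> J\<close> are
  multiplications with values of \<open>\<psi>\<close>, and the Takeuchi product is all of \<open>J \<diamond> J\<close> (\<open>takeuchi_eq_dia\<close>), since its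
  defining condition turns into a defining relation of \<open>J \<diamond> J\<close> when left and right multiplication agree.
  Multiplicativity of the coproduct is then multiplicativity of \<open>\<psi>\<close>.

  The Hopf map is \<open>s(a) t(b) \<otimes> y \<mapsto> s(a) \<diamond> t(b) y\<close>, with inverse \<open>s(a) t(b) \<diamond> y \<mapsto> s(a) \<otimes> s(b) y\<close>; here
  \<open>\<psi>(s(a)) = s(a) \<otimes> 1\<close> and \<open>\<psi>(t(b)) = 1 \<otimes> s(b)\<close> (\<open>psi_vanish\<close>). Both composites are transition maps of the
  pro-objects because \<open>t(b)\<close> moves across \<open>\<otimes>\<close>, and \<open>t(b)\<close> on the left of \<open>\<diamond>\<close> becomes \<open>s(b)\<close> on its right
  (\<open>f_invertible\<close>). The other Hopf map is the mirror image, with the roles of \<open>s\<close> and \<open>t\<close> and the factors of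
  \<open>J \<diamond> J\<close> exchanged.\<close>

section \<open>Additive maps and the universal property of the tensor product\<close>

definition add_hom :: "('a, 'x) ring_scheme \<Rightarrow> ('b, 'y) ring_scheme \<Rightarrow> ('a \<Rightarrow> 'b) set" where
  "add_hom M N = {f. (\<forall>x \<in> carrier M. f x \<in> carrier N) \<and>
     (\<forall>x \<in> carrier M. \<forall>y \<in> carrier M. f (x \<oplus>\<^bsub>M\<^esub> y) = f x \<oplus>\<^bsub>N\<^esub> f y)}"

lemma add_homI:
  assumes "\<And>x. x \<in> carrier M \<Longrightarrow> f x \<in> carrier N"
    and "\<And>x y. x \<in> carrier M \<Longrightarrow> y \<in> carrier M \<Longrightarrow> f (x \<oplus>\<^bsub>M\<^esub> y) = f x \<oplus>\<^bsub>N\<^esub> f y"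
  shows "f \<in> add_hom M N"
  using assms by (simp add: add_hom_def)

lemma add_hom_closed: "f \<in> add_hom M N \<Longrightarrow> x \<in> carrier M \<Longrightarrow> f x \<in> carrier N"
  by (simp add: add_hom_def)

lemma add_hom_add:
  "f \<in> add_hom M N \<Longrightarrow> x \<in> carrier M \<Longrightarrow> y \<in> carrier M \<Longrightarrow> f (x \<oplus>\<^bsub>M\<^esub> y) = f x \<oplus>\<^bsub>N\<^esub> f y"
  by (simp add: add_hom_def)

lemma add_hom_comp: "f \<in> add_hom N P \<Longrightarrow> g \<in> add_hom M N \<Longrightarrow> (\<lambda>x. f (g x)) \<in> add_hom M P"
  by (simp add: add_hom_def)

lemma add_hom_cong:
  assumes "carrier M = carrier M'" "add M = add M'" "carrier N = carrier N'" "add N = add N'"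
  shows "add_hom M N = add_hom M' N'"
  using assms by (simp add: add_hom_def)

lemma abelian_group_a_closed:
  "abelian_group M \<Longrightarrow> x \<in> carrier M \<Longrightarrow> y \<in> carrier M \<Longrightarrow> x \<oplus>\<^bsub>M\<^esub> y \<in> carrier M"
  by (simp add: abelian_group_def abelian_monoid.a_closed)

lemma add_hom_zero:
  assumes "f \<in> add_hom M N" "abelian_group M" "abelian_group N"
  shows "f \<zero>\<^bsub>M\<^esub> = \<zero>\<^bsub>N\<^esub>"
proof -
  interpret M: abelian_group M by fact
  interpret N: abelian_group N by fact
  have "f \<zero>\<^bsub>M\<^esub> \<oplus>\<^bsub>N\<^esub> f \<zero>\<^bsub>M\<^esub> = f \<zero>\<^bsub>M\<^esub>"
    using add_hom_add[OF assms(1) M.zero_closed M.zero_closed] by simp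
  then show ?thesis
    using add_hom_closed[OF assms(1) M.zero_closed] by (metis N.add.r_cancel_one')
qed

lemma add_hom_plus:
  assumes "f \<in> add_hom M N" "g \<in> add_hom M N" "abelian_group N"
  shows "(\<lambda>x. f x \<oplus>\<^bsub>N\<^esub> g x) \<in> add_hom M N"
proof -
  interpret N: abelian_group N by fact
  show ?thesis
    using assms(1,2) by (auto simp: add_hom_def N.a_ac)
qed

lemma abelian_group_cong:
  fixes M :: "('a, 'x) ring_scheme" and N :: "('a, 'y) ring_scheme"
  assumes "abelian_group M" "carrier N = carrier M" "add N = add M" "zero N = zero M"
  shows "abelian_group N"
proof -
  interpret M: abelian_group M by fact
  show ?thesis
  proof (rule abelian_groupI, unfold assms(2-4))
    show "\<exists>y\<in>carrier M. y \<oplus>\<^bsub>M\<^esub> x = \<zero>\<^bsub>M\<^esub>" if "x \<in> carrier M" for x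
      using that M.l_neg by blast
  qed (auto simp: M.a_ac)
qed

text \<open>The sum over the support of a formal combination does not change if it runs over a larger
  finite set, which makes it visibly additive.\<close>

lemma finsum_keys_add_hom:
  fixes c d :: "'b \<Rightarrow>\<^sub>0 int"
  assumes "abelian_group M" and f: "\<And>x. x \<in> S \<Longrightarrow> f x \<in> carrier M"
    and c: "Poly_Mapping.keys c \<subseteq> S" and d: "Poly_Mapping.keys d \<subseteq> S"
  defines "h \<equiv> \<lambda>c. \<Oplus>\<^bsub>M\<^esub>x \<in> Poly_Mapping.keys c. [Poly_Mapping.lookup c x] \<cdot>\<^bsub>M\<^esub> f x"
  shows "h (c + d) = h c \<oplus>\<^bsub>M\<^esub> h d"
proof -
  interpret M: abelian_group M by fact
  let ?A = "Poly_Mapping.keys c \<union> Poly_Mapping.keys d"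
  have fA: "f x \<in> carrier M" if "x \<in> ?A" for x
    using that c d f by blast
  have cl: "[n] \<cdot>\<^bsub>M\<^esub> f x \<in> carrier M" if "x \<in> ?A" for x and n :: int
    unfolding add_pow_def using group.int_pow_closed[OF M.a_group, of "f x" n] fA[OF that] by simp
  have extend: "h e = (\<Oplus>\<^bsub>M\<^esub>x \<in> ?A. [Poly_Mapping.lookup e x] \<cdot>\<^bsub>M\<^esub> f x)"
    if "Poly_Mapping.keys e \<subseteq> ?A" for e :: "'b \<Rightarrow>\<^sub>0 int"
    unfolding h_def
  proof (rule M.add.finprod_mono_neutral_cong_left)
    fix x assume "x \<in> ?A - Poly_Mapping.keys e"
    then show "[Poly_Mapping.lookup e x] \<cdot>\<^bsub>M\<^esub> f x = \<zero>\<^bsub>M\<^esub>"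
      by (simp add: in_keys_iff add_pow_def)
  qed (use that cl in auto)
  have "h (c + d) = (\<Oplus>\<^bsub>M\<^esub>x \<in> ?A. [Poly_Mapping.lookup c x] \<cdot>\<^bsub>M\<^esub> f x \<oplus>\<^bsub>M\<^esub> [Poly_Mapping.lookup d x] \<cdot>\<^bsub>M\<^esub> f x)"
    unfolding extend[OF Poly_Mapping.keys_add]
  proof (rule M.add.finprod_cong')
    show "[Poly_Mapping.lookup (c + d) x] \<cdot>\<^bsub>M\<^esub> f x
        = [Poly_Mapping.lookup c x] \<cdot>\<^bsub>M\<^esub> f x \<oplus>\<^bsub>M\<^esub> [Poly_Mapping.lookup d x] \<cdot>\<^bsub>M\<^esub> f x" if "x \<in> ?A" for x
      unfolding add_pow_def Poly_Mapping.lookup_add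
      using group.int_pow_mult[OF M.a_group, of "f x"] fA[OF that] by simp
  qed (use cl in auto)
  also have "\<dots> = h c \<oplus>\<^bsub>M\<^esub> h d"
    using cl by (subst M.finsum_addf) (auto simp: extend)
  finally show ?thesis .
qed

definition balanced ::
  "('s, 'y) ring_scheme \<Rightarrow> ('r, 'p, 's) bimod \<Rightarrow> ('s, 'q, 't) bimod \<Rightarrow> ('n, 'z) ring_scheme
    \<Rightarrow> ('p \<Rightarrow> 'q \<Rightarrow> 'n) \<Rightarrow> bool" where
  "balanced S P Q M f \<longleftrightarrow>
     (\<forall>q \<in> carrier Q. (\<lambda>p. f p q) \<in> add_hom P M) \<and> (\<forall>p \<in> carrier P. f p \<in> add_hom Q M) \<and>
     (\<forall>p \<in> carrier P. \<forall>s \<in> carrier S. \<forall>q \<in> carrier Q. f (rsmult P p s) q = f p (s \<odot>\<^bsub>Q\<^esub> q))"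

lemma balancedI:
  assumes "\<And>p q. p \<in> carrier P \<Longrightarrow> q \<in> carrier Q \<Longrightarrow> f p q \<in> carrier M"
    and "\<And>p p' q. p \<in> carrier P \<Longrightarrow> p' \<in> carrier P \<Longrightarrow> q \<in> carrier Q \<Longrightarrow>
      f (p \<oplus>\<^bsub>P\<^esub> p') q = f p q \<oplus>\<^bsub>M\<^esub> f p' q"
    and "\<And>p q q'. p \<in> carrier P \<Longrightarrow> q \<in> carrier Q \<Longrightarrow> q' \<in> carrier Q \<Longrightarrow>
      f p (q \<oplus>\<^bsub>Q\<^esub> q') = f p q \<oplus>\<^bsub>M\<^esub> f p q'"
    and "\<And>p s q. p \<in> carrier P \<Longrightarrow> s \<in> carrier S \<Longrightarrow> q \<in> carrier Q \<Longrightarrow>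
      f (rsmult P p s) q = f p (s \<odot>\<^bsub>Q\<^esub> q)"
  shows "balanced S P Q M f"
  using assms by (simp add: balanced_def add_hom_def)

lemma balancedD:
  assumes "balanced S P Q M f"
  shows "p \<in> carrier P \<Longrightarrow> q \<in> carrier Q \<Longrightarrow> f p q \<in> carrier M"
    and "p \<in> carrier P \<Longrightarrow> p' \<in> carrier P \<Longrightarrow> q \<in> carrier Q \<Longrightarrow>
      f (p \<oplus>\<^bsub>P\<^esub> p') q = f p q \<oplus>\<^bsub>M\<^esub> f p' q"
    and "p \<in> carrier P \<Longrightarrow> q \<in> carrier Q \<Longrightarrow> q' \<in> carrier Q \<Longrightarrow>
      f p (q \<oplus>\<^bsub>Q\<^esub> q') = f p q \<oplus>\<^bsub>M\<^esub> f p q'"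
    and "p \<in> carrier P \<Longrightarrow> s \<in> carrier S \<Longrightarrow> q \<in> carrier Q \<Longrightarrow>
      f (rsmult P p s) q = f p (s \<odot>\<^bsub>Q\<^esub> q)"
  using assms by (simp_all add: balanced_def add_hom_def)

text \<open>One-sided actions by additive maps: the part of a module structure on which the tensor product
  and its induced maps depend.\<close>

definition left_act :: "('r, 'y) ring_scheme \<Rightarrow> ('r, 'm, 's) bimod \<Rightarrow> bool" where
  "left_act R M \<longleftrightarrow> abelian_group M \<and> (\<forall>r \<in> carrier R. smult M r \<in> add_hom M M)"

definition right_act :: "('s, 'y) ring_scheme \<Rightarrow> ('r, 'm, 's) bimod \<Rightarrow> bool" where
  "right_act S M \<longleftrightarrow> abelian_group M \<and> (\<forall>s \<in> carrier S. (\<lambda>x. rsmult M x s) \<in> add_hom M M)"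

lemma left_actD:
  assumes "left_act R M"
  shows "abelian_group M"
    and "r \<in> carrier R \<Longrightarrow> x \<in> carrier M \<Longrightarrow> r \<odot>\<^bsub>M\<^esub> x \<in> carrier M"
    and "r \<in> carrier R \<Longrightarrow> x \<in> carrier M \<Longrightarrow> y \<in> carrier M \<Longrightarrow>
      r \<odot>\<^bsub>M\<^esub> (x \<oplus>\<^bsub>M\<^esub> y) = r \<odot>\<^bsub>M\<^esub> x \<oplus>\<^bsub>M\<^esub> r \<odot>\<^bsub>M\<^esub> y"
  using assms by (auto simp: left_act_def add_hom_def)

lemma right_actD:
  assumes "right_act S M"
  shows "abelian_group M"
    and "s \<in> carrier S \<Longrightarrow> x \<in> carrier M \<Longrightarrow> rsmult M x s \<in> carrier M"
    and "s \<in> carrier S \<Longrightarrow> x \<in> carrier M \<Longrightarrow> y \<in> carrier M \<Longrightarrow>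
      rsmult M (x \<oplus>\<^bsub>M\<^esub> y) s = rsmult M x s \<oplus>\<^bsub>M\<^esub> rsmult M y s"
  using assms by (auto simp: right_act_def add_hom_def)

locale tensorable =
  fixes S :: "('s, 'y) ring_scheme" and P :: "('r, 'p, 's) bimod" and Q :: "('s, 'q, 't) bimod"
  assumes P: "right_act S P" and Q: "left_act S Q"
begin

abbreviation "F \<equiv> free_Abelian_group (carrier P \<times> carrier Q)"
abbreviation "N \<equiv> tensor_null S P Q"
abbreviation "G \<equiv> tensor_group S P Q"
abbreviation "t \<equiv> tensor S P Q"

sublocale P: abelian_group P by (rule right_actD(1)[OF P])
sublocale Q: abelian_group Q by (rule left_actD(1)[OF Q])
sublocale F: comm_group F by (rule abelian_free_Abelian_group)

lemma relators_closed: "tensor_relators S P Q \<subseteq> carrier F"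
proof -
  have k2: "Poly_Mapping.keys (frag_of x - frag_of y) \<subseteq> A" if "x \<in> A" "y \<in> A"
    for x y :: "'p \<times> 'q" and A
    using keys_diff[of "frag_of x" "frag_of y"] that by auto
  have k3: "Poly_Mapping.keys (frag_of x - frag_of y - frag_of z) \<subseteq> A" if "x \<in> A" "y \<in> A" "z \<in> A"
    for x y z :: "'p \<times> 'q" and A
    using keys_diff[of "frag_of x - frag_of y" "frag_of z"] k2[of x A y] that by auto
  show ?thesis
  proof
    fix r assume "r \<in> tensor_relators S P Q"
    then show "r \<in> carrier F"
      unfolding tensor_relators_def carrier_free_Abelian_group_iff
      by (elim UnE CollectE exE conjE)
        (simp_all only: k2 k3 mem_Sigma_iff P.add.m_closed Q.add.m_closed right_actD(2)[OF P] left_actD(2)[OF Q] simp_thms)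
  qed
qed

lemma null_subgroup: "subgroup N F"
  unfolding tensor_null_def by (rule F.generate_is_subgroup[OF relators_closed])

lemma null_normal: "N \<lhd> F"
  by (rule F.subgroup_imp_normal[OF null_subgroup])

abbreviation cos :: "(('p \<times> 'q) \<Rightarrow>\<^sub>0 int) \<Rightarrow> ('p, 'q) tens" where
  "cos c \<equiv> N #>\<^bsub>F\<^esub> c"

lemma carrier_G: "carrier G = cos ` {c. Poly_Mapping.keys c \<subseteq> carrier P \<times> carrier Q}"
  by (auto simp: tensor_group_def FactGroup_def RCOSETS_def Let_def)

lemma add_G:
  assumes "Poly_Mapping.keys c \<subseteq> carrier P \<times> carrier Q" "Poly_Mapping.keys d \<subseteq> carrier P \<times> carrier Q"
  shows "cos c \<oplus>\<^bsub>G\<^esub> cos d = cos (c + d)"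
  using normal.rcos_sum[OF null_normal, of c d] assms
  by (simp add: tensor_group_def FactGroup_def Let_def)

lemma zero_G: "\<zero>\<^bsub>G\<^esub> = cos 0"
  using F.coset_join2[OF _ null_subgroup, of 0] subgroup.one_closed[OF null_subgroup]
  by (simp add: tensor_group_def FactGroup_def Let_def)

lemma abelian_G: "abelian_group G"
proof -
  have "comm_group (F Mod N)"
    by (rule F.abelian_FactGroup[OF null_subgroup])
  then interpret FN: comm_group "F Mod N" .
  show ?thesis
  proof (rule abelian_groupI)
    fix x assume "x \<in> carrier G"
    then show "\<exists>y\<in>carrier G. y \<oplus>\<^bsub>G\<^esub> x = \<zero>\<^bsub>G\<^esub>"
      unfolding tensor_group_def Let_def ring_record_simps using FN.l_inv FN.inv_closed by metis
  qed (unfold tensor_group_def Let_def ring_record_simps,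
      auto simp del: mult_FactGroup one_FactGroup simp: FN.m_ac)
qed

sublocale G: abelian_group G by (rule abelian_G)

lemma cos_eq:
  assumes "x - y \<in> N" "Poly_Mapping.keys x \<subseteq> carrier P \<times> carrier Q"
    "Poly_Mapping.keys y \<subseteq> carrier P \<times> carrier Q"
  shows "cos x = cos y"
proof -
  have "x - y + y \<in> cos y"
    using assms(1) unfolding r_coset_def mult_free_Abelian_group by blast
  then show ?thesis
    using F.repr_independence[of x N y] null_subgroup assms(3) by simp
qed

lemma relator_null: "r \<in> tensor_relators S P Q \<Longrightarrow> r \<in> N"
  unfolding tensor_null_def by (rule generate.incl)

lemma keys_pair_add: "p \<in> carrier P \<Longrightarrow> q \<in> carrier Q \<Longrightarrow> p' \<in> carrier P \<Longrightarrow> q' \<in> carrier Q \<Longrightarrow>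
    Poly_Mapping.keys (frag_of (p, q) + frag_of (p', q')) \<subseteq> carrier P \<times> carrier Q"
  using Poly_Mapping.keys_add[of "frag_of (p, q)" "frag_of (p', q')"] by auto

lemma tensor_balanced: "balanced S P Q G t"
proof (rule balancedI)
  fix p q assume "p \<in> carrier P" "q \<in> carrier Q"
  then show "t p q \<in> carrier G"
    by (auto simp: carrier_G tensor_def)
next
  fix p p' q assume *: "p \<in> carrier P" "p' \<in> carrier P" "q \<in> carrier Q"
  then have "frag_of (p \<oplus>\<^bsub>P\<^esub> p', q) - frag_of (p, q) - frag_of (p', q) \<in> N"
    by (intro relator_null) (auto simp: tensor_relators_def)
  with * show "t (p \<oplus>\<^bsub>P\<^esub> p') q = t p q \<oplus>\<^bsub>G\<^esub> t p' q"
    unfolding tensor_def by (subst add_G) (simp_all add: cos_eq keys_pair_add diff_diff_add)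
next
  fix p q q' assume *: "p \<in> carrier P" "q \<in> carrier Q" "q' \<in> carrier Q"
  then have "frag_of (p, q \<oplus>\<^bsub>Q\<^esub> q') - frag_of (p, q) - frag_of (p, q') \<in> N"
    by (intro relator_null) (auto simp: tensor_relators_def)
  with * show "t p (q \<oplus>\<^bsub>Q\<^esub> q') = t p q \<oplus>\<^bsub>G\<^esub> t p q'"
    unfolding tensor_def by (subst add_G) (simp_all add: cos_eq keys_pair_add diff_diff_add)
next
  fix p s q assume *: "p \<in> carrier P" "s \<in> carrier S" "q \<in> carrier Q"
  then have "frag_of (rsmult P p s, q) - frag_of (p, s \<odot>\<^bsub>Q\<^esub> q) \<in> N"
    by (intro relator_null) (auto simp: tensor_relators_def)
  with * show "t (rsmult P p s) q = t p (s \<odot>\<^bsub>Q\<^esub> q)"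
    unfolding tensor_def using right_actD(2)[OF P] left_actD(2)[OF Q] by (simp add: cos_eq)
qed

lemmas tensor_closed = balancedD(1)[OF tensor_balanced]
  and tensor_add_left = balancedD(2)[OF tensor_balanced]
  and tensor_add_right = balancedD(3)[OF tensor_balanced]
  and tensor_smult = balancedD(4)[OF tensor_balanced]

lemma tensor_uminus:
  assumes "p \<in> carrier P" "q \<in> carrier Q"
  shows "t (\<ominus>\<^bsub>P\<^esub> p) q = \<ominus>\<^bsub>G\<^esub> t p q"
proof -
  have "(\<lambda>p. t p q) \<in> add_hom P G"
    using tensor_balanced assms by (simp add: balanced_def)
  then have "t \<zero>\<^bsub>P\<^esub> q = \<zero>\<^bsub>G\<^esub>"
    by (rule add_hom_zero) (rule P.abelian_group_axioms G.abelian_group_axioms)+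
  then have "t (\<ominus>\<^bsub>P\<^esub> p) q \<oplus>\<^bsub>G\<^esub> t p q = \<zero>\<^bsub>G\<^esub>"
    using assms by (simp add: P.l_neg tensor_closed flip: tensor_add_left)
  then show ?thesis
    using assms by (simp add: G.minus_equality tensor_closed)
qed

text \<open>Negatives of pure tensors are pure, so that sums of pure tensors exhaust the tensor product.\<close>

lemma tensor_induct [consumes 1, case_names pure add]:
  assumes X: "X \<in> carrier G"
    and pure: "\<And>p q. p \<in> carrier P \<Longrightarrow> q \<in> carrier Q \<Longrightarrow> R (t p q)"
    and add: "\<And>X Y. X \<in> carrier G \<Longrightarrow> Y \<in> carrier G \<Longrightarrow> R X \<Longrightarrow> R Y \<Longrightarrow> R (X \<oplus>\<^bsub>G\<^esub> Y)"
  shows "R X"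
proof -
  have cG: "cos c \<in> carrier G" if "Poly_Mapping.keys c \<subseteq> carrier P \<times> carrier Q" for c
    using that carrier_G by blast
  have neg: "cos (- frag_of (p, q)) = t (\<ominus>\<^bsub>P\<^esub> p) q" if "p \<in> carrier P" "q \<in> carrier Q" for p q
  proof -
    have "cos (- frag_of (p, q)) \<oplus>\<^bsub>G\<^esub> t p q = \<zero>\<^bsub>G\<^esub>"
      unfolding tensor_def using that by (subst add_G) (auto simp: zero_G)
    then have "cos (- frag_of (p, q)) = \<ominus>\<^bsub>G\<^esub> t p q"
      using that by (intro G.minus_equality[symmetric]) (auto intro!: cG tensor_closed)
    then show ?thesis
      by (simp add: tensor_uminus that)
  qed
  have "R (cos c) \<and> R (cos (- c))" if "Poly_Mapping.keys c \<subseteq> carrier P \<times> carrier Q" for c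
  proof (induction rule: free_Abelian_group_induct[OF that])
    case 1
    have "cos 0 = t \<zero>\<^bsub>P\<^esub> \<zero>\<^bsub>Q\<^esub>"
      using tensor_add_left[of "\<zero>\<^bsub>P\<^esub>" "\<zero>\<^bsub>P\<^esub>" "\<zero>\<^bsub>Q\<^esub>"] tensor_closed[of "\<zero>\<^bsub>P\<^esub>" "\<zero>\<^bsub>Q\<^esub>"]
      by (simp flip: zero_G)
    then show ?case
      using pure[of "\<zero>\<^bsub>P\<^esub>" "\<zero>\<^bsub>Q\<^esub>"] by simp
  next
    case (2 x y)
    then have "R (cos x \<oplus>\<^bsub>G\<^esub> cos (- y))" "R (cos y \<oplus>\<^bsub>G\<^esub> cos (- x))"
      by (auto intro!: add cG)
    then show ?case
      using 2 by (simp add: add_G)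
  next
    case (3 a)
    then show ?case
      using pure neg by (cases a) (auto simp flip: tensor_def)
  qed
  then show ?thesis
    using X carrier_G by auto
qed

text \<open>The sum \<open>h\<close> that defines \<open>tlift\<close> is additive in the formal combination and kills the relators, hence
  the subgroup generated by them. It is therefore constant on cosets, and any representative will do.\<close>

lemma tlift_universal:
  assumes "abelian_group M" "balanced S P Q M f"
  shows "tlift M f \<in> add_hom G M"
    and "p \<in> carrier P \<Longrightarrow> q \<in> carrier Q \<Longrightarrow> tlift M f (t p q) = f p q"
proof -
  interpret M: abelian_group M by fact
  define h :: "('p \<times> 'q \<Rightarrow>\<^sub>0 int) \<Rightarrow> _" where "h \<equiv> \<lambda>c. \<Oplus>\<^bsub>M\<^esub>x \<in> Poly_Mapping.keys c.
    [Poly_Mapping.lookup c x] \<cdot>\<^bsub>M\<^esub> f (fst x) (snd x)"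
  have cl: "f (fst x) (snd x) \<in> carrier M" if "x \<in> carrier P \<times> carrier Q" for x
    using that balancedD(1)[OF assms(2)] by auto
  have h_add: "h (c + d) = h c \<oplus>\<^bsub>M\<^esub> h d" if "c \<in> carrier F" "d \<in> carrier F" for c d
    using finsum_keys_add_hom[OF assms(1) cl] that unfolding h_def by simp
  have h_cl: "h c \<in> carrier M" if "c \<in> carrier F" for c
    unfolding h_def
  proof (rule M.finsum_closed, rule Pi_I)
    fix x assume "x \<in> Poly_Mapping.keys c"
    then have "f (fst x) (snd x) \<in> carrier M"
      using that cl by auto
    then show "[Poly_Mapping.lookup c x] \<cdot>\<^bsub>M\<^esub> f (fst x) (snd x) \<in> carrier M"
      unfolding add_pow_def using group.int_pow_closed[OF M.a_group, of "f (fst x) (snd x)"] by simp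
  qed
  have h_frag: "h (frag_of (p, q)) = f p q" if "p \<in> carrier P" "q \<in> carrier Q" for p q
    using that balancedD(1)[OF assms(2)] group.int_pow_1[OF M.a_group, of "f p q"]
    unfolding h_def by (simp add: add_pow_def)
  have h_zero: "h 0 = \<zero>\<^bsub>M\<^esub>"
    by (simp add: h_def)
  have h_diff: "h (c - d) = h c \<ominus>\<^bsub>M\<^esub> h d" if "c \<in> carrier F" "d \<in> carrier F" for c d
  proof -
    have "c - d \<in> carrier F"
      using that keys_diff[of c d] by auto
    then show ?thesis
      using h_add[of "c - d" d] h_cl[of "c - d"] h_cl[of c] h_cl[of d] that
      by (simp add: M.minus_eq M.add.inv_solve_right)
  qed
  have diff_cl: "c - d \<in> carrier F" if "c \<in> carrier F" "d \<in> carrier F" for c d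
    using that keys_diff[of c d] by auto
  have h_relator: "h r = \<zero>\<^bsub>M\<^esub>" if "r \<in> tensor_relators S P Q" for r
  proof -
    have h3: "h (frag_of x - frag_of y - frag_of z) = h (frag_of x) \<ominus>\<^bsub>M\<^esub> h (frag_of y) \<ominus>\<^bsub>M\<^esub> h (frag_of z)"
      if "x \<in> carrier P \<times> carrier Q" "y \<in> carrier P \<times> carrier Q" "z \<in> carrier P \<times> carrier Q" for x y z
      using that h_diff diff_cl by simp
    have h2: "h (frag_of x - frag_of y) = h (frag_of x) \<ominus>\<^bsub>M\<^esub> h (frag_of y)"
      if "x \<in> carrier P \<times> carrier Q" "y \<in> carrier P \<times> carrier Q" for x y
      using that h_diff by simp
    have cancel: "a \<oplus>\<^bsub>M\<^esub> b \<ominus>\<^bsub>M\<^esub> a \<ominus>\<^bsub>M\<^esub> b = \<zero>\<^bsub>M\<^esub>" if "a \<in> carrier M" "b \<in> carrier M" for a b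
    proof -
      have "a \<oplus>\<^bsub>M\<^esub> b \<ominus>\<^bsub>M\<^esub> a = b"
        using that by (simp add: M.minus_eq M.a_comm[of a b] M.a_assoc M.r_neg)
      then show ?thesis
        using that by (simp add: M.minus_eq M.r_neg)
    qed
    note * = balancedD(1)[OF assms(2)] h_frag h2 h3 cancel right_actD(2)[OF P] left_actD(2)[OF Q]
    from that show ?thesis
      unfolding tensor_relators_def
    proof (elim UnE CollectE exE conjE)
      fix p p' q
      assume "p \<in> carrier P" "p' \<in> carrier P" "q \<in> carrier Q"
        and "r = frag_of (p \<oplus>\<^bsub>P\<^esub> p', q) - frag_of (p, q) - frag_of (p', q)"
      then show ?thesis
        by (simp add: * balancedD(2)[OF assms(2)])
    next
      fix p q q'
      assume "p \<in> carrier P" "q \<in> carrier Q" "q' \<in> carrier Q"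
        and "r = frag_of (p, q \<oplus>\<^bsub>Q\<^esub> q') - frag_of (p, q) - frag_of (p, q')"
      then show ?thesis
        by (simp add: * balancedD(3)[OF assms(2)])
    next
      fix p s q
      assume "p \<in> carrier P" "s \<in> carrier S" "q \<in> carrier Q"
        and "r = frag_of (rsmult P p s, q) - frag_of (p, s \<odot>\<^bsub>Q\<^esub> q)"
      then show ?thesis
        by (simp add: * balancedD(4)[OF assms(2)] M.minus_eq M.r_neg)
    qed
  qed
  have h_null: "c \<in> carrier F \<and> h c = \<zero>\<^bsub>M\<^esub>" if "c \<in> N" for c
    using that unfolding tensor_null_def
  proof (induction c rule: generate.induct)
    case one
    then show ?case by (simp add: h_zero)
  next
    case (incl c)
    then show ?case using relators_closed h_relator by blast
  next
    case (inv c)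
    then have "c \<in> carrier F" "h c = \<zero>\<^bsub>M\<^esub>"
      using relators_closed h_relator by blast+
    then show ?case
      using h_diff[of 0 c] h_zero by (simp add: M.minus_eq)
  next
    case (eng c d)
    then show ?case
      using h_add[of c d] Poly_Mapping.keys_add[of c d] by (simp add: subset_trans)
  qed
  have tlift_cos: "tlift M f (cos c) = h c" if c: "c \<in> carrier F" for c
  proof -
    have "c \<in> cos c"
      using F.rcos_self[OF c null_subgroup] .
    then have "(SOME c'. c' \<in> cos c) \<in> cos c"
      by (rule someI[where P = "\<lambda>d. d \<in> cos c"])
    then obtain n where "n \<in> N" "(SOME c'. c' \<in> cos c) = n + c"
      by (auto simp: r_coset_def)
    then show ?thesis
      using h_null h_add c h_cl by (simp add: tlift_def h_def[symmetric])
  qed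
  show "tlift M f \<in> add_hom G M"
  proof (rule add_homI)
    fix X assume "X \<in> carrier G"
    then show "tlift M f X \<in> carrier M"
      using tlift_cos h_cl carrier_G by auto
  next
    fix X Y assume "X \<in> carrier G" "Y \<in> carrier G"
    then obtain c d where "c \<in> carrier F" "d \<in> carrier F" "X = cos c" "Y = cos d"
      unfolding carrier_G by auto
    then show "tlift M f (X \<oplus>\<^bsub>G\<^esub> Y) = tlift M f X \<oplus>\<^bsub>M\<^esub> tlift M f Y"
      using h_add tlift_cos Poly_Mapping.keys_add[of c d] by (simp add: add_G subset_trans)
  qed
  show "tlift M f (t p q) = f p q" if "p \<in> carrier P" "q \<in> carrier Q"
    using that h_frag tlift_cos by (simp add: tensor_def)
qed

lemma tensor_eqI:
  assumes f: "f \<in> add_hom G M" and g: "g \<in> add_hom G M"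
    and pure: "\<And>p q. p \<in> carrier P \<Longrightarrow> q \<in> carrier Q \<Longrightarrow> f (t p q) = g (t p q)"
    and X: "X \<in> carrier G"
  shows "f X = g X"
  using X
proof (induction X rule: tensor_induct)
  case (add X Y)
  then show ?case
    by (simp only: add_hom_add[OF f] add_hom_add[OF g])
qed (rule pure)

end

lemma tensor_group_abelian:
  "right_act S P \<Longrightarrow> left_act S Q \<Longrightarrow> abelian_group (tensor_group S P Q)"
  by (rule tensorable.abelian_G[OF tensorable.intro])

text \<open>A function of \<open>X = \<Sum> p \<otimes> q\<close> and \<open>Y = \<Sum> p' \<otimes> q'\<close> that is given on pure tensors may be computed by
  summing over \<open>Y\<close> first.\<close>

lemma tlift_tlift:
  assumes PQ: "right_act S P" "left_act S Q" and PQ': "right_act S' P'" "left_act S' Q'"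
    and M: "abelian_group M"
    and inner: "\<And>p q. p \<in> carrier P \<Longrightarrow> q \<in> carrier Q \<Longrightarrow> balanced S' P' Q' M (f p q)"
    and outer: "\<And>p' q'. p' \<in> carrier P' \<Longrightarrow> q' \<in> carrier Q' \<Longrightarrow> balanced S P Q M (\<lambda>p q. f p q p' q')"
  defines "h \<equiv> \<lambda>X Y. tlift M (\<lambda>p q. tlift M (f p q) Y) X"
  shows "Y \<in> carrier (tensor_group S' P' Q') \<Longrightarrow> (\<lambda>X. h X Y) \<in> add_hom (tensor_group S P Q) M"
    and "X \<in> carrier (tensor_group S P Q) \<Longrightarrow> h X \<in> add_hom (tensor_group S' P' Q') M"
    and "p \<in> carrier P \<Longrightarrow> q \<in> carrier Q \<Longrightarrow> p' \<in> carrier P' \<Longrightarrow> q' \<in> carrier Q' \<Longrightarrow>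
      h (tensor S P Q p q) (tensor S' P' Q' p' q') = f p q p' q'"
proof -
  interpret T: tensorable S P Q by (rule tensorable.intro[OF PQ])
  interpret T': tensorable S' P' Q' by (rule tensorable.intro[OF PQ'])
  interpret M: abelian_group M by fact
  note inner_lift = T'.tlift_universal[OF M inner]
  note outerD = balancedD[OF outer]
  have balanced: "balanced S P Q M (\<lambda>p q. tlift M (f p q) Y)" if Y: "Y \<in> carrier (tensor_group S' P' Q')" for Y
  proof (rule balancedI)
    fix p q assume "p \<in> carrier P" "q \<in> carrier Q"
    then show "tlift M (f p q) Y \<in> carrier M"
      using add_hom_closed[OF inner_lift(1) Y] by simp
  next
    fix p1 p2 q assume *: "p1 \<in> carrier P" "p2 \<in> carrier P" "q \<in> carrier Q"
    show "tlift M (f (p1 \<oplus>\<^bsub>P\<^esub> p2) q) Y = tlift M (f p1 q) Y \<oplus>\<^bsub>M\<^esub> tlift M (f p2 q) Y"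
      by (rule T'.tensor_eqI[OF _ add_hom_plus[OF _ _ M] _ Y])
        (use * in \<open>simp_all add: inner_lift outerD(2)\<close>)
  next
    fix p q1 q2 assume *: "p \<in> carrier P" "q1 \<in> carrier Q" "q2 \<in> carrier Q"
    show "tlift M (f p (q1 \<oplus>\<^bsub>Q\<^esub> q2)) Y = tlift M (f p q1) Y \<oplus>\<^bsub>M\<^esub> tlift M (f p q2) Y"
      by (rule T'.tensor_eqI[OF _ add_hom_plus[OF _ _ M] _ Y])
        (use * in \<open>simp_all add: inner_lift outerD(3)\<close>)
  next
    fix p s q assume *: "p \<in> carrier P" "s \<in> carrier S" "q \<in> carrier Q"
    then have "rsmult P p s \<in> carrier P" "s \<odot>\<^bsub>Q\<^esub> q \<in> carrier Q"
      using right_actD(2)[OF PQ(1)] left_actD(2)[OF PQ(2)] by auto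
    with * show "tlift M (f (rsmult P p s) q) Y = tlift M (f p (s \<odot>\<^bsub>Q\<^esub> q)) Y"
      by (intro T'.tensor_eqI[OF inner_lift(1) inner_lift(1) _ Y]) (simp_all add: inner_lift(2) outerD(4))
  qed
  show left: "(\<lambda>X. h X Y) \<in> add_hom (tensor_group S P Q) M" if "Y \<in> carrier (tensor_group S' P' Q')" for Y
    unfolding h_def by (rule T.tlift_universal(1)[OF M balanced[OF that]])
  have pure: "h (tensor S P Q p q) Y = tlift M (f p q) Y"
    if "p \<in> carrier P" "q \<in> carrier Q" "Y \<in> carrier (tensor_group S' P' Q')" for p q Y
    unfolding h_def using T.tlift_universal(2)[OF M balanced[OF that(3)] that(1,2)] .
  show "h X \<in> add_hom (tensor_group S' P' Q') M" if X: "X \<in> carrier (tensor_group S P Q)" for X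
  proof (rule add_homI)
    fix Y assume "Y \<in> carrier (tensor_group S' P' Q')"
    then show "h X Y \<in> carrier M"
      using add_hom_closed[OF left X] by simp
  next
    fix Y Y' assume *: "Y \<in> carrier (tensor_group S' P' Q')" "Y' \<in> carrier (tensor_group S' P' Q')"
    then have YY': "Y \<oplus>\<^bsub>tensor_group S' P' Q'\<^esub> Y' \<in> carrier (tensor_group S' P' Q')"
      by simp
    show "h X (Y \<oplus>\<^bsub>tensor_group S' P' Q'\<^esub> Y') = h X Y \<oplus>\<^bsub>M\<^esub> h X Y'"
    proof (rule T.tensor_eqI[OF left[OF YY'] add_hom_plus[OF left left M] _ X])
      fix p q assume "p \<in> carrier P" "q \<in> carrier Q"
      then show "h (tensor S P Q p q) (Y \<oplus>\<^bsub>tensor_group S' P' Q'\<^esub> Y')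
          = h (tensor S P Q p q) Y \<oplus>\<^bsub>M\<^esub> h (tensor S P Q p q) Y'"
        using add_hom_add[OF inner_lift(1)] * YY' by (simp only: pure)
    qed (use * in simp_all)
  qed
  show "h (tensor S P Q p q) (tensor S' P' Q' p' q') = f p q p' q'"
    if "p \<in> carrier P" "q \<in> carrier Q" "p' \<in> carrier P'" "q' \<in> carrier Q'"
    using that by (simp add: pure T'.tensor_closed inner_lift(2))
qed

section \<open>Bimodules, induced maps and rebracketing\<close>

lemma tensor_bimod_simps [simp]:
  "carrier (tensor_bimod S P Q) = carrier (tensor_group S P Q)"
  "add (tensor_bimod S P Q) = add (tensor_group S P Q)"
  "zero (tensor_bimod S P Q) = zero (tensor_group S P Q)"
  by (simp_all add: tensor_bimod_def Let_def)

definition left_lin ::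
  "('r, 'y) ring_scheme \<Rightarrow> ('r, 'm, 's) bimod \<Rightarrow> ('r, 'n, 's') bimod \<Rightarrow> ('m \<Rightarrow> 'n) set" where
  "left_lin R M N = {f \<in> add_hom M N. \<forall>r \<in> carrier R. \<forall>x \<in> carrier M. f (r \<odot>\<^bsub>M\<^esub> x) = r \<odot>\<^bsub>N\<^esub> f x}"

definition right_lin ::
  "('s, 'y) ring_scheme \<Rightarrow> ('r, 'm, 's) bimod \<Rightarrow> ('r', 'n, 's) bimod \<Rightarrow> ('m \<Rightarrow> 'n) set" where
  "right_lin S M N = {f \<in> add_hom M N. \<forall>s \<in> carrier S. \<forall>x \<in> carrier M. f (rsmult M x s) = rsmult N (f x) s}"

lemma bimod_hom_iff: "f \<in> bimod_hom R S M N \<longleftrightarrow> f \<in> left_lin R M N \<and> f \<in> right_lin S M N"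
  by (auto simp: bimod_hom_def left_lin_def right_lin_def add_hom_def)

lemma left_linI:
  "f \<in> add_hom M N \<Longrightarrow> (\<And>r x. r \<in> carrier R \<Longrightarrow> x \<in> carrier M \<Longrightarrow> f (r \<odot>\<^bsub>M\<^esub> x) = r \<odot>\<^bsub>N\<^esub> f x) \<Longrightarrow>
    f \<in> left_lin R M N"
  by (simp add: left_lin_def)

lemma right_linI:
  "f \<in> add_hom M N \<Longrightarrow> (\<And>s x. s \<in> carrier S \<Longrightarrow> x \<in> carrier M \<Longrightarrow> f (rsmult M x s) = rsmult N (f x) s) \<Longrightarrow>
    f \<in> right_lin S M N"
  by (simp add: right_lin_def)

lemma left_lin_add_hom: "f \<in> left_lin R M N \<Longrightarrow> f \<in> add_hom M N"
  by (simp add: left_lin_def)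

lemma right_lin_add_hom: "f \<in> right_lin S M N \<Longrightarrow> f \<in> add_hom M N"
  by (simp add: right_lin_def)

lemma left_lin_smult:
  "f \<in> left_lin R M N \<Longrightarrow> r \<in> carrier R \<Longrightarrow> x \<in> carrier M \<Longrightarrow> f (r \<odot>\<^bsub>M\<^esub> x) = r \<odot>\<^bsub>N\<^esub> f x"
  by (simp add: left_lin_def)

lemma right_lin_rsmult:
  "f \<in> right_lin S M N \<Longrightarrow> s \<in> carrier S \<Longrightarrow> x \<in> carrier M \<Longrightarrow> f (rsmult M x s) = rsmult N (f x) s"
  by (simp add: right_lin_def)

text \<open>Linearity has to be checked on additive generators only.\<close>

lemma left_lin_tensorI:
  assumes f: "f \<in> add_hom M N" and PQ: "right_act S P" "left_act S Q"
    and M: "left_act R M" "carrier M = carrier (tensor_group S P Q)" "add M = add (tensor_group S P Q)"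
    and N: "left_act R N"
    and pure: "\<And>r p q. r \<in> carrier R \<Longrightarrow> p \<in> carrier P \<Longrightarrow> q \<in> carrier Q \<Longrightarrow>
      f (r \<odot>\<^bsub>M\<^esub> tensor S P Q p q) = r \<odot>\<^bsub>N\<^esub> f (tensor S P Q p q)"
  shows "f \<in> left_lin R M N"
proof (rule left_linI[OF f])
  interpret T: tensorable S P Q by (rule tensorable.intro[OF PQ])
  fix r x assume r: "r \<in> carrier R" and x: "x \<in> carrier M"
  have eq: "add_hom M N = add_hom (tensor_group S P Q) N" by (rule add_hom_cong) (simp_all add: M)
  show "f (r \<odot>\<^bsub>M\<^esub> x) = r \<odot>\<^bsub>N\<^esub> f x"
  proof (rule T.tensor_eqI)
    show "(\<lambda>x. f (r \<odot>\<^bsub>M\<^esub> x)) \<in> add_hom (tensor_group S P Q) N"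
      unfolding eq[symmetric] using M(1) r by (intro add_hom_comp[OF f]) (simp add: left_act_def)
    show "(\<lambda>x. r \<odot>\<^bsub>N\<^esub> f x) \<in> add_hom (tensor_group S P Q) N"
      unfolding eq[symmetric] using N r by (intro add_hom_comp[OF _ f]) (simp add: left_act_def)
  qed (use r x pure M in simp_all)
qed

lemma right_lin_tensorI:
  assumes f: "f \<in> add_hom M N" and PQ: "right_act S P" "left_act S Q"
    and M: "right_act R M" "carrier M = carrier (tensor_group S P Q)" "add M = add (tensor_group S P Q)"
    and N: "right_act R N"
    and pure: "\<And>r p q. r \<in> carrier R \<Longrightarrow> p \<in> carrier P \<Longrightarrow> q \<in> carrier Q \<Longrightarrow>
      f (rsmult M (tensor S P Q p q) r) = rsmult N (f (tensor S P Q p q)) r"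
  shows "f \<in> right_lin R M N"
proof (rule right_linI[OF f])
  interpret T: tensorable S P Q by (rule tensorable.intro[OF PQ])
  fix r x assume r: "r \<in> carrier R" and x: "x \<in> carrier M"
  have eq: "add_hom M N = add_hom (tensor_group S P Q) N" by (rule add_hom_cong) (simp_all add: M)
  show "f (rsmult M x r) = rsmult N (f x) r"
  proof (rule T.tensor_eqI)
    show "(\<lambda>x. f (rsmult M x r)) \<in> add_hom (tensor_group S P Q) N"
      unfolding eq[symmetric] using M(1) r by (intro add_hom_comp[OF f]) (simp add: right_act_def)
    show "(\<lambda>x. rsmult N (f x) r) \<in> add_hom (tensor_group S P Q) N"
      unfolding eq[symmetric] using N r
      by (intro add_hom_comp[OF _ f, of "\<lambda>x. rsmult N x r"]) (simp add: right_act_def)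
  qed (use r x pure M in simp_all)
qed

text \<open>Additive actions that commute with each other. Tensor products inherit them, so that they make iterated
  tensor products accessible to the universal property.\<close>

definition biact ::
  "('r, 'y) ring_scheme \<Rightarrow> ('s, 'z) ring_scheme \<Rightarrow> ('r, 'm, 's) bimod \<Rightarrow> bool" where
  "biact R S M \<longleftrightarrow> left_act R M \<and> right_act S M \<and>
     (\<forall>r \<in> carrier R. \<forall>s \<in> carrier S. \<forall>x \<in> carrier M. rsmult M (r \<odot>\<^bsub>M\<^esub> x) s = r \<odot>\<^bsub>M\<^esub> rsmult M x s)"

lemma biactD:
  assumes "biact R S M"
  shows "left_act R M" "right_act S M"
    "r \<in> carrier R \<Longrightarrow> s \<in> carrier S \<Longrightarrow> x \<in> carrier M \<Longrightarrow> rsmult M (r \<odot>\<^bsub>M\<^esub> x) s = r \<odot>\<^bsub>M\<^esub> rsmult M x s"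
  using assms by (auto simp: biact_def)

lemma tensor_map_balanced:
  assumes "right_act S P" "left_act S Q" "right_act S P'" "left_act S Q'"
    and "f \<in> right_lin S P P'" "g \<in> left_lin S Q Q'"
  shows "balanced S P Q (tensor_group S P' Q') (\<lambda>p q. tensor S P' Q' (f p) (g q))"
proof -
  interpret T': tensorable S P' Q' by (rule tensorable.intro) fact+
  note f = add_hom_closed[OF right_lin_add_hom[OF assms(5)]] add_hom_add[OF right_lin_add_hom[OF assms(5)]]
    right_lin_rsmult[OF assms(5)]
  note g = add_hom_closed[OF left_lin_add_hom[OF assms(6)]] add_hom_add[OF left_lin_add_hom[OF assms(6)]]
    left_lin_smult[OF assms(6)]
  show ?thesis
    by (rule balancedI)
      (simp_all add: f g T'.tensor_closed T'.tensor_add_left T'.tensor_add_right T'.tensor_smult)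
qed

lemma tensor_map_add_hom:
  assumes "right_act S P" "left_act S Q" "right_act S P'" "left_act S Q'"
    and "f \<in> right_lin S P P'" "g \<in> left_lin S Q Q'"
  shows "tensor_map S P' Q' f g \<in> add_hom (tensor_group S P Q) (tensor_group S P' Q')"
  unfolding tensor_map_def
  by (rule tensorable.tlift_universal(1)[OF tensorable.intro tensor_group_abelian tensor_map_balanced]) fact+

lemma tensor_map_tensor:
  assumes "right_act S P" "left_act S Q" "right_act S P'" "left_act S Q'"
    and "f \<in> right_lin S P P'" "g \<in> left_lin S Q Q'" and "p \<in> carrier P" "q \<in> carrier Q"
  shows "tensor_map S P' Q' f g (tensor S P Q p q) = tensor S P' Q' (f p) (g q)"
  unfolding tensor_map_def
  by (rule tensorable.tlift_universal(2)[OF tensorable.intro tensor_group_abelian tensor_map_balanced]) fact+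

lemma tensor_bimod_smult_balanced:
  assumes "biact R S P" "left_act S Q" "r \<in> carrier R"
  shows "balanced S P Q (tensor_group S P Q) (\<lambda>p q. tensor S P Q (r \<odot>\<^bsub>P\<^esub> p) q)"
proof (rule tensor_map_balanced[where g = "\<lambda>q. q"])
  show "smult P r \<in> right_lin S P P"
    using assms(1,3) by (auto simp: biact_def left_act_def intro: right_linI)
  show "(\<lambda>q. q) \<in> left_lin S Q Q"
    by (simp add: left_lin_def add_hom_def)
qed (use assms in \<open>simp_all add: biact_def\<close>)

lemma tensor_bimod_rsmult_balanced:
  assumes "right_act S P" "biact S T Q" "s \<in> carrier T"
  shows "balanced S P Q (tensor_group S P Q) (\<lambda>p q. tensor S P Q p (rsmult Q q s))"
proof (rule tensor_map_balanced[where f = "\<lambda>p. p"])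
  show "(\<lambda>q. rsmult Q q s) \<in> left_lin S Q Q"
    using assms(2,3) by (auto simp: biact_def right_act_def intro: left_linI)
  show "(\<lambda>p. p) \<in> right_lin S P P"
    by (simp add: right_lin_def add_hom_def)
qed (use assms in \<open>simp_all add: biact_def\<close>)

lemma tensor_bimod_smult:
  assumes "biact R S P" "left_act S Q" "r \<in> carrier R" "p \<in> carrier P" "q \<in> carrier Q"
  shows "r \<odot>\<^bsub>tensor_bimod S P Q\<^esub> tensor S P Q p q = tensor S P Q (r \<odot>\<^bsub>P\<^esub> p) q"
  using tensorable.tlift_universal(2)[OF tensorable.intro tensor_group_abelian
      tensor_bimod_smult_balanced[OF assms(1-3)] assms(4,5)] assms
  by (simp add: tensor_bimod_def Let_def biact_def)

lemma tensor_bimod_rsmult: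
  assumes "right_act S P" "biact S T Q" "s \<in> carrier T" "p \<in> carrier P" "q \<in> carrier Q"
  shows "rsmult (tensor_bimod S P Q) (tensor S P Q p q) s = tensor S P Q p (rsmult Q q s)"
  using tensorable.tlift_universal(2)[OF tensorable.intro tensor_group_abelian
      tensor_bimod_rsmult_balanced[OF assms(1-3)] assms(4,5)] assms
  by (simp add: tensor_bimod_def Let_def biact_def)

lemma tensor_bimod_abelian:
  "right_act S P \<Longrightarrow> left_act S Q \<Longrightarrow> abelian_group (tensor_bimod S P Q)"
  by (rule abelian_group_cong[OF tensor_group_abelian]) simp_all

lemma tensor_bimod_left_act:
  assumes "biact R S P" "left_act S Q"
  shows "left_act R (tensor_bimod S P Q)"
  unfolding left_act_def
proof (intro conjI ballI)
  fix r assume r: "r \<in> carrier R"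
  have "tlift (tensor_group S P Q) (\<lambda>p q. tensor S P Q (r \<odot>\<^bsub>P\<^esub> p) q) \<in> add_hom (tensor_group S P Q) (tensor_group S P Q)"
    using assms by (intro tensorable.tlift_universal(1)[OF tensorable.intro tensor_group_abelian]
        tensor_bimod_smult_balanced[OF _ _ r]) (simp_all add: biact_def)
  then show "smult (tensor_bimod S P Q) r \<in> add_hom (tensor_bimod S P Q) (tensor_bimod S P Q)"
    by (simp add: tensor_bimod_def Let_def add_hom_def)
qed (use assms in \<open>simp add: tensor_bimod_abelian biact_def\<close>)

lemma tensor_bimod_right_act:
  assumes "right_act S P" "biact S T Q"
  shows "right_act T (tensor_bimod S P Q)"
  unfolding right_act_def
proof (intro conjI ballI)
  fix r assume r: "r \<in> carrier T"
  have "tlift (tensor_group S P Q) (\<lambda>p q. tensor S P Q p (rsmult Q q r)) \<in> add_hom (tensor_group S P Q) (tensor_group S P Q)"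
    using assms by (intro tensorable.tlift_universal(1)[OF tensorable.intro tensor_group_abelian]
        tensor_bimod_rsmult_balanced[OF _ _ r]) (simp_all add: biact_def)
  then show "(\<lambda>X. rsmult (tensor_bimod S P Q) X r) \<in> add_hom (tensor_bimod S P Q) (tensor_bimod S P Q)"
    by (simp add: tensor_bimod_def Let_def add_hom_def)
qed (use assms in \<open>simp add: tensor_bimod_abelian biact_def\<close>)

lemma tensor_bimod_biact:
  assumes "biact R S P" "biact S T Q"
  shows "biact R T (tensor_bimod S P Q)"
  unfolding biact_def
proof (intro conjI ballI)
  interpret T: tensorable S P Q using assms by (intro tensorable.intro) (simp_all add: biact_def)
  show l: "left_act R (tensor_bimod S P Q)" and r: "right_act T (tensor_bimod S P Q)"
    using assms by (auto intro: tensor_bimod_left_act tensor_bimod_right_act simp: biact_def)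
  fix x y X assume x: "x \<in> carrier R" and y: "y \<in> carrier T" and X: "X \<in> carrier (tensor_bimod S P Q)"
  note sm = tensor_bimod_smult[OF assms(1) biactD(1)[OF assms(2)]]
    tensor_bimod_rsmult[OF biactD(2)[OF assms(1)] assms(2)]
  from X have X: "X \<in> carrier (tensor_group S P Q)" by simp
  then show "rsmult (tensor_bimod S P Q) (x \<odot>\<^bsub>tensor_bimod S P Q\<^esub> X) y
      = x \<odot>\<^bsub>tensor_bimod S P Q\<^esub> rsmult (tensor_bimod S P Q) X y"
  proof (induction X rule: T.tensor_induct)
    case (pure p q)
    then show ?case
      using x y sm left_actD(2)[OF biactD(1)[OF assms(1)]] right_actD(2)[OF biactD(2)[OF assms(2)]] by simp
  next
    case (add X Y)
    then show ?case
      using left_actD[OF l] right_actD[OF r] x y by simp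
  qed
qed

text \<open>The shape of a rebracketing: a function of \<open>p\<close>, \<open>q\<close>, \<open>w\<close> descends to \<open>U \<otimes> W\<close>, where \<open>U\<close> is
  \<open>P \<otimes> Q\<close> with a right action that may come from \<open>P\<close> or from \<open>Q\<close>.\<close>

lemma nested_tlift:
  assumes PQ: "right_act S P" "left_act S Q" and UW: "right_act S' U" "left_act S' W"
    and U: "carrier U = carrier (tensor_group S P Q)" "add U = add (tensor_group S P Q)"
    and M: "abelian_group M"
    and pq: "\<And>w. w \<in> carrier W \<Longrightarrow> balanced S P Q M (\<lambda>p q. f p q w)"
    and w: "\<And>p q. p \<in> carrier P \<Longrightarrow> q \<in> carrier Q \<Longrightarrow> f p q \<in> add_hom W M"
    and bal: "\<And>p q s w. p \<in> carrier P \<Longrightarrow> q \<in> carrier Q \<Longrightarrow> s \<in> carrier S' \<Longrightarrow> w \<in> carrier W \<Longrightarrow>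
      \<exists>p' \<in> carrier P. \<exists>q' \<in> carrier Q. rsmult U (tensor S P Q p q) s = tensor S P Q p' q' \<and> f p' q' w = f p q (s \<odot>\<^bsub>W\<^esub> w)"
  defines "h \<equiv> tlift M (\<lambda>X w. tlift M (\<lambda>p q. f p q w) X)"
  shows "h \<in> add_hom (tensor_group S' U W) M"
    and "p \<in> carrier P \<Longrightarrow> q \<in> carrier Q \<Longrightarrow> w \<in> carrier W \<Longrightarrow> h (tensor S' U W (tensor S P Q p q) w) = f p q w"
proof -
  interpret T: tensorable S P Q by (rule tensorable.intro[OF PQ])
  interpret T': tensorable S' U W by (rule tensorable.intro[OF UW])
  note lift = T.tlift_universal[OF M pq]
  have W: "abelian_group W" using UW by (simp add: left_act_def)
  have hom: "tlift M (\<lambda>p q. f p q w) \<in> add_hom U M" if "w \<in> carrier W" for w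
    using lift(1)[OF that] by (simp add: add_hom_def U)
  have b: "balanced S' U W M (\<lambda>X w. tlift M (\<lambda>p q. f p q w) X)"
  proof (rule balancedI)
    fix X w assume "X \<in> carrier U" "w \<in> carrier W"
    then show "tlift M (\<lambda>p q. f p q w) X \<in> carrier M"
      using add_hom_closed[OF hom] by simp
  next
    fix X X' w assume "X \<in> carrier U" "X' \<in> carrier U" "w \<in> carrier W"
    then show "tlift M (\<lambda>p q. f p q w) (X \<oplus>\<^bsub>U\<^esub> X') = tlift M (\<lambda>p q. f p q w) X \<oplus>\<^bsub>M\<^esub> tlift M (\<lambda>p q. f p q w) X'"
      using add_hom_add[OF hom] by simp
  next
    fix X w w' assume *: "X \<in> carrier U" "w \<in> carrier W" "w' \<in> carrier W"
    then have ww': "w \<oplus>\<^bsub>W\<^esub> w' \<in> carrier W" and X: "X \<in> carrier (tensor_group S P Q)"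
      using abelian_group_a_closed[OF W] U by simp_all
    show "tlift M (\<lambda>p q. f p q (w \<oplus>\<^bsub>W\<^esub> w')) X = tlift M (\<lambda>p q. f p q w) X \<oplus>\<^bsub>M\<^esub> tlift M (\<lambda>p q. f p q w') X"
      by (rule T.tensor_eqI[OF lift(1)[OF ww'] add_hom_plus[OF lift(1)[OF *(2)] lift(1)[OF *(3)] M] _ X])
        (use * ww' add_hom_add[OF w] in \<open>simp add: lift(2)\<close>)
  next
    fix X s z assume *: "X \<in> carrier U" "s \<in> carrier S'" "z \<in> carrier W"
    then have sz: "s \<odot>\<^bsub>W\<^esub> z \<in> carrier W" and X: "X \<in> carrier (tensor_group S P Q)"
      using left_actD(2)[OF UW(2)] U by simp_all
    show "tlift M (\<lambda>p q. f p q z) (rsmult U X s) = tlift M (\<lambda>p q. f p q (s \<odot>\<^bsub>W\<^esub> z)) X"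
    proof (rule T.tensor_eqI[OF _ lift(1)[OF sz] _ X])
      show "(\<lambda>X. tlift M (\<lambda>p q. f p q z) (rsmult U X s)) \<in> add_hom (tensor_group S P Q) M"
        using add_hom_comp[OF hom[OF *(3)], of "\<lambda>X. rsmult U X s" U] UW(1) *(2)
        by (simp add: right_act_def add_hom_def U)
      fix p q assume pq: "p \<in> carrier P" "q \<in> carrier Q"
      obtain p' q' where "p' \<in> carrier P" "q' \<in> carrier Q" "rsmult U (tensor S P Q p q) s = tensor S P Q p' q'"
        "f p' q' z = f p q (s \<odot>\<^bsub>W\<^esub> z)"
        using bal[OF pq *(2,3)] by blast
      then show "tlift M (\<lambda>p q. f p q z) (rsmult U (tensor S P Q p q) s)
          = tlift M (\<lambda>p q. f p q (s \<odot>\<^bsub>W\<^esub> z)) (tensor S P Q p q)"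
        using pq * sz by (simp add: lift(2))
    qed
  qed
  show "h \<in> add_hom (tensor_group S' U W) M"
    unfolding h_def by (rule T'.tlift_universal(1)[OF M b])
  show "h (tensor S' U W (tensor S P Q p q) w) = f p q w"
    if "p \<in> carrier P" "q \<in> carrier Q" "w \<in> carrier W"
    unfolding h_def using that T.tensor_closed U
    by (subst T'.tlift_universal(2)[OF M b]) (simp_all add: T.tlift_universal(2)[OF M pq])
qed

section \<open>Tensor products of commutative algebras\<close>

lemma cring_cong:
  fixes M :: "('a, 'x) ring_scheme" and N :: "('a, 'y) ring_scheme"
  assumes "cring M" "carrier N = carrier M" "add N = add M" "zero N = zero M" "one N = one M"
    and "\<And>x y. x \<in> carrier M \<Longrightarrow> y \<in> carrier M \<Longrightarrow> x \<otimes>\<^bsub>N\<^esub> y = x \<otimes>\<^bsub>M\<^esub> y"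
  shows "cring N"
proof -
  interpret M: cring M by fact
  show ?thesis
  proof (rule cringI)
    show "abelian_group N"
      by (rule abelian_group_cong[OF M.abelian_group_axioms]) (use assms in auto)
    show "comm_monoid N"
      by (rule comm_monoidI) (use assms in \<open>auto simp: M.m_ac\<close>)
  qed (use assms in \<open>auto simp: M.l_distr\<close>)
qed

text \<open>The conditions say that \<open>S\<close> acts by multiplication operators; they make factorwise multiplication well
  defined.\<close>

locale tensor_algebras = tensorable S P Q
  for S :: "('s, 'y) ring_scheme" and P :: "('r, 'p, 's) bimod" and Q :: "('s, 'q, 't) bimod" +
  assumes cring_P: "cring P" and cring_Q: "cring Q"
    and rsmult_mult: "p \<in> carrier P \<Longrightarrow> p' \<in> carrier P \<Longrightarrow> s \<in> carrier S \<Longrightarrow>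
      rsmult P (p \<otimes>\<^bsub>P\<^esub> p') s = rsmult P p s \<otimes>\<^bsub>P\<^esub> p'"
    and smult_mult: "q \<in> carrier Q \<Longrightarrow> q' \<in> carrier Q \<Longrightarrow> s \<in> carrier S \<Longrightarrow>
      s \<odot>\<^bsub>Q\<^esub> (q \<otimes>\<^bsub>Q\<^esub> q') = (s \<odot>\<^bsub>Q\<^esub> q) \<otimes>\<^bsub>Q\<^esub> q'"
begin

sublocale PR: cring P by (rule cring_P)
sublocale QR: cring Q by (rule cring_Q)

lemma product_balanced:
  fixes M :: "(('p, 'q) tens, 'm) ring_scheme"
  assumes M: "carrier M = carrier G" "add M = add G"
    and pq: "p \<in> carrier P" "q \<in> carrier Q"
  shows "balanced S P Q M (\<lambda>p' q'. t (p \<otimes>\<^bsub>P\<^esub> p') (q \<otimes>\<^bsub>Q\<^esub> q'))"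
    and "balanced S P Q M (\<lambda>p' q'. t (p' \<otimes>\<^bsub>P\<^esub> p) (q' \<otimes>\<^bsub>Q\<^esub> q))"
proof -
  show r: "balanced S P Q M (\<lambda>p' q'. t (p' \<otimes>\<^bsub>P\<^esub> p) (q' \<otimes>\<^bsub>Q\<^esub> q))"
  proof (rule balancedI)
    fix p' s q' assume "p' \<in> carrier P" "s \<in> carrier S" "q' \<in> carrier Q"
    then show "t (rsmult P p' s \<otimes>\<^bsub>P\<^esub> p) (q' \<otimes>\<^bsub>Q\<^esub> q) = t (p' \<otimes>\<^bsub>P\<^esub> p) ((s \<odot>\<^bsub>Q\<^esub> q') \<otimes>\<^bsub>Q\<^esub> q)"
      using pq by (simp add: tensor_smult flip: rsmult_mult smult_mult)
  qed (use pq in \<open>simp_all add: M tensor_closed PR.l_distr QR.l_distr tensor_add_left tensor_add_right\<close>)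
  have *: "p' \<in> carrier P \<Longrightarrow> p \<otimes>\<^bsub>P\<^esub> p' = p' \<otimes>\<^bsub>P\<^esub> p" "q' \<in> carrier Q \<Longrightarrow> q \<otimes>\<^bsub>Q\<^esub> q' = q' \<otimes>\<^bsub>Q\<^esub> q" for p' q'
    using pq PR.m_comm QR.m_comm by simp_all
  note rD = balancedD[OF r]
  show "balanced S P Q M (\<lambda>p' q'. t (p \<otimes>\<^bsub>P\<^esub> p') (q \<otimes>\<^bsub>Q\<^esub> q'))"
    by (rule balancedI) (use rD right_actD(2)[OF P] left_actD(2)[OF Q] in \<open>simp_all add: *\<close>)
qed

text \<open>The record \<open>M\<close> only supplies the addition in which the sums are formed: it is the tensor group in one
  case and the bimodule on it in the other.\<close>

lemma product_tlift:
  fixes M :: "(('p, 'q) tens, 'm) ring_scheme"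
  assumes M: "carrier M = carrier G" "add M = add G" "zero M = zero G"
  defines "h \<equiv> \<lambda>X Y. tlift M (\<lambda>p q. tlift M (\<lambda>p' q'. t (p \<otimes>\<^bsub>P\<^esub> p') (q \<otimes>\<^bsub>Q\<^esub> q')) Y) X"
  shows "Y \<in> carrier G \<Longrightarrow> (\<lambda>X. h X Y) \<in> add_hom G G"
    and "X \<in> carrier G \<Longrightarrow> h X \<in> add_hom G G"
    and "p \<in> carrier P \<Longrightarrow> q \<in> carrier Q \<Longrightarrow> p' \<in> carrier P \<Longrightarrow> q' \<in> carrier Q \<Longrightarrow>
      h (t p q) (t p' q') = t (p \<otimes>\<^bsub>P\<^esub> p') (q \<otimes>\<^bsub>Q\<^esub> q')"
proof -
  have M': "abelian_group M"
    by (rule abelian_group_cong[OF abelian_G]) (use M in simp_all)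
  have eq: "add_hom G M = add_hom G G" by (simp add: add_hom_def M)
  note * = tlift_tlift[OF P Q P Q M' product_balanced[OF M(1,2)]]
  show "Y \<in> carrier G \<Longrightarrow> (\<lambda>X. h X Y) \<in> add_hom G G"
    unfolding h_def eq[symmetric] by (rule *(1))
  show "X \<in> carrier G \<Longrightarrow> h X \<in> add_hom G G"
    unfolding h_def eq[symmetric] by (rule *(2))
  show "p \<in> carrier P \<Longrightarrow> q \<in> carrier Q \<Longrightarrow> p' \<in> carrier P \<Longrightarrow> q' \<in> carrier Q \<Longrightarrow>
      h (t p q) (t p' q') = t (p \<otimes>\<^bsub>P\<^esub> p') (q \<otimes>\<^bsub>Q\<^esub> q')"
    unfolding h_def by (rule *(3))
qed

end

text \<open>Any ring structure on the tensor product in which pure tensors are multiplied factorwise; the enveloping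
  algebra and the tensor products of its quotients are of this kind.\<close>

locale tensor_cring = tensor_algebras S P Q
  for S :: "('s, 'y) ring_scheme" and P :: "('r, 'p, 's) bimod" and Q :: "('s, 'q, 't) bimod" +
  fixes R :: "(('p, 'q) tens, 'm) ring_scheme"
  assumes R: "carrier R = carrier G" "add R = add G" "zero R = zero G"
    and one_R: "one R = t \<one>\<^bsub>P\<^esub> \<one>\<^bsub>Q\<^esub>"
    and mult_left: "Y \<in> carrier G \<Longrightarrow> (\<lambda>X. X \<otimes>\<^bsub>R\<^esub> Y) \<in> add_hom G G"
    and mult_right: "X \<in> carrier G \<Longrightarrow> (\<lambda>Y. X \<otimes>\<^bsub>R\<^esub> Y) \<in> add_hom G G"
    and mult_pure: "p \<in> carrier P \<Longrightarrow> q \<in> carrier Q \<Longrightarrow> p' \<in> carrier P \<Longrightarrow> q' \<in> carrier Q \<Longrightarrow>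
      t p q \<otimes>\<^bsub>R\<^esub> t p' q' = t (p \<otimes>\<^bsub>P\<^esub> p') (q \<otimes>\<^bsub>Q\<^esub> q')"
begin

lemmas mult_add = add_hom_add[OF mult_left] add_hom_add[OF mult_right]
lemmas mult_closed = add_hom_closed[OF mult_right]

lemma mult_comm: "X \<in> carrier G \<Longrightarrow> Y \<in> carrier G \<Longrightarrow> X \<otimes>\<^bsub>R\<^esub> Y = Y \<otimes>\<^bsub>R\<^esub> X"
proof (induction X rule: tensor_induct)
  case (pure p q)
  from pure(3) show ?case
    by (induction Y rule: tensor_induct)
      (use pure(1,2) in \<open>simp_all add: mult_add tensor_closed mult_pure PR.m_comm QR.m_comm\<close>)
qed (simp add: mult_add)

lemma mult_assoc:
  "X \<in> carrier G \<Longrightarrow> Y \<in> carrier G \<Longrightarrow> Z \<in> carrier G \<Longrightarrow> X \<otimes>\<^bsub>R\<^esub> Y \<otimes>\<^bsub>R\<^esub> Z = X \<otimes>\<^bsub>R\<^esub> (Y \<otimes>\<^bsub>R\<^esub> Z)"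
proof (induction X rule: tensor_induct)
  case (pure p q)
  from pure(3) show ?case
  proof (induction Y rule: tensor_induct)
    case (pure p' q')
    from \<open>Z \<in> carrier G\<close> show ?case
      by (induction Z rule: tensor_induct)
        (use pure \<open>p \<in> carrier P\<close> \<open>q \<in> carrier Q\<close>
          in \<open>simp_all add: mult_add tensor_closed mult_pure mult_closed PR.m_assoc QR.m_assoc\<close>)
  qed (use pure in \<open>simp add: mult_add mult_closed tensor_closed\<close>)
qed (simp add: mult_add mult_closed)

lemma mult_one: "X \<in> carrier G \<Longrightarrow> \<one>\<^bsub>R\<^esub> \<otimes>\<^bsub>R\<^esub> X = X"
  by (induction X rule: tensor_induct) (simp_all add: one_R mult_add tensor_closed mult_pure)

lemma cring_R: "cring R"
proof (rule cringI)
  show "abelian_group R"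
    by (rule abelian_group_cong[OF abelian_G]) (rule R)+
  show "comm_monoid R"
    by (rule comm_monoidI)
      (simp_all add: R mult_closed mult_assoc mult_one, simp_all add: one_R tensor_closed mult_comm)
qed (simp add: R mult_add)

lemma left_hom: "(\<lambda>p. t p \<one>\<^bsub>Q\<^esub>) \<in> ring_hom P R"
  by (rule ring_hom_memI) (simp_all add: R tensor_closed mult_pure tensor_add_left one_R)

lemma right_hom: "(\<lambda>q. t \<one>\<^bsub>P\<^esub> q) \<in> ring_hom Q R"
  by (rule ring_hom_memI) (simp_all add: R tensor_closed mult_pure tensor_add_right one_R)

text \<open>The tensor product is the pushout of commutative rings.\<close>

lemma lift_ring_hom:
  assumes "cring A" and f: "f \<in> ring_hom P A" and g: "g \<in> ring_hom Q A"
    and bal: "\<And>s p q. s \<in> carrier S \<Longrightarrow> p \<in> carrier P \<Longrightarrow> q \<in> carrier Q \<Longrightarrow>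
      f (rsmult P p s) \<otimes>\<^bsub>A\<^esub> g q = f p \<otimes>\<^bsub>A\<^esub> g (s \<odot>\<^bsub>Q\<^esub> q)"
  shows "tlift A (\<lambda>p q. f p \<otimes>\<^bsub>A\<^esub> g q) \<in> ring_hom R A"
    and "p \<in> carrier P \<Longrightarrow> q \<in> carrier Q \<Longrightarrow> tlift A (\<lambda>p q. f p \<otimes>\<^bsub>A\<^esub> g q) (t p q) = f p \<otimes>\<^bsub>A\<^esub> g q"
proof -
  interpret A: cring A by fact
  note [simp] = ring_hom_closed[OF f] ring_hom_closed[OF g] ring_hom_add[OF f] ring_hom_add[OF g]
    ring_hom_mult[OF f] ring_hom_mult[OF g] ring_hom_one[OF f] ring_hom_one[OF g]
  have balanced: "balanced S P Q A (\<lambda>p q. f p \<otimes>\<^bsub>A\<^esub> g q)"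
    by (rule balancedI) (simp_all add: A.l_distr A.r_distr bal)
  let ?h = "tlift A (\<lambda>p q. f p \<otimes>\<^bsub>A\<^esub> g q)"
  note lift = tlift_universal[OF A.abelian_group_axioms balanced]
  show pure: "p \<in> carrier P \<Longrightarrow> q \<in> carrier Q \<Longrightarrow> ?h (t p q) = f p \<otimes>\<^bsub>A\<^esub> g q" for p q
    by (rule lift(2))
  note cl = add_hom_closed[OF lift(1)] and add = add_hom_add[OF lift(1)]
  show "?h \<in> ring_hom R A"
  proof (rule ring_hom_memI)
    fix X Y assume X: "X \<in> carrier R" and Y: "Y \<in> carrier R"
    then have "X \<in> carrier G" "Y \<in> carrier G" by (simp_all add: R)
    then show "?h (X \<otimes>\<^bsub>R\<^esub> Y) = ?h X \<otimes>\<^bsub>A\<^esub> ?h Y"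
    proof (induction X rule: tensor_induct)
      case (pure p q)
      from pure(3) show ?case
        by (induction Y rule: tensor_induct)
          (use pure(1,2) in \<open>simp_all add: mult_add tensor_closed mult_pure mult_closed lift(2) add cl A.r_distr A.m_ac\<close>)
    qed (simp add: mult_add mult_closed add cl A.l_distr)
  qed (use cl add in \<open>simp_all add: R one_R lift(2)\<close>)
qed

end

definition tensor_ring ::
  "('s, 'y) ring_scheme \<Rightarrow> ('r, 'p, 's) bimod \<Rightarrow> ('s, 'q, 't) bimod \<Rightarrow> ('p, 'q) tens ring" where
  "tensor_ring S P Q = (let G = tensor_group S P Q; t = tensor S P Q in
     G\<lparr>mult := \<lambda>X Y. tlift G (\<lambda>p q. tlift G (\<lambda>p' q'. t (p \<otimes>\<^bsub>P\<^esub> p') (q \<otimes>\<^bsub>Q\<^esub> q')) Y) X,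
       one := t \<one>\<^bsub>P\<^esub> \<one>\<^bsub>Q\<^esub>\<rparr>)"

lemma tensor_ring_simps [simp]:
  "carrier (tensor_ring S P Q) = carrier (tensor_group S P Q)"
  "add (tensor_ring S P Q) = add (tensor_group S P Q)"
  "zero (tensor_ring S P Q) = zero (tensor_group S P Q)"
  "one (tensor_ring S P Q) = tensor S P Q \<one>\<^bsub>P\<^esub> \<one>\<^bsub>Q\<^esub>"
  by (simp_all add: tensor_ring_def Let_def)

lemma (in tensor_algebras) tensor_cring_tensor_ring: "tensor_cring S P Q (tensor_ring S P Q)"
  by unfold_locales (simp_all add: tensor_ring_def Let_def product_tlift)

section \<open>The enveloping algebra of a commutative algebra\<close>

locale pair_algebra =
  fixes K :: "('k, 'x) ring_scheme" and B :: "('k, 'b, 'y) module_scheme"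
  assumes field_K: "field K" and algebra_B: "algebra K B"
begin

sublocale K: field K by (rule field_K)

lemma cring_B: "cring B" using algebra_B by (rule algebra.M_cring)

sublocale BR: cring B by (rule cring_B)
sublocale B: algebra K B by (rule algebra_B)

abbreviation "E \<equiv> env K B"
abbreviation "ee \<equiv> env_elem K B"
abbreviation "s \<equiv> src K B"
abbreviation "t \<equiv> tgt K B"
abbreviation "VB \<equiv> vs_bimod B"
abbreviation "VO \<equiv> vs_bimod (op_alg B)"

lemma op_alg_simps [simp]:
  "carrier (op_alg B) = carrier B" "add (op_alg B) = add B" "zero (op_alg B) = zero B"
  "one (op_alg B) = one B" "smult (op_alg B) = smult B" "x \<otimes>\<^bsub>op_alg B\<^esub> y = y \<otimes>\<^bsub>B\<^esub> x"
  by (simp_all add: op_alg_def)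

lemma vs_bimod_simps [simp]:
  "carrier (vs_bimod M) = carrier M" "add (vs_bimod M) = add M" "zero (vs_bimod M) = zero M"
  "one (vs_bimod M) = one M" "mult (vs_bimod M) = mult M" "smult (vs_bimod M) = smult M"
  "rsmult (vs_bimod M) x k = k \<odot>\<^bsub>M\<^esub> x"
  by (simp_all add: vs_bimod_def)

lemma smult_assoc_right:
  "k \<in> carrier K \<Longrightarrow> a \<in> carrier B \<Longrightarrow> b \<in> carrier B \<Longrightarrow> a \<otimes>\<^bsub>B\<^esub> (k \<odot>\<^bsub>B\<^esub> b) = k \<odot>\<^bsub>B\<^esub> (a \<otimes>\<^bsub>B\<^esub> b)"
  using B.smult_assoc2[of k b a] by (simp add: BR.m_comm)

lemma smult_one_mult:
  "k \<in> carrier K \<Longrightarrow> a \<in> carrier B \<Longrightarrow> k \<odot>\<^bsub>B\<^esub> a = (k \<odot>\<^bsub>B\<^esub> \<one>\<^bsub>B\<^esub>) \<otimes>\<^bsub>B\<^esub> a"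
  by (simp add: B.smult_assoc2)

lemma VB_cring: "cring VB" by (rule cring_cong[OF cring_B]) simp_all
lemma VO_cring: "cring VO" by (rule cring_cong[OF cring_B]) (simp_all add: BR.m_comm)

lemma vs_biact: "biact K K VB" "biact K K VO"
proof -
  have ab: "abelian_group VB" "abelian_group VO"
    by (rule abelian_group_cong[OF BR.abelian_group_axioms]; simp)+
  have comm: "r \<odot>\<^bsub>B\<^esub> (k \<odot>\<^bsub>B\<^esub> x) = k \<odot>\<^bsub>B\<^esub> (r \<odot>\<^bsub>B\<^esub> x)"
    if "r \<in> carrier K" "k \<in> carrier K" "x \<in> carrier B" for r k x
    using that by (simp add: K.m_comm flip: B.smult_assoc1)
  show "biact K K VB" "biact K K VO"
    using ab by (auto simp: biact_def left_act_def right_act_def add_hom_def B.smult_r_distr comm)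
qed

sublocale EA: tensor_algebras K VB VO
  by (intro tensor_algebras.intro tensorable.intro tensor_algebras_axioms.intro)
    (simp_all add: VB_cring VO_cring B.smult_assoc2 smult_assoc_right biactD[OF vs_biact(1)] biactD[OF vs_biact(2)])

lemma env_simps:
  "carrier E = carrier (tensor_group K VB VO)" "add E = add (tensor_group K VB VO)"
  "zero E = zero (tensor_group K VB VO)" "one E = ee \<one>\<^bsub>B\<^esub> \<one>\<^bsub>B\<^esub>"
  "smult E = smult (tensor_bimod K VB VO)"
  by (simp_all add: env_def alg_tensor_def Let_def env_elem_def)

sublocale ET: tensor_cring K VB VO E
proof -
  let ?V = "tensor_bimod K VB VO"
  have "X \<otimes>\<^bsub>E\<^esub> Y = tlift ?V (\<lambda>p q. tlift ?V (\<lambda>p' q'. tensor K VB VO (p \<otimes>\<^bsub>VB\<^esub> p') (q \<otimes>\<^bsub>VO\<^esub> q')) Y) X" for X Y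
    by (simp add: env_def alg_tensor_def Let_def)
  then show "tensor_cring K VB VO E"
    using EA.product_tlift[of ?V] by unfold_locales (simp_all add: env_simps env_elem_def)
qed

sublocale E: cring E by (rule ET.cring_R)

lemma ee_closed [simp]: "a \<in> carrier B \<Longrightarrow> b \<in> carrier B \<Longrightarrow> ee a b \<in> carrier E"
  by (simp add: env_simps env_elem_def EA.tensor_closed)

text \<open>The reversed product in the second factor is invisible because \<open>B\<close> is commutative.\<close>

lemma ee_mult:
  "a \<in> carrier B \<Longrightarrow> b \<in> carrier B \<Longrightarrow> c \<in> carrier B \<Longrightarrow> d \<in> carrier B \<Longrightarrow>
    ee a b \<otimes>\<^bsub>E\<^esub> ee c d = ee (a \<otimes>\<^bsub>B\<^esub> c) (b \<otimes>\<^bsub>B\<^esub> d)"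
  using ET.mult_pure[of a b c d] by (simp add: env_elem_def BR.m_comm)

lemma env_induct [consumes 1, case_names pure add]:
  assumes "X \<in> carrier E"
    and "\<And>a b. a \<in> carrier B \<Longrightarrow> b \<in> carrier B \<Longrightarrow> Pr (ee a b)"
    and "\<And>X Y. X \<in> carrier E \<Longrightarrow> Y \<in> carrier E \<Longrightarrow> Pr X \<Longrightarrow> Pr Y \<Longrightarrow> Pr (X \<oplus>\<^bsub>E\<^esub> Y)"
  shows "Pr X"
  using EA.tensor_induct[of X Pr] assms by (simp add: env_simps env_elem_def)

lemma src_hom: "s \<in> ring_hom B E"
  using ET.left_hom by (simp add: src_def[abs_def] env_elem_def[abs_def] ring_hom_def)

lemma tgt_hom: "t \<in> ring_hom B E"
  using ET.right_hom by (simp add: tgt_def[abs_def] env_elem_def[abs_def] ring_hom_def Pi_def BR.m_comm)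

lemma src_closed [simp]: "a \<in> carrier B \<Longrightarrow> s a \<in> carrier E"
  by (simp add: src_def)

lemma tgt_closed [simp]: "a \<in> carrier B \<Longrightarrow> t a \<in> carrier E"
  by (simp add: tgt_def)

lemmas src_simps = ring_hom_mult[OF src_hom] ring_hom_add[OF src_hom] ring_hom_one[OF src_hom]
lemmas tgt_simps = ring_hom_mult[OF tgt_hom] ring_hom_add[OF tgt_hom] ring_hom_one[OF tgt_hom]

lemma ee_src_tgt: "a \<in> carrier B \<Longrightarrow> b \<in> carrier B \<Longrightarrow> ee a b = s a \<otimes>\<^bsub>E\<^esub> t b"
  by (simp add: src_def tgt_def ee_mult)

lemma ee_smult:
  assumes "k \<in> carrier K" "a \<in> carrier B" "b \<in> carrier B"
  shows "k \<odot>\<^bsub>E\<^esub> ee a b = ee (k \<odot>\<^bsub>B\<^esub> a) b" "ee (k \<odot>\<^bsub>B\<^esub> a) b = ee a (k \<odot>\<^bsub>B\<^esub> b)"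
  using assms tensor_bimod_smult[OF vs_biact(1) biactD(1)[OF vs_biact(2)], of k a b] EA.tensor_smult[of a k b]
  by (simp_all add: env_simps env_elem_def)

lemma scal_eq: "k \<in> carrier K \<Longrightarrow> scal K B k = s (k \<odot>\<^bsub>B\<^esub> \<one>\<^bsub>B\<^esub>)"
  "k \<in> carrier K \<Longrightarrow> scal K B k = t (k \<odot>\<^bsub>B\<^esub> \<one>\<^bsub>B\<^esub>)"
  by (simp_all add: scal_def src_def tgt_def env_simps(4) ee_smult)

lemma env_smult:
  assumes "k \<in> carrier K" "X \<in> carrier E"
  shows "k \<odot>\<^bsub>E\<^esub> X = scal K B k \<otimes>\<^bsub>E\<^esub> X"
  using assms(2)
proof (induction rule: env_induct)
  case (pure a b)
  then show ?case
    using assms by (simp add: ee_smult(1) scal_def env_simps(4) ee_mult flip: smult_one_mult)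
next
  case (add X Y)
  have "left_act K (tensor_bimod K VB VO)"
    by (rule tensor_bimod_left_act[OF vs_biact(1) biactD(1)[OF vs_biact(2)]])
  from left_actD(3)[OF this] add(1,2) have "k \<odot>\<^bsub>E\<^esub> (X \<oplus>\<^bsub>E\<^esub> Y) = k \<odot>\<^bsub>E\<^esub> X \<oplus>\<^bsub>E\<^esub> k \<odot>\<^bsub>E\<^esub> Y"
    using assms by (simp add: env_simps(1,2,5))
  with add show ?case
    using assms by (simp add: scal_eq(1) E.r_distr)
qed

lemma scal_closed [simp]: "k \<in> carrier K \<Longrightarrow> scal K B k \<in> carrier E"
  by (simp add: scal_eq)

lemma k_algebra_B: "k_algebra K B"
  unfolding k_algebra_def using B.module BR.ring_axioms
  by (simp add: field_K B.smult_assoc2 smult_assoc_right)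

lemma k_algebra_E: "k_algebra K E"
proof -
  have scal_add: "scal K B (k \<oplus>\<^bsub>K\<^esub> l) = scal K B k \<oplus>\<^bsub>E\<^esub> scal K B l" if "k \<in> carrier K" "l \<in> carrier K" for k l
    using that by (simp add: scal_eq(1) B.smult_l_distr src_simps)
  have scal_mult: "scal K B (k \<otimes>\<^bsub>K\<^esub> l) = scal K B k \<otimes>\<^bsub>E\<^esub> scal K B l" if "k \<in> carrier K" "l \<in> carrier K" for k l
    using that by (simp add: scal_eq(1) B.smult_assoc1 B.smult_assoc2 flip: src_simps(1))
  have scal_one: "scal K B \<one>\<^bsub>K\<^esub> = \<one>\<^bsub>E\<^esub>"
    by (simp add: scal_eq(1) src_simps)
  have "module K E"
    by (rule moduleI)
      (simp_all add: K.is_cring E.abelian_group_axioms env_smult scal_add scal_mult scal_one E.l_distr E.r_distr E.m_assoc)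
  then show ?thesis
    unfolding k_algebra_def by (simp add: field_K E.ring_axioms env_smult E.m_ac)
qed

lemma counit_hom: "pair_counit K B \<in> ring_hom E B"
  and counit_ee: "a \<in> carrier B \<Longrightarrow> b \<in> carrier B \<Longrightarrow> pair_counit K B (ee a b) = a \<otimes>\<^bsub>B\<^esub> b"
  using ET.lift_ring_hom[OF cring_B, of "\<lambda>x. x" "\<lambda>x. x"]
  by (simp_all add: pair_counit_def env_elem_def ring_hom_def BR.m_comm B.smult_assoc2 smult_assoc_right)

lemma counit_closed [simp]: "X \<in> carrier E \<Longrightarrow> pair_counit K B X \<in> carrier B"
  by (rule ring_hom_closed[OF counit_hom])

lemma counit_src_tgt [simp]:
  "a \<in> carrier B \<Longrightarrow> pair_counit K B (s a) = a" "a \<in> carrier B \<Longrightarrow> pair_counit K B (t a) = a"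
  by (simp_all add: src_def tgt_def counit_ee)

text \<open>The enveloping algebra is the coproduct of two copies of \<open>B\<close> over \<open>K\<close>: a ring homomorphism out of it is
  the same as a pair of ring homomorphisms out of \<open>B\<close> that agree on scalars.\<close>

definition env_lift :: "('a, 'z) ring_scheme \<Rightarrow> ('b \<Rightarrow> 'a) \<Rightarrow> ('b \<Rightarrow> 'a) \<Rightarrow> ('b, 'b) tens \<Rightarrow> 'a" where
  "env_lift A f g = tlift A (\<lambda>a b. f a \<otimes>\<^bsub>A\<^esub> g b)"

lemma env_lift:
  assumes "cring A" and f: "f \<in> ring_hom B A" and g: "g \<in> ring_hom B A"
    and bal: "\<And>k. k \<in> carrier K \<Longrightarrow> f (k \<odot>\<^bsub>B\<^esub> \<one>\<^bsub>B\<^esub>) = g (k \<odot>\<^bsub>B\<^esub> \<one>\<^bsub>B\<^esub>)"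
  shows "env_lift A f g \<in> ring_hom E A"
    and "a \<in> carrier B \<Longrightarrow> b \<in> carrier B \<Longrightarrow> env_lift A f g (ee a b) = f a \<otimes>\<^bsub>A\<^esub> g b"
    and "a \<in> carrier B \<Longrightarrow> env_lift A f g (s a) = f a"
    and "b \<in> carrier B \<Longrightarrow> env_lift A f g (t b) = g b"
proof -
  interpret A: cring A by fact
  note [simp] = ring_hom_closed[OF f] ring_hom_closed[OF g] ring_hom_mult[OF f] ring_hom_mult[OF g]
    ring_hom_one[OF f] ring_hom_one[OF g]
  have "f (rsmult VB p k) \<otimes>\<^bsub>A\<^esub> g q = f p \<otimes>\<^bsub>A\<^esub> g (k \<odot>\<^bsub>VO\<^esub> q)"
    if "k \<in> carrier K" "p \<in> carrier VB" "q \<in> carrier VO" for k p q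
    using that by (simp add: smult_one_mult[of k p] smult_one_mult[of k q] bal A.m_ac)
  moreover have "f \<in> ring_hom VB A" "g \<in> ring_hom VO A"
    using f g by (auto simp: ring_hom_def Pi_def BR.m_comm)
  ultimately have *: "env_lift A f g \<in> ring_hom E A"
      "a \<in> carrier B \<Longrightarrow> b \<in> carrier B \<Longrightarrow> env_lift A f g (ee a b) = f a \<otimes>\<^bsub>A\<^esub> g b" for a b
    using ET.lift_ring_hom[OF \<open>cring A\<close>, of f g] by (simp_all add: env_lift_def env_elem_def)
  show "env_lift A f g \<in> ring_hom E A"
    and "a \<in> carrier B \<Longrightarrow> b \<in> carrier B \<Longrightarrow> env_lift A f g (ee a b) = f a \<otimes>\<^bsub>A\<^esub> g b"
    by (fact *)+
  show "a \<in> carrier B \<Longrightarrow> env_lift A f g (s a) = f a"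
    and "b \<in> carrier B \<Longrightarrow> env_lift A f g (t b) = g b"
    by (simp_all add: src_def tgt_def *(2))
qed

end

section \<open>Powers of the kernel of the product\<close>

lemma ring_hom_cringI_ring_hom:
  "cring R \<Longrightarrow> cring S \<Longrightarrow> h \<in> ring_hom R S \<Longrightarrow> ring_hom_cring R S h"
  by (rule ring_hom_cringI[OF ring_hom_ringI2]) (auto simp: cring_def)

text \<open>For a decreasing multiplicative filtration \<open>I\<close>, this is the \<open>n\<close>-th step of the product filtration on \<open>T\<close> that
  is induced by the two homomorphisms \<open>f\<close> and \<open>g\<close>.\<close>

inductive_set product_span ::
  "('t, 'z) ring_scheme \<Rightarrow> ('a \<Rightarrow> 't) \<Rightarrow> ('a \<Rightarrow> 't) \<Rightarrow> (nat \<Rightarrow> 'a set) \<Rightarrow> nat \<Rightarrow> 't set"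
  for T :: "('t, 'z) ring_scheme" and f g :: "'a \<Rightarrow> 't" and I :: "nat \<Rightarrow> 'a set" and n :: nat where
  prod: "i + j = n \<Longrightarrow> x \<in> I i \<Longrightarrow> y \<in> I j \<Longrightarrow> c \<in> carrier T \<Longrightarrow>
    f x \<otimes>\<^bsub>T\<^esub> g y \<otimes>\<^bsub>T\<^esub> c \<in> product_span T f g I n"
| add: "u \<in> product_span T f g I n \<Longrightarrow> v \<in> product_span T f g I n \<Longrightarrow> u \<oplus>\<^bsub>T\<^esub> v \<in> product_span T f g I n"

context pair_algebra
begin

abbreviation "mu \<equiv> mu_power K B"
abbreviation "q \<equiv> quot K B"
abbreviation "Q i \<equiv> E Quot mu i"
abbreviation "J i \<equiv> ring_bimod (q i) (Q i)"

sublocale IS: comm_monoid "ideals_set E"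
  by (rule E.ideals_set_is_comm_monoid)

lemma ideal_mu_ideal: "ideal (mu_ideal K B) E"
  unfolding mu_ideal_def
  by (rule ring_hom_ring.kernel_is_ideal, rule ring_hom_ringI2[OF E.ring_axioms BR.ring_axioms counit_hom])

lemma mu_ideal_iff: "x \<in> mu_ideal K B \<longleftrightarrow> x \<in> carrier E \<and> pair_counit K B x = \<zero>\<^bsub>B\<^esub>"
  by (auto simp: mu_ideal_def a_kernel_def kernel_def)

lemma ideal_mu: "ideal (mu i) E"
  using IS.nat_pow_closed[of "mu_ideal K B" i] ideal_mu_ideal by (simp add: mu_power_def ideals_set_def)

lemma mu_closed: "x \<in> mu i \<Longrightarrow> x \<in> carrier E"
  using ideal.Icarr[OF ideal_mu] .

lemma mu_0: "mu 0 = carrier E"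
  by (simp add: mu_power_def ideals_set_def)

lemma mu_1: "mu 1 = mu_ideal K B"
  using IS.l_one[of "mu_ideal K B"] ideal_mu_ideal by (simp add: mu_power_def ideals_set_def)

lemma mu_Suc: "mu (Suc i) = ideal_prod E (mu i) (mu 1)"
  unfolding mu_1 by (simp add: mu_power_def ideals_set_def)

lemma mu_mult: "x \<in> mu i \<Longrightarrow> y \<in> mu j \<Longrightarrow> x \<otimes>\<^bsub>E\<^esub> y \<in> mu (i + j)"
  using IS.nat_pow_mult[of "mu_ideal K B" i j] ideal_mu_ideal
  by (simp add: mu_power_def ideals_set_def) (metis ideal_prod.prod)

lemma mu_antimono: "i \<le> j \<Longrightarrow> mu j \<subseteq> mu i"
proof (induction rule: dec_induct)
  case (step n)
  have "mu (Suc n) \<subseteq> mu n"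
    using E.ideal_prod_inter[OF ideal_mu ideal_mu] unfolding mu_Suc by blast
  with step show ?case by blast
qed simp

lemma src_tgt_mu: "a \<in> carrier B \<Longrightarrow> s a \<ominus>\<^bsub>E\<^esub> t a \<in> mu 1"
proof -
  assume a: "a \<in> carrier B"
  interpret h: ring_hom_cring E B "pair_counit K B"
    by (rule ring_hom_cringI_ring_hom[OF E.is_cring cring_B counit_hom])
  show ?thesis
    unfolding mu_1 mu_ideal_iff using a by (simp add: a_minus_def BR.r_neg)
qed

text \<open>If two ring homomorphisms vanish on \<open>\<mu>\<^sup>k\<close> and a third one maps the generators of \<open>\<mu>\<close> to sums of
  values of the first two on \<open>\<mu>\<close>, then it vanishes on \<open>\<mu>\<^sup>2\<^sup>k\<close>: each product of \<open>2 k\<close> such sums expands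
  into terms with at least \<open>k\<close> factors of the same kind.\<close>

lemma vanish_mu_double:
  assumes "cring T" and f: "f \<in> ring_hom E T" and g: "g \<in> ring_hom E T" and h: "h \<in> ring_hom E T"
    and f0: "\<And>x. x \<in> mu k \<Longrightarrow> f x = \<zero>\<^bsub>T\<^esub>" and g0: "\<And>x. x \<in> mu k \<Longrightarrow> g x = \<zero>\<^bsub>T\<^esub>"
    and gen: "\<And>a. a \<in> carrier B \<Longrightarrow> \<exists>u \<in> mu 1. \<exists>v \<in> mu 1. h (s a) = f u \<oplus>\<^bsub>T\<^esub> g v \<oplus>\<^bsub>T\<^esub> h (t a)"
    and z: "z \<in> mu (2 * k)"
  shows "h z = \<zero>\<^bsub>T\<^esub>"
proof -
  interpret T: cring T by fact
  interpret h: ring_hom_cring E T h by (rule ring_hom_cringI_ring_hom[OF E.is_cring T.is_cring h])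
  interpret f: ring_hom_cring E T f by (rule ring_hom_cringI_ring_hom[OF E.is_cring T.is_cring f])
  interpret g: ring_hom_cring E T g by (rule ring_hom_cringI_ring_hom[OF E.is_cring T.is_cring g])
  let ?N = "product_span T f g mu"
  have N_closed: "x \<in> carrier T" if "x \<in> ?N n" for x n
    using that by induction (auto dest: mu_closed)
  have N_mult: "x \<otimes>\<^bsub>T\<^esub> y \<in> ?N (m + n)" if "x \<in> ?N m" "y \<in> ?N n" for x y m n
    using that(1)
  proof induction
    case (prod i j x y' c)
    note x = prod
    show ?case
      using that(2)
    proof induction
      case (prod i' j' x' y'' c')
      have "(f x \<otimes>\<^bsub>T\<^esub> g y' \<otimes>\<^bsub>T\<^esub> c) \<otimes>\<^bsub>T\<^esub> (f x' \<otimes>\<^bsub>T\<^esub> g y'' \<otimes>\<^bsub>T\<^esub> c')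
          = f (x \<otimes>\<^bsub>E\<^esub> x') \<otimes>\<^bsub>T\<^esub> g (y' \<otimes>\<^bsub>E\<^esub> y'') \<otimes>\<^bsub>T\<^esub> (c \<otimes>\<^bsub>T\<^esub> c')"
        using x prod by (simp add: mu_closed T.m_ac)
      moreover have "f (x \<otimes>\<^bsub>E\<^esub> x') \<otimes>\<^bsub>T\<^esub> g (y' \<otimes>\<^bsub>E\<^esub> y'') \<otimes>\<^bsub>T\<^esub> (c \<otimes>\<^bsub>T\<^esub> c') \<in> ?N (m + n)"
        using x prod by (intro product_span.prod[of "i + i'" "j + j'"] mu_mult) auto
      ultimately show ?case by simp
    next
      case (add u v)
      then show ?case
        using x by (subst T.r_distr) (auto dest: mu_closed N_closed intro: product_span.add)
    qed
  next
    case (add u v)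
    then show ?case
      using N_closed[OF that(2)] by (subst T.l_distr) (auto dest: N_closed intro: product_span.add)
  qed
  have one: "\<one>\<^bsub>E\<^esub> \<in> mu 0"
    by (simp add: mu_0)
  have N_scale: "x \<otimes>\<^bsub>T\<^esub> c \<in> ?N n" if "x \<in> ?N n" "c \<in> carrier T" for x c n
  proof -
    have "c \<in> ?N 0"
      using product_span.prod[of 0 0 0 "\<one>\<^bsub>E\<^esub>" mu "\<one>\<^bsub>E\<^esub>" c T f g] that(2) one by simp
    then show ?thesis
      using N_mult[OF that(1)] by fastforce
  qed
  have fg: "f u \<oplus>\<^bsub>T\<^esub> g v \<in> ?N 1" if "u \<in> mu 1" "v \<in> mu 1" for u v
  proof (rule product_span.add)
    show "f u \<in> ?N 1"
      using product_span.prod[of 1 0 1 u mu "\<one>\<^bsub>E\<^esub>" "\<one>\<^bsub>T\<^esub>" T f g] that mu_closed[OF that(1)] one by simp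
    show "g v \<in> ?N 1"
      using product_span.prod[of 0 1 1 "\<one>\<^bsub>E\<^esub>" mu v "\<one>\<^bsub>T\<^esub>" T f g] that mu_closed[OF that(2)] one by simp
  qed
  \<comment> \<open>Modulo the span, \<open>h z\<close> depends on the counit of \<open>z\<close> only.\<close>
  have "\<exists>n \<in> ?N 1. h z = n \<oplus>\<^bsub>T\<^esub> h (t (pair_counit K B z))" if "z \<in> carrier E" for z
    using that
  proof (induction rule: env_induct)
    case (pure a b)
    obtain u v where uv: "u \<in> mu 1" "v \<in> mu 1" "h (s a) = f u \<oplus>\<^bsub>T\<^esub> g v \<oplus>\<^bsub>T\<^esub> h (t a)"
      using gen pure by blast
    have "h (ee a b) = (f u \<oplus>\<^bsub>T\<^esub> g v) \<otimes>\<^bsub>T\<^esub> h (t b) \<oplus>\<^bsub>T\<^esub> h (t (a \<otimes>\<^bsub>B\<^esub> b))"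
      using pure uv by (simp add: ee_src_tgt tgt_simps mu_closed T.l_distr)
    then show ?case
      using N_scale[OF fg[OF uv(1,2)], of "h (t b)"] pure by (auto simp: counit_ee)
  next
    case (add X Y)
    then obtain x y where xy: "x \<in> ?N 1" "y \<in> ?N 1" "h X = x \<oplus>\<^bsub>T\<^esub> h (t (pair_counit K B X))"
      "h Y = y \<oplus>\<^bsub>T\<^esub> h (t (pair_counit K B Y))"
      by blast
    then have "h (X \<oplus>\<^bsub>E\<^esub> Y) = (x \<oplus>\<^bsub>T\<^esub> y) \<oplus>\<^bsub>T\<^esub> h (t (pair_counit K B (X \<oplus>\<^bsub>E\<^esub> Y)))"
      using add(1,2) N_closed[OF xy(1)] N_closed[OF xy(2)]
      by (simp add: ring_hom_add[OF counit_hom] tgt_simps T.a_ac)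
    with xy(1,2) show ?case
      by (blast intro: product_span.add)
  qed
  note move = this
  have h1: "h z \<in> ?N 1" if z: "z \<in> mu 1" for z
  proof -
    have "z \<in> carrier E" "pair_counit K B z = \<zero>\<^bsub>B\<^esub>"
      using z unfolding mu_1 mu_ideal_iff by auto
    with move obtain n where n: "n \<in> ?N 1" "h z = n \<oplus>\<^bsub>T\<^esub> h (t \<zero>\<^bsub>B\<^esub>)"
      by metis
    then have "h z = n"
      using N_closed[OF n(1)] by (simp add: ring_hom_zero[OF tgt_hom BR.ring_axioms E.ring_axioms])
    with n(1) show ?thesis by simp
  qed
  have hn: "h z \<in> ?N n" if "z \<in> mu n" for z n
    using that
  proof (induction n arbitrary: z)
    case 0
    then show ?case
      using product_span.prod[of 0 0 0 "\<one>\<^bsub>E\<^esub>" mu "\<one>\<^bsub>E\<^esub>" "h z" T f g] mu_closed[OF 0] one by simp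
  next
    case (Suc n)
    from Suc.prems have "z \<in> carrier E \<and> h z \<in> ?N (Suc n)"
      unfolding mu_Suc
    proof induction
      case (prod i j)
      then show ?case
        using N_mult[OF Suc.IH h1] by (simp add: mu_closed)
    qed (auto intro: product_span.add)
    then show ?case ..
  qed
  have "x = \<zero>\<^bsub>T\<^esub>" if "x \<in> ?N (2 * k)" for x
    using that
  proof induction
    case (prod i j x y c)
    then have "k \<le> i \<or> k \<le> j" by linarith
    then have "f x = \<zero>\<^bsub>T\<^esub> \<or> g y = \<zero>\<^bsub>T\<^esub>"
      using prod mu_antimono f0 g0 by blast
    then show ?case
      using prod mu_closed[OF prod(2)] mu_closed[OF prod(3)] by auto
  qed simp
  with hn[OF z] show ?thesis by blast
qed

section \<open>The quotients by the powers\<close>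

lemma q_hom: "q i \<in> ring_hom E (Q i)"
  using ideal.rcos_ring_hom[OF ideal_mu] by (simp add: quot_def[abs_def])

lemma cring_Q: "cring (Q i)"
  by (rule ideal.quotient_is_cring[OF ideal_mu E.is_cring])

lemma q_closed [simp]: "x \<in> carrier E \<Longrightarrow> q i x \<in> carrier (Q i)"
  by (rule ring_hom_closed[OF q_hom])

lemma q_mult [simp]: "x \<in> carrier E \<Longrightarrow> y \<in> carrier E \<Longrightarrow> q i x \<otimes>\<^bsub>Q i\<^esub> q i y = q i (x \<otimes>\<^bsub>E\<^esub> y)"
  by (rule ring_hom_mult[OF q_hom, symmetric])

lemma q_add [simp]: "x \<in> carrier E \<Longrightarrow> y \<in> carrier E \<Longrightarrow> q i x \<oplus>\<^bsub>Q i\<^esub> q i y = q i (x \<oplus>\<^bsub>E\<^esub> y)"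
  by (rule ring_hom_add[OF q_hom, symmetric])

lemma q_one [simp]: "\<one>\<^bsub>Q i\<^esub> = q i \<one>\<^bsub>E\<^esub>"
  by (rule ring_hom_one[OF q_hom, symmetric])

lemma q_zero: "x \<in> mu i \<Longrightarrow> q i x = \<zero>\<^bsub>Q i\<^esub>"
  by (simp add: quot_def FactRing_def E.a_rcos_zero[OF ideal_mu])

lemma q_cases [consumes 1]:
  assumes "X \<in> carrier (Q i)"
  obtains x where "x \<in> carrier E" "X = q i x"
  using assms by (auto simp: FactRing_def A_RCOSETS_def' quot_def)

text \<open>A map that vanishes on \<open>\<mu>\<^sup>i\<close> may be evaluated on any representative of a class.\<close>

lemma descend:
  assumes f: "f \<in> add_hom E M" and "abelian_group M" and f0: "\<And>x. x \<in> mu i \<Longrightarrow> f x = \<zero>\<^bsub>M\<^esub>"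
    and x: "x \<in> carrier E"
  shows "f (SOME y. y \<in> q i x) = f x"
proof -
  interpret M: abelian_group M by fact
  have "x \<in> q i x"
    using abelian_subgroup.a_rcos_self[OF abelian_subgroupI3[OF ideal.axioms(1)[OF ideal_mu] E.abelian_group_axioms] x]
    by (simp add: quot_def)
  then have "(SOME y. y \<in> q i x) \<in> q i x"
    by (rule someI[where P = "\<lambda>y. y \<in> q i x"])
  then obtain m where "m \<in> mu i" "(SOME y. y \<in> q i x) = m \<oplus>\<^bsub>E\<^esub> x"
    by (auto simp: quot_def a_r_coset_def')
  then show ?thesis
    using add_hom_add[OF f, of m x] add_hom_closed[OF f x] x by (simp add: f0 mu_closed)
qed

text \<open>The transition map: a coset of \<open>\<mu>\<^sup>n\<close> is enlarged to the coset of \<open>\<mu>\<^sup>k\<close> that contains it.\<close>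

abbreviation "res k X \<equiv> mu k <+>\<^bsub>E\<^esub> X"

lemma res_q [simp]:
  assumes "k \<le> n" "x \<in> carrier E"
  shows "res k (q n x) = q k x"
proof
  interpret I: ideal "mu k" E by (rule ideal_mu)
  interpret I': ideal "mu n" E by (rule ideal_mu)
  show "res k (q n x) \<subseteq> q k x"
  proof
    fix y assume "y \<in> res k (q n x)"
    then obtain i j where ij: "i \<in> mu k" "j \<in> mu n" "y = i \<oplus>\<^bsub>E\<^esub> (j \<oplus>\<^bsub>E\<^esub> x)"
      by (auto simp: set_add_def' quot_def a_r_coset_def')
    then have "y = (i \<oplus>\<^bsub>E\<^esub> j) \<oplus>\<^bsub>E\<^esub> x" "i \<oplus>\<^bsub>E\<^esub> j \<in> mu k"
      using mu_antimono[OF assms(1)] assms(2) by (auto simp: E.a_assoc mu_closed)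
    then show "y \<in> q k x"
      by (auto simp: quot_def a_r_coset_def')
  qed
  show "q k x \<subseteq> res k (q n x)"
  proof
    fix y assume "y \<in> q k x"
    then obtain i where "i \<in> mu k" "y = i \<oplus>\<^bsub>E\<^esub> (\<zero>\<^bsub>E\<^esub> \<oplus>\<^bsub>E\<^esub> x)"
      using assms(2) by (auto simp: quot_def a_r_coset_def')
    then show "y \<in> res k (q n x)"
      using I'.zero_closed unfolding set_add_def' quot_def a_r_coset_def' by blast
  qed
qed

lemma res_hom:
  assumes "k \<le> n"
  shows "(\<lambda>X. res k X) \<in> ring_hom (Q n) (Q k)"
proof (rule ring_hom_memI)
  fix X Y assume "X \<in> carrier (Q n)" "Y \<in> carrier (Q n)"
  then obtain x y where "x \<in> carrier E" "X = q n x" "y \<in> carrier E" "Y = q n y"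
    by (meson q_cases)
  then show "res k X \<in> carrier (Q k)" "res k (X \<otimes>\<^bsub>Q n\<^esub> Y) = res k X \<otimes>\<^bsub>Q k\<^esub> res k Y"
    "res k (X \<oplus>\<^bsub>Q n\<^esub> Y) = res k X \<oplus>\<^bsub>Q k\<^esub> res k Y"
    using assms by simp_all
qed (use assms in simp)

lemma res_closed: "k \<le> n \<Longrightarrow> X \<in> carrier (Q n) \<Longrightarrow> res k X \<in> carrier (Q k)"
  by (rule ring_hom_closed[OF res_hom])

text \<open>The level \<open>i = 0\<close> has to be excluded, as \<open>\<mu>\<^sup>0\<close> is the whole enveloping algebra.\<close>

lemma counit_descend:
  assumes "1 \<le> i" "x \<in> carrier E"
  shows "pair_counit K B (SOME y. y \<in> q i x) = pair_counit K B x"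
proof (rule descend[OF _ BR.abelian_group_axioms _ assms(2)])
  show "pair_counit K B \<in> add_hom E B"
    using counit_hom by (auto simp: ring_hom_def add_hom_def)
  show "pair_counit K B x = \<zero>\<^bsub>B\<^esub>" if "x \<in> mu i" for x
    using that mu_antimono[OF assms(1)] unfolding mu_1 by (auto simp: mu_ideal_iff)
qed

end

section \<open>Pro-objects over the natural numbers\<close>

lemma nat_cat_simps [simp]:
  "Ob nat_cat = UNIV" "w \<in> Arr nat_cat \<longleftrightarrow> snd w \<le> fst w" "Dom nat_cat = fst" "Cod nat_cat = snd"
  "Ident nat_cat k = (k, k)" "Cmp nat_cat v u = (fst u, snd v)"
  by (auto simp: nat_cat_def)

lemma arrows_nat_cat [simp]: "w \<in> arrows nat_cat i j \<longleftrightarrow> w = (i, j) \<and> j \<le> i"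
  by (cases w) (auto simp: arrows_def)

lemma cofiltered_nat_cat: "cofiltered nat_cat"
proof -
  have "\<exists>k. arrows nat_cat k i \<noteq> {} \<and> arrows nat_cat k j \<noteq> {}" for i j
    by (rule exI[of _ "max i j"], auto simp flip: ex_in_conv)
  then show ?thesis
    unfolding cofiltered_def category_def by (auto simp: Bex_def)
qed

lemma pro_eq_natI:
  assumes "Idx F = nat_cat" "Idx G = nat_cat"
    and "\<And>k. \<exists>n. fst f k \<le> n \<and> fst g k \<le> n \<and>
      (\<forall>x \<in> carrier (Obj F n). snd f k (Map F (n, fst f k) x) = snd g k (Map F (n, fst g k) x))"
  shows "pro_eq F G f g"
  using assms unfolding pro_eq_def by (auto simp: Bex_def)

lemma pro_mor_natI:
  assumes "Idx F = nat_cat" "Idx G = nat_cat"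
    and "\<And>k. snd f k \<in> bimod_hom R S (Obj F (fst f k)) (Obj G k)"
    and "\<And>k k'. k \<le> k' \<Longrightarrow> \<exists>n. fst f k \<le> n \<and> fst f k' \<le> n \<and>
      (\<forall>x \<in> carrier (Obj F n). Map G (k', k) (snd f k' (Map F (n, fst f k') x)) = snd f k (Map F (n, fst f k) x))"
  shows "f \<in> pro_mor R S F G"
proof (cases f)
  case (Pair r p)
  then show ?thesis
    using assms unfolding pro_mor_def by (auto simp: Bex_def)
qed

text \<open>Tensor products of morphisms involve the choice of a common source of two indices. Nothing is known about
  the chosen index except that it bounds the two, so the identities at the levels below are proved for
  every upper bound.\<close>

definition common_index :: "nat \<Rightarrow> nat \<Rightarrow> nat" where
  "common_index i j = fst (fst (common_arrows nat_cat i j))"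

lemma common_arrows_nat:
  "common_arrows nat_cat i j = ((common_index i j, i), (common_index i j, j))"
  "i \<le> common_index i j" "j \<le> common_index i j"
proof -
  let ?P = "\<lambda>uv. fst uv \<in> Arr nat_cat \<and> snd uv \<in> Arr nat_cat \<and> Dom nat_cat (fst uv) = Dom nat_cat (snd uv) \<and>
    Cod nat_cat (fst uv) = i \<and> Cod nat_cat (snd uv) = j"
  have "?P ((max i j, i), (max i j, j))" by simp
  then have "?P (common_arrows nat_cat i j)"
    unfolding common_arrows_def by (rule someI)
  then show "common_arrows nat_cat i j = ((common_index i j, i), (common_index i j, j))"
    "i \<le> common_index i j" "j \<le> common_index i j"
    by (cases "common_arrows nat_cat i j", auto simp: common_index_def)+
qed

lemma pro_tensor_mor_nat:
  assumes "Idx F = nat_cat"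
  shows "fst (pro_tensor_mor S F F' G G' f f') k = common_index (fst f k) (fst f' k)"
    and "snd (pro_tensor_mor S F F' G G' f f') k = (let n = common_index (fst f k) (fst f' k) in
      tensor_map S (Obj G k) (Obj G' k) (\<lambda>x. snd f k (Map F (n, fst f k) x)) (\<lambda>x. snd f' k (Map F' (n, fst f' k) x)))"
  by (simp_all add: pro_tensor_mor_def Let_def assms common_arrows_nat(1))

lemma pro_simps [simp]:
  "fst (pro_comp g f) k = fst f (fst g k)"
  "snd (pro_comp g f) k x = snd g k (snd f (fst g k) x)"
  "fst (pro_level p) k = k" "snd (pro_level p) = p"
  "Idx (const_pro I M) = I" "Obj (const_pro I M) i = M" "Map (const_pro I M) u x = x"
  "Idx (pro_restr f1 f2 F) = Idx F" "Obj (pro_restr f1 f2 F) i = restr f1 f2 (Obj F i)" "Map (pro_restr f1 f2 F) = Map F"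
  "Idx (pro_left_view K B L) = Idx L" "Obj (pro_left_view K B L) i = left_view K B (Obj L i)"
  "Map (pro_left_view K B L) = Map L"
  "Idx (pro_tensor S F1 F2) = Idx F1" "Obj (pro_tensor S F1 F2) i = tensor_bimod S (Obj F1 i) (Obj F2 i)"
  "Idx (pro_dia K B L L') = Idx L" "Obj (pro_dia K B L L') i = dia K B (Obj L i) (Obj L' i)"
  "Map (pro_dia K B L L') = Map (pro_tensor B (pro_left_view K B L) (pro_left_view K B L'))"
  "Idx (pro_takeuchi K B L L') = Idx L" "Obj (pro_takeuchi K B L L') i = takeuchi K B (Obj L i) (Obj L' i)"
  "Map (pro_takeuchi K B L L') = Map (pro_dia K B L L')"
  by (simp_all add: pro_comp_def pro_level_def const_pro_def pro_restr_def pro_left_view_def pro_tensor_def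
      pro_dia_def pro_takeuchi_def)

lemma pro_tensor_Map_nat [simp]:
  "Idx F = nat_cat \<Longrightarrow> Map (pro_tensor S F G) (n, k) = tensor_map S (Obj F k) (Obj G k) (Map F (n, k)) (Map G (n, k))"
  by (simp add: pro_tensor_def)

section \<open>Bimodule structures on the quotients and their tensor products\<close>

lemma left_view_simps [simp]:
  "carrier (left_view K B M) = carrier M" "add (left_view K B M) = add M" "zero (left_view K B M) = zero M"
  "one (left_view K B M) = one M" "mult (left_view K B M) = mult M"
  "a \<odot>\<^bsub>left_view K B M\<^esub> x = src K B a \<odot>\<^bsub>M\<^esub> x" "rsmult (left_view K B M) x b = tgt K B b \<odot>\<^bsub>M\<^esub> x"
  by (simp_all add: left_view_def)

lemma restr_simps [simp]:
  "carrier (restr f g M) = carrier M" "add (restr f g M) = add M" "zero (restr f g M) = zero M"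
  "one (restr f g M) = one M" "mult (restr f g M) = mult M"
  "a \<odot>\<^bsub>restr f g M\<^esub> x = f a \<odot>\<^bsub>M\<^esub> x" "rsmult (restr f g M) x b = rsmult M x (g b)"
  by (simp_all add: restr_def)

lemma ring_bimod_simps [simp]:
  "carrier (ring_bimod h A) = carrier A" "add (ring_bimod h A) = add A" "zero (ring_bimod h A) = zero A"
  "one (ring_bimod h A) = one A" "mult (ring_bimod h A) = mult A"
  "a \<odot>\<^bsub>ring_bimod h A\<^esub> x = h a \<otimes>\<^bsub>A\<^esub> x" "rsmult (ring_bimod h A) x b = x \<otimes>\<^bsub>A\<^esub> h b"
  by (simp_all add: ring_bimod_def)

lemma restr_biact:
  assumes "biact R S M" "\<And>r. r \<in> carrier R' \<Longrightarrow> f r \<in> carrier R" "\<And>s. s \<in> carrier S' \<Longrightarrow> g s \<in> carrier S"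
  shows "biact R' S' (restr f g M)"
proof -
  have "abelian_group (restr f g M)"
    by (rule abelian_group_cong[of M]) (use assms(1) in \<open>simp_all add: biact_def left_act_def\<close>)
  then show ?thesis
    using assms by (simp add: biact_def left_act_def right_act_def add_hom_def)
qed

lemma restr_bimod_hom:
  assumes "f \<in> bimod_hom R S M N" "\<And>r. r \<in> carrier R' \<Longrightarrow> u r \<in> carrier R" "\<And>s. s \<in> carrier S' \<Longrightarrow> v s \<in> carrier S"
  shows "f \<in> bimod_hom R' S' (restr u v M) (restr u v N)"
  using assms by (simp add: bimod_hom_def)

lemma ring_bimod_biact:
  assumes "cring A" and h: "h \<in> ring_hom R A"
  shows "biact R R (ring_bimod h A)"
proof -
  interpret A: cring A by fact
  have "abelian_group (ring_bimod h A)"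
    by (rule abelian_group_cong[OF A.abelian_group_axioms]) simp_all
  then show ?thesis
    by (simp add: biact_def left_act_def right_act_def add_hom_def ring_hom_closed[OF h] A.l_distr A.r_distr A.m_assoc)
qed

lemma ring_bimod_bimodule:
  assumes "k_algebra K R" "cring A" and h: "h \<in> ring_hom R A"
  shows "bimodule K R R (ring_bimod h A)"
proof -
  interpret A: cring A by fact
  interpret R: ring R using assms(1) by (simp add: k_algebra_def)
  have "abelian_group (ring_bimod h A)"
    by (rule abelian_group_cong[OF A.abelian_group_axioms]) simp_all
  moreover have "k \<odot>\<^bsub>R\<^esub> \<one>\<^bsub>R\<^esub> \<in> carrier R" if "k \<in> carrier K" for k
    using assms(1) module.smult_closed[of K R k "\<one>\<^bsub>R\<^esub>"] that by (simp add: k_algebra_def)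
  ultimately show ?thesis
    using assms(1)
    by (simp add: bimodule_def ring_hom_closed[OF h] ring_hom_add[OF h] ring_hom_mult[OF h] ring_hom_one[OF h]
        A.l_distr A.r_distr A.m_ac)
qed

context pair_algebra
begin

abbreviation "V k \<equiv> left_view K B (J k)"
abbreviation "Bo \<equiv> op_alg B"

lemma JJ_simps [simp]:
  "Idx (JJ K B) = nat_cat" "Obj (JJ K B) k = J k" "Map (JJ K B) (n, k) = (\<lambda>X. res k X)"
  by (simp_all add: JJ_def)

lemma left_view_biact:
  assumes "left_act E M"
    and "\<And>e e' x. e \<in> carrier E \<Longrightarrow> e' \<in> carrier E \<Longrightarrow> x \<in> carrier M \<Longrightarrow> e \<odot>\<^bsub>M\<^esub> (e' \<odot>\<^bsub>M\<^esub> x) = e' \<odot>\<^bsub>M\<^esub> (e \<odot>\<^bsub>M\<^esub> x)"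
  shows "biact B B (left_view K B M)"
proof -
  have "abelian_group (left_view K B M)"
    by (rule abelian_group_cong[OF left_actD(1)[OF assms(1)]]) simp_all
  then show ?thesis
    using assms by (simp add: biact_def left_act_def right_act_def add_hom_def)
qed

lemma J_biact: "biact E E (J k)"
  by (rule ring_bimod_biact[OF cring_Q q_hom])

lemma J_bimodule: "bimodule K E E (J k)"
  by (rule ring_bimod_bimodule[OF k_algebra_E cring_Q q_hom])

lemma ring_bimod_left_comm:
  assumes "cring A" "h \<in> ring_hom E A" "e \<in> carrier E" "e' \<in> carrier E" "x \<in> carrier A"
  shows "h e \<otimes>\<^bsub>A\<^esub> (h e' \<otimes>\<^bsub>A\<^esub> x) = h e' \<otimes>\<^bsub>A\<^esub> (h e \<otimes>\<^bsub>A\<^esub> x)"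
proof -
  interpret cring A by fact
  show ?thesis using assms by (simp add: ring_hom_closed[OF assms(2)] m_lcomm)
qed

lemma V_biact: "biact B B (V k)"
  by (rule left_view_biact[OF biactD(1)[OF J_biact]]) (simp add: ring_bimod_left_comm[OF cring_Q q_hom])

lemma V_bimodule: "bimodule K B B (V k)"
proof -
  interpret A: cring "Q k" by (rule cring_Q)
  have "abelian_group (V k)"
    using biactD(1)[OF V_biact] by (rule left_actD(1))
  then show ?thesis
    by (simp add: bimodule_def k_algebra_B ring_hom_closed[OF q_hom] src_simps tgt_simps A.l_distr A.r_distr A.m_ac
        del: q_one q_add q_mult add: ring_hom_add[OF q_hom] ring_hom_mult[OF q_hom] ring_hom_one[OF q_hom] flip: scal_eq)
qed

lemma res_bimod_hom: "k \<le> n \<Longrightarrow> (\<lambda>X. res k X) \<in> bimod_hom E E (J n) (J k)"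
  by (simp add: bimod_hom_def ring_hom_closed[OF res_hom] ring_hom_add[OF res_hom] ring_hom_mult[OF res_hom])

end

text \<open>The tensor products that occur are all formed from quotients of the enveloping algebra, with the
  actions of \<open>S\<close> given by two maps \<open>g\<close>, \<open>h\<close> from \<open>S\<close> to the enveloping algebra.\<close>

locale quotient_tensor = pair_algebra K B
  for K :: "('k, 'x) ring_scheme" and B :: "('k, 'b, 'y) module_scheme" +
  fixes S :: "('s, 'z) ring_scheme" and g h :: "'s \<Rightarrow> ('b, 'b) tens"
    and L :: "nat \<Rightarrow> ('l, ('b, 'b) tens set, 's) bimod" and R :: "nat \<Rightarrow> ('s, ('b, 'b) tens set, 'r) bimod"
  assumes g: "r \<in> carrier S \<Longrightarrow> g r \<in> carrier E" and h: "r \<in> carrier S \<Longrightarrow> h r \<in> carrier E"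
    and L: "carrier (L k) = carrier (Q k)" "add (L k) = add (Q k)" "zero (L k) = zero (Q k)"
      "mult (L k) = mult (Q k)" "one (L k) = one (Q k)"
    and R: "carrier (R k) = carrier (Q k)" "add (R k) = add (Q k)" "zero (R k) = zero (Q k)"
      "mult (R k) = mult (Q k)" "one (R k) = one (Q k)"
    and L_act: "x \<in> carrier E \<Longrightarrow> r \<in> carrier S \<Longrightarrow> rsmult (L k) (q k x) r = q k (g r \<otimes>\<^bsub>E\<^esub> x)"
    and R_act: "x \<in> carrier E \<Longrightarrow> r \<in> carrier S \<Longrightarrow> r \<odot>\<^bsub>R k\<^esub> q k x = q k (h r \<otimes>\<^bsub>E\<^esub> x)"
begin

abbreviation "TT k \<equiv> tensor_ring S (L k) (R k)"
abbreviation "TG k \<equiv> tensor_group S (L k) (R k)"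
abbreviation "tens k x y \<equiv> tensor S (L k) (R k) (q k x) (q k y)"

lemma cring_L: "cring (L k)" by (rule cring_cong[OF cring_Q]) (simp_all add: L)
lemma cring_R: "cring (R k)" by (rule cring_cong[OF cring_Q]) (simp_all add: R)

lemma L_right_act: "right_act S (L k)"
  unfolding right_act_def
proof (intro conjI ballI add_homI)
  interpret cring "L k" by (rule cring_L)
  show "abelian_group (L k)" by (rule abelian_group_axioms)
  show "rsmult (L k) X r \<in> carrier (L k)" if "r \<in> carrier S" "X \<in> carrier (L k)" for X r
    using that g by (auto simp: L L_act elim!: q_cases)
  show "rsmult (L k) (X \<oplus>\<^bsub>L k\<^esub> Y) r = rsmult (L k) X r \<oplus>\<^bsub>L k\<^esub> rsmult (L k) Y r"
    if "r \<in> carrier S" "X \<in> carrier (L k)" "Y \<in> carrier (L k)" for X Y r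
    using that g by (auto simp: L L_act E.r_distr elim!: q_cases)
qed

lemma R_left_act: "left_act S (R k)"
  unfolding left_act_def
proof (intro conjI ballI add_homI)
  interpret cring "R k" by (rule cring_R)
  show "abelian_group (R k)" by (rule abelian_group_axioms)
  show "r \<odot>\<^bsub>R k\<^esub> X \<in> carrier (R k)" if "r \<in> carrier S" "X \<in> carrier (R k)" for X r
    using that h by (auto simp: R R_act elim!: q_cases)
  show "r \<odot>\<^bsub>R k\<^esub> (X \<oplus>\<^bsub>R k\<^esub> Y) = r \<odot>\<^bsub>R k\<^esub> X \<oplus>\<^bsub>R k\<^esub> r \<odot>\<^bsub>R k\<^esub> Y"
    if "r \<in> carrier S" "X \<in> carrier (R k)" "Y \<in> carrier (R k)" for X Y r
    using that h by (auto simp: R R_act E.r_distr elim!: q_cases)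
qed

lemma tensor_algebras_TT: "tensor_algebras S (L k) (R k)"
proof (intro tensor_algebras.intro tensorable.intro tensor_algebras_axioms.intro L_right_act R_left_act cring_L cring_R)
  show "rsmult (L k) (X \<otimes>\<^bsub>L k\<^esub> Y) r = rsmult (L k) X r \<otimes>\<^bsub>L k\<^esub> Y"
    if "X \<in> carrier (L k)" "Y \<in> carrier (L k)" "r \<in> carrier S" for X Y r
    using that g by (auto simp: L L_act E.m_assoc elim!: q_cases)
  show "r \<odot>\<^bsub>R k\<^esub> (X \<otimes>\<^bsub>R k\<^esub> Y) = (r \<odot>\<^bsub>R k\<^esub> X) \<otimes>\<^bsub>R k\<^esub> Y"
    if "X \<in> carrier (R k)" "Y \<in> carrier (R k)" "r \<in> carrier S" for X Y r
    using that h by (auto simp: R R_act E.m_assoc elim!: q_cases)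
qed

lemma tensor_cring_TT: "tensor_cring S (L k) (R k) (TT k)"
  by (rule tensor_algebras.tensor_cring_tensor_ring[OF tensor_algebras_TT])

lemma tensorable_TT: "tensorable S (L k) (R k)"
  by (rule tensorable.intro[OF L_right_act R_left_act])

lemma cring_TT: "cring (TT k)"
  by (rule tensor_cring.cring_R[OF tensor_cring_TT])

lemma abelian_TT: "abelian_group (TG k)"
  by (rule tensorable.abelian_G[OF tensorable_TT])

lemma tens_closed [simp]: "x \<in> carrier E \<Longrightarrow> y \<in> carrier E \<Longrightarrow> tens k x y \<in> carrier (TG k)"
  by (rule tensorable.tensor_closed[OF tensorable_TT]) (simp_all add: L R)

lemma tens_add_left: "x \<in> carrier E \<Longrightarrow> x' \<in> carrier E \<Longrightarrow> y \<in> carrier E \<Longrightarrow>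
    tens k (x \<oplus>\<^bsub>E\<^esub> x') y = tens k x y \<oplus>\<^bsub>TG k\<^esub> tens k x' y"
  using tensorable.tensor_add_left[OF tensorable_TT, of "q k x" k "q k x'" "q k y"] by (simp add: L R)

lemma tens_add_right: "x \<in> carrier E \<Longrightarrow> y \<in> carrier E \<Longrightarrow> y' \<in> carrier E \<Longrightarrow>
    tens k x (y \<oplus>\<^bsub>E\<^esub> y') = tens k x y \<oplus>\<^bsub>TG k\<^esub> tens k x y'"
  using tensorable.tensor_add_right[OF tensorable_TT, of "q k x" k "q k y" "q k y'"] by (simp add: L R)

text \<open>The defining relation of the tensor product, from which all computations with pure tensors proceed.\<close>

lemma tens_balanced: "x \<in> carrier E \<Longrightarrow> y \<in> carrier E \<Longrightarrow> r \<in> carrier S \<Longrightarrow>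
    tens k (g r \<otimes>\<^bsub>E\<^esub> x) y = tens k x (h r \<otimes>\<^bsub>E\<^esub> y)"
  using tensorable.tensor_smult[OF tensorable_TT, of "q k x" k r "q k y"] by (simp add: L R L_act R_act)

lemma tens_mult: "x \<in> carrier E \<Longrightarrow> y \<in> carrier E \<Longrightarrow> x' \<in> carrier E \<Longrightarrow> y' \<in> carrier E \<Longrightarrow>
    tens k x y \<otimes>\<^bsub>TT k\<^esub> tens k x' y' = tens k (x \<otimes>\<^bsub>E\<^esub> x') (y \<otimes>\<^bsub>E\<^esub> y')"
  using tensor_cring.mult_pure[OF tensor_cring_TT, of "q k x" k "q k y" "q k x'" "q k y'"] by (simp add: L R)

lemma tens_one: "\<one>\<^bsub>TT k\<^esub> = tens k \<one>\<^bsub>E\<^esub> \<one>\<^bsub>E\<^esub>"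
  by (simp add: L R)

lemma tens_left_hom: "(\<lambda>x. tens k x \<one>\<^bsub>E\<^esub>) \<in> ring_hom E (TT k)"
  by (rule ring_hom_memI) (simp_all add: tens_mult tens_one tens_add_left L R)

lemma tens_right_hom: "(\<lambda>y. tens k \<one>\<^bsub>E\<^esub> y) \<in> ring_hom E (TT k)"
  by (rule ring_hom_memI) (simp_all add: tens_mult tens_one tens_add_right L R)

lemma tens_left_vanish: "x \<in> mu k \<Longrightarrow> tens k x \<one>\<^bsub>E\<^esub> = \<zero>\<^bsub>TT k\<^esub>"
  using ring_hom_zero[OF tens_left_hom E.ring_axioms cring.axioms(1)[OF cring_TT]]
    q_zero[of x k] q_zero[of "\<zero>\<^bsub>E\<^esub>" k] additive_subgroup.zero_closed[OF ideal.axioms(1)[OF ideal_mu]]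
  by metis

lemma tens_right_vanish: "y \<in> mu k \<Longrightarrow> tens k \<one>\<^bsub>E\<^esub> y = \<zero>\<^bsub>TT k\<^esub>"
  using ring_hom_zero[OF tens_right_hom E.ring_axioms cring.axioms(1)[OF cring_TT]]
    q_zero[of y k] q_zero[of "\<zero>\<^bsub>E\<^esub>" k] additive_subgroup.zero_closed[OF ideal.axioms(1)[OF ideal_mu]]
  by metis

lemma TT_induct [consumes 1, case_names pure add]:
  assumes "X \<in> carrier (TG k)"
    and "\<And>x y. x \<in> carrier E \<Longrightarrow> y \<in> carrier E \<Longrightarrow> Pr (tens k x y)"
    and "\<And>X Y. X \<in> carrier (TG k) \<Longrightarrow> Y \<in> carrier (TG k) \<Longrightarrow>
      Pr X \<Longrightarrow> Pr Y \<Longrightarrow> Pr (X \<oplus>\<^bsub>TG k\<^esub> Y)"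
  shows "Pr X"
  using assms(1)
proof (induction rule: tensorable.tensor_induct[OF tensorable_TT, consumes 1, case_names pure add])
  case (pure p p')
  then show ?case
    using assms(2) by (auto simp: L R elim!: q_cases)
qed (rule assms(3))

lemma TT_eqI:
  assumes f: "f \<in> add_hom (TG k) M" and f': "f' \<in> add_hom (TG k) M"
    and pure: "\<And>x y. x \<in> carrier E \<Longrightarrow> y \<in> carrier E \<Longrightarrow> f (tens k x y) = f' (tens k x y)"
    and X: "X \<in> carrier (TG k)"
  shows "f X = f' X"
  using X by (induction rule: TT_induct) (simp_all add: pure add_hom_add[OF f] add_hom_add[OF f'])

text \<open>On the left, or on the right, it suffices to consider the classes of pure tensors.\<close>

lemma TT_eqI_left:
  assumes f: "f \<in> add_hom (TG k) M" and f': "f' \<in> add_hom (TG k) M"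
    and pure: "\<And>a b y. a \<in> carrier B \<Longrightarrow> b \<in> carrier B \<Longrightarrow> y \<in> carrier E \<Longrightarrow> f (tens k (ee a b) y) = f' (tens k (ee a b) y)"
    and X: "X \<in> carrier (TG k)"
  shows "f X = f' X"
proof (rule TT_eqI[OF f f' _ X])
  fix x y assume x: "x \<in> carrier E" and y: "y \<in> carrier E"
  from x show "f (tens k x y) = f' (tens k x y)"
    by (induction rule: env_induct)
      (use y in \<open>simp_all add: pure tens_add_left add_hom_add[OF f] add_hom_add[OF f']\<close>)
qed

lemma TT_eqI_right:
  assumes f: "f \<in> add_hom (TG k) M" and f': "f' \<in> add_hom (TG k) M"
    and pure: "\<And>a b y. a \<in> carrier B \<Longrightarrow> b \<in> carrier B \<Longrightarrow> y \<in> carrier E \<Longrightarrow> f (tens k y (ee a b)) = f' (tens k y (ee a b))"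
    and X: "X \<in> carrier (TG k)"
  shows "f X = f' X"
proof (rule TT_eqI[OF f f' _ X])
  fix x y assume x: "x \<in> carrier E" and y: "y \<in> carrier E"
  from y show "f (tens k x y) = f' (tens k x y)"
    by (induction rule: env_induct)
      (use x in \<open>simp_all add: pure tens_add_right add_hom_add[OF f] add_hom_add[OF f']\<close>)
qed

lemma res_right_lin: "k \<le> n \<Longrightarrow> (\<lambda>X. res k X) \<in> right_lin S (L n) (L k)"
  by (rule right_linI, rule add_homI) (use g in \<open>auto simp: L L_act res_closed elim!: q_cases\<close>)

lemma res_left_lin: "k \<le> n \<Longrightarrow> (\<lambda>X. res k X) \<in> left_lin S (R n) (R k)"
  by (rule left_linI, rule add_homI) (use h in \<open>auto simp: R R_act res_closed elim!: q_cases\<close>)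

abbreviation "transit k \<equiv> tensor_map S (L k) (R k) (\<lambda>X. res k X) (\<lambda>X. res k X)"

lemma transit_add_hom: "k \<le> n \<Longrightarrow> transit k \<in> add_hom (TG n) (TG k)"
  by (intro tensor_map_add_hom L_right_act R_left_act res_right_lin res_left_lin)

lemma transit_tens:
  assumes "k \<le> n" "x \<in> carrier E" "y \<in> carrier E"
  shows "transit k (tens n x y) = tens k x y"
  by (subst tensor_map_tensor[OF L_right_act R_left_act L_right_act R_left_act res_right_lin res_left_lin])
    (use assms in \<open>auto simp: L R\<close>)

text \<open>Moving \<open>r\<close> across the tensor sign does not change the product if it acts on both sides as multiplication by
  the same element.\<close>

lemma mult_balanced:
  assumes "\<And>r. r \<in> carrier S \<Longrightarrow> g r = h r"
  shows "balanced S (L k) (R k) (Q k) (\<lambda>x y. x \<otimes>\<^bsub>Q k\<^esub> y)"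
proof (rule balancedI)
  interpret Q: cring "Q k" by (rule cring_Q)
  show "X \<otimes>\<^bsub>Q k\<^esub> Y \<in> carrier (Q k)" if "X \<in> carrier (L k)" "Y \<in> carrier (R k)" for X Y
    using that by (simp add: L R)
  show "(X \<oplus>\<^bsub>L k\<^esub> X') \<otimes>\<^bsub>Q k\<^esub> Y = X \<otimes>\<^bsub>Q k\<^esub> Y \<oplus>\<^bsub>Q k\<^esub> X' \<otimes>\<^bsub>Q k\<^esub> Y"
    if "X \<in> carrier (L k)" "X' \<in> carrier (L k)" "Y \<in> carrier (R k)" for X X' Y
    using that by (simp add: L R Q.l_distr)
  show "X \<otimes>\<^bsub>Q k\<^esub> (Y \<oplus>\<^bsub>R k\<^esub> Y') = X \<otimes>\<^bsub>Q k\<^esub> Y \<oplus>\<^bsub>Q k\<^esub> X \<otimes>\<^bsub>Q k\<^esub> Y'"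
    if "X \<in> carrier (L k)" "Y \<in> carrier (R k)" "Y' \<in> carrier (R k)" for X Y Y'
    using that by (simp add: L R Q.r_distr)
  show "rsmult (L k) X r \<otimes>\<^bsub>Q k\<^esub> Y = X \<otimes>\<^bsub>Q k\<^esub> (r \<odot>\<^bsub>R k\<^esub> Y)"
    if "X \<in> carrier (L k)" "r \<in> carrier S" "Y \<in> carrier (R k)" for X r Y
    using that h[of r] by (auto simp: L R L_act R_act assms E.m_ac elim!: q_cases)
qed

end

context pair_algebra
begin

text \<open>\<open>D\<close> is \<open>J \<diamond> J\<close>, \<open>EE\<close> is the domain of the product, and the counit laws are stated on \<open>KK\<close>, the tensor
  product over the field.\<close>

sublocale D: quotient_tensor K B B t s V V
  by unfold_locales simp_all

sublocale EE: quotient_tensor K B E "\<lambda>e. e" "\<lambda>e. e" J J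
  by unfold_locales (simp_all add: E.m_comm)

sublocale KK: quotient_tensor K B K "scal K B" "scal K B" "\<lambda>k. restr (\<lambda>x. x) (scal K B) (J k)" "\<lambda>k. restr (scal K B) (\<lambda>x. x) (J k)"
  by unfold_locales (simp_all add: E.m_comm)

end

section \<open>The coproduct, the counit and the Takeuchi product\<close>

context pair_algebra
begin

lemma tgt_src_mu: "a \<in> carrier B \<Longrightarrow> t a \<ominus>\<^bsub>E\<^esub> s a \<in> mu 1"
proof -
  assume a: "a \<in> carrier B"
  have "\<ominus>\<^bsub>E\<^esub> (s a \<ominus>\<^bsub>E\<^esub> t a) \<in> mu 1"
    by (rule additive_subgroup.a_inv_closed[OF ideal.axioms(1)[OF ideal_mu] src_tgt_mu[OF a]])
  then show ?thesis
    using a by (simp add: E.minus_eq E.minus_add E.a_comm)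
qed

lemma diff_add: "x \<in> carrier E \<Longrightarrow> y \<in> carrier E \<Longrightarrow> x \<ominus>\<^bsub>E\<^esub> y \<oplus>\<^bsub>E\<^esub> y = x"
  by (simp add: E.minus_eq E.a_assoc E.l_neg)

lemma q_add_homI:
  assumes "G \<in> add_hom E M" "\<And>x. x \<in> carrier E \<Longrightarrow> F (q n x) = G x"
  shows "F \<in> add_hom (Q n) M"
  by (rule add_homI) (use assms(2) add_hom_closed[OF assms(1)] add_hom_add[OF assms(1)] in \<open>auto elim!: q_cases\<close>)

lemma ring_hom_add_hom: "f \<in> ring_hom M N \<Longrightarrow> f \<in> add_hom M N"
  by (auto simp: ring_hom_def add_hom_def)

lemma scal_unit: "c \<in> carrier K \<Longrightarrow> s (c \<odot>\<^bsub>B\<^esub> \<one>\<^bsub>B\<^esub>) = t (c \<odot>\<^bsub>B\<^esub> \<one>\<^bsub>B\<^esub>)"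
  using scal_eq by simp

text \<open>The coproduct of the pair Hopf algebroid followed by the projection to \<open>J(k) \<diamond> J(k)\<close>, as a ring
  homomorphism.\<close>

definition psiD :: "nat \<Rightarrow> _" where
  "psiD k = env_lift (D.TT k) (\<lambda>a. D.tens k (s a) \<one>\<^bsub>E\<^esub>) (\<lambda>b. D.tens k \<one>\<^bsub>E\<^esub> (t b))"

lemma psiD:
  shows psiD_hom: "psiD k \<in> ring_hom E (D.TT k)"
    and psiD_ee: "a \<in> carrier B \<Longrightarrow> b \<in> carrier B \<Longrightarrow> psiD k (ee a b) = D.tens k (s a) (t b)"
    and psiD_src: "a \<in> carrier B \<Longrightarrow> psiD k (s a) = D.tens k (s a) \<one>\<^bsub>E\<^esub>"
    and psiD_tgt: "a \<in> carrier B \<Longrightarrow> psiD k (t a) = D.tens k \<one>\<^bsub>E\<^esub> (t a)"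
proof -
  have bal: "D.tens k (s (c \<odot>\<^bsub>B\<^esub> \<one>\<^bsub>B\<^esub>)) \<one>\<^bsub>E\<^esub> = D.tens k \<one>\<^bsub>E\<^esub> (t (c \<odot>\<^bsub>B\<^esub> \<one>\<^bsub>B\<^esub>))" if "c \<in> carrier K" for c
    using D.tens_balanced[of "\<one>\<^bsub>E\<^esub>" "\<one>\<^bsub>E\<^esub>" "c \<odot>\<^bsub>B\<^esub> \<one>\<^bsub>B\<^esub>" k] that by (simp add: scal_unit)
  note * = env_lift[OF D.cring_TT ring_hom_trans[OF src_hom D.tens_left_hom, unfolded comp_def]
      ring_hom_trans[OF tgt_hom D.tens_right_hom, unfolded comp_def] bal, folded psiD_def]
  show "psiD k \<in> ring_hom E (D.TT k)" by (rule *(1))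
  show "a \<in> carrier B \<Longrightarrow> b \<in> carrier B \<Longrightarrow> psiD k (ee a b) = D.tens k (s a) (t b)"
    by (simp add: *(2) D.tens_mult)
  show "a \<in> carrier B \<Longrightarrow> psiD k (s a) = D.tens k (s a) \<one>\<^bsub>E\<^esub>" "a \<in> carrier B \<Longrightarrow> psiD k (t a) = D.tens k \<one>\<^bsub>E\<^esub> (t a)"
    by (simp_all add: *(3,4))
qed

text \<open>From \<open>s(a) \<diamond> 1\<close> to \<open>1 \<diamond> t(a)\<close> the way leads through \<open>t(a) \<diamond> 1 = 1 \<diamond> s(a)\<close>; the two steps contribute an
  element of \<open>\<mu>\<close> on the left and one on the right.\<close>

lemma psiD_vanish:
  assumes "z \<in> mu (2 * k)"
  shows "psiD k z = \<zero>\<^bsub>D.TT k\<^esub>"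
proof (rule vanish_mu_double[OF D.cring_TT D.tens_left_hom D.tens_right_hom psiD_hom D.tens_left_vanish D.tens_right_vanish _ assms])
  interpret T: cring "D.TT k" by (rule D.cring_TT)
  fix a assume a: "a \<in> carrier B"
  have "D.tens k (s a) \<one>\<^bsub>E\<^esub> = D.tens k (s a \<ominus>\<^bsub>E\<^esub> t a) \<one>\<^bsub>E\<^esub> \<oplus>\<^bsub>D.TT k\<^esub> D.tens k (t a) \<one>\<^bsub>E\<^esub>"
    using a D.tens_add_left[of "s a \<ominus>\<^bsub>E\<^esub> t a" "t a" "\<one>\<^bsub>E\<^esub>" k] by (simp add: diff_add)
  also have "D.tens k (t a) \<one>\<^bsub>E\<^esub> = D.tens k \<one>\<^bsub>E\<^esub> (s a)"
    using D.tens_balanced[of "\<one>\<^bsub>E\<^esub>" "\<one>\<^bsub>E\<^esub>" a k] a by simp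
  also have "\<dots> = D.tens k \<one>\<^bsub>E\<^esub> (s a \<ominus>\<^bsub>E\<^esub> t a) \<oplus>\<^bsub>D.TT k\<^esub> D.tens k \<one>\<^bsub>E\<^esub> (t a)"
    using a D.tens_add_right[of "\<one>\<^bsub>E\<^esub>" "s a \<ominus>\<^bsub>E\<^esub> t a" "t a" k] by (simp add: diff_add)
  finally have "psiD k (s a) = D.tens k (s a \<ominus>\<^bsub>E\<^esub> t a) \<one>\<^bsub>E\<^esub> \<oplus>\<^bsub>D.TT k\<^esub> D.tens k \<one>\<^bsub>E\<^esub> (s a \<ominus>\<^bsub>E\<^esub> t a) \<oplus>\<^bsub>D.TT k\<^esub> psiD k (t a)"
    using a T.a_assoc by (simp add: psiD_src psiD_tgt)
  then show "\<exists>u\<in>mu 1. \<exists>v\<in>mu 1. psiD k (s a) = D.tens k u \<one>\<^bsub>E\<^esub> \<oplus>\<^bsub>D.TT k\<^esub> D.tens k \<one>\<^bsub>E\<^esub> v \<oplus>\<^bsub>D.TT k\<^esub> psiD k (t a)"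
    using src_tgt_mu[OF a] by blast
qed

lemma psiD_closed [simp]: "x \<in> carrier E \<Longrightarrow> psiD k x \<in> carrier (D.TG k)"
  using ring_hom_closed[OF psiD_hom, of x k] by simp

abbreviation "VE \<equiv> left_view K B (regular E)"

lemma VE_biact: "biact B B VE"
  by (rule left_view_biact[OF biactD(1)[OF ring_bimod_biact[OF E.is_cring]]])
    (simp_all add: E.m_lcomm ring_hom_def)

lemma pair_coproduct:
  shows pair_coproduct_add_hom: "pair_coproduct K B \<in> add_hom E (tensor_group B VE VE)"
    and pair_coproduct_ee: "a \<in> carrier B \<Longrightarrow> b \<in> carrier B \<Longrightarrow> pair_coproduct K B (ee a b) = tensor B VE VE (s a) (t b)"
proof -
  interpret VV: tensorable B VE VE
    by (rule tensorable.intro[OF biactD(2)[OF VE_biact] biactD(1)[OF VE_biact]])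
  have "balanced K VB VO (tensor_group B VE VE) (\<lambda>a b. tensor B VE VE (s a) (t b))"
  proof (rule balancedI)
    fix a c b assume *: "a \<in> carrier VB" "c \<in> carrier K" "b \<in> carrier VO"
    then have "s (c \<odot>\<^bsub>B\<^esub> a) = t (c \<odot>\<^bsub>B\<^esub> \<one>\<^bsub>B\<^esub>) \<otimes>\<^bsub>E\<^esub> s a" "t (c \<odot>\<^bsub>B\<^esub> b) = s (c \<odot>\<^bsub>B\<^esub> \<one>\<^bsub>B\<^esub>) \<otimes>\<^bsub>E\<^esub> t b"
      by (simp_all add: smult_one_mult[of c a] smult_one_mult[of c b] src_simps tgt_simps scal_unit)
    with * show "tensor B VE VE (s (rsmult VB a c)) (t b) = tensor B VE VE (s a) (t (c \<odot>\<^bsub>VO\<^esub> b))"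
      using VV.tensor_smult[of "s a" "c \<odot>\<^bsub>B\<^esub> \<one>\<^bsub>B\<^esub>" "t b"] by simp
  qed (use VV.tensor_closed VV.tensor_add_left VV.tensor_add_right in \<open>simp_all add: src_simps tgt_simps\<close>)
  note * = EA.tlift_universal[OF VV.abelian_G this]
  show "pair_coproduct K B \<in> add_hom E (tensor_group B VE VE)"
    using *(1) by (simp add: pair_coproduct_def Let_def add_hom_def env_simps(1,2))
  show "a \<in> carrier B \<Longrightarrow> b \<in> carrier B \<Longrightarrow> pair_coproduct K B (ee a b) = tensor B VE VE (s a) (t b)"
    using *(2) by (simp add: pair_coproduct_def Let_def env_elem_def)
qed

lemma q_VE_lin: "q k \<in> right_lin B VE (V k)" "q k \<in> left_lin B VE (V k)"
  by (auto simp: right_lin_def left_lin_def add_hom_def)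

lemma coproduct_psiD:
  assumes "x \<in> carrier E"
  shows "tensor_map B (V k) (V k) (q k) (q k) (pair_coproduct K B x) = psiD k x"
  using assms
proof (induction rule: env_induct)
  case (pure a b)
  then show ?case
    using tensor_map_tensor[OF biactD(2)[OF VE_biact] biactD(1)[OF VE_biact] D.L_right_act D.R_left_act q_VE_lin, of "s a" "t b"]
    by (simp add: pair_coproduct_ee psiD_ee)
next
  case (add X Y)
  note tm = tensor_map_add_hom[OF biactD(2)[OF VE_biact] biactD(1)[OF VE_biact] D.L_right_act D.R_left_act q_VE_lin]
  show ?case
    using add add_hom_closed[OF pair_coproduct_add_hom]
    by (simp add: add_hom_add[OF pair_coproduct_add_hom] add_hom_add[OF tm] ring_hom_add[OF psiD_hom])
qed

abbreviation "cop k \<equiv> snd (JJ_coproduct K B) k"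

text \<open>The coproduct is evaluated on a chosen representative. By \<open>psiD_vanish\<close> every other one gives the same
  value.\<close>

lemma cop_q: "x \<in> carrier E \<Longrightarrow> cop k (q (2 * k) x) = psiD k x"
proof -
  assume x: "x \<in> carrier E"
  let ?f = "\<lambda>x. tensor_map B (V k) (V k) (q k) (q k) (pair_coproduct K B x)"
  have "?f \<in> add_hom E (D.TG k)"
    by (rule add_hom_comp[OF tensor_map_add_hom pair_coproduct_add_hom])
      (fact biactD(2)[OF VE_biact] biactD(1)[OF VE_biact] D.L_right_act D.R_left_act q_VE_lin)+
  then have "?f (SOME y. y \<in> q (2 * k) x) = ?f x"
    by (rule descend[OF _ D.abelian_TT _ x]) (use psiD_vanish mu_closed in \<open>simp add: coproduct_psiD\<close>)
  then show ?thesis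
    by (simp add: JJ_coproduct_def Let_def coproduct_psiD[OF x])
qed

lemma fst_coproduct [simp]: "fst (JJ_coproduct K B) k = 2 * k"
  by (simp add: JJ_coproduct_def)

lemma cop_res_add_hom: "2 * k \<le> n \<Longrightarrow> (\<lambda>X. cop k (res (2 * k) X)) \<in> add_hom (Q n) (D.TG k)"
proof -
  assume "2 * k \<le> n"
  moreover have "psiD k \<in> add_hom E (D.TG k)"
    using ring_hom_add_hom[OF psiD_hom] by (simp add: add_hom_def)
  ultimately show ?thesis
    by (intro q_add_homI[where G = "psiD k"]) (simp_all add: cop_q)
qed

text \<open>Left and right multiplication on \<open>J \<diamond> J\<close> and the derived actions are products in the commutative
  ring \<open>J \<diamond> J\<close>.\<close>

lemma D_smult:
  assumes "a \<in> carrier B" "X \<in> carrier (D.TG k)"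
  shows "a \<odot>\<^bsub>tensor_bimod B (V k) (V k)\<^esub> X = D.tens k (s a) \<one>\<^bsub>E\<^esub> \<otimes>\<^bsub>D.TT k\<^esub> X"
    and "rsmult (tensor_bimod B (V k) (V k)) X a = D.tens k \<one>\<^bsub>E\<^esub> (t a) \<otimes>\<^bsub>D.TT k\<^esub> X"
proof -
  interpret T: cring "D.TT k" by (rule D.cring_TT)
  note acts = biactD[OF V_biact]
  note l = left_actD[OF tensor_bimod_left_act[OF V_biact acts(1)]]
  note r = right_actD[OF tensor_bimod_right_act[OF acts(2) V_biact]]
  show "a \<odot>\<^bsub>tensor_bimod B (V k) (V k)\<^esub> X = D.tens k (s a) \<one>\<^bsub>E\<^esub> \<otimes>\<^bsub>D.TT k\<^esub> X"
    using assms(2)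
  proof (induction rule: D.TT_induct)
    case (pure x y)
    then show ?case
      using assms(1) tensor_bimod_smult[OF V_biact acts(1), where r = a and p = "q k x" and q = "q k y"] by (simp add: D.tens_mult)
  next
    case (add X Y)
    then show ?case
      using assms(1) l(3)[where r = a and x = X and y = Y] T.r_distr[of X Y "D.tens k (s a) \<one>\<^bsub>E\<^esub>"] by simp
  qed
  show "rsmult (tensor_bimod B (V k) (V k)) X a = D.tens k \<one>\<^bsub>E\<^esub> (t a) \<otimes>\<^bsub>D.TT k\<^esub> X"
    using assms(2)
  proof (induction rule: D.TT_induct)
    case (pure x y)
    then show ?case
      using assms(1) tensor_bimod_rsmult[OF acts(2) V_biact, where s = a and p = "q k x" and q = "q k y"] by (simp add: D.tens_mult)
  next
    case (add X Y)
    then show ?case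
      using assms(1) r(3)[where s = a and x = X and y = Y] T.r_distr[of X Y "D.tens k \<one>\<^bsub>E\<^esub> (t a)"] by simp
  qed
qed

lemma dia_simps [simp]:
  "carrier (dia K B P R) = carrier (tensor_group B (left_view K B P) (left_view K B R))"
  "add (dia K B P R) = add (tensor_group B (left_view K B P) (left_view K B R))"
  "zero (dia K B P R) = zero (tensor_group B (left_view K B P) (left_view K B R))"
  by (simp_all add: dia_def Let_def)

abbreviation "DD k \<equiv> dia K B (J k) (J k)"

text \<open>Both actions on \<open>J \<diamond> J\<close> are sums over a representative in the enveloping algebra, and over one in
  \<open>J \<diamond> J\<close>, of the following shape.\<close>

lemma dia_tlift:
  assumes Z: "Z \<in> carrier E" and X: "X \<in> carrier (D.TG k)"
    and f_q: "\<And>a b x y. a \<in> carrier B \<Longrightarrow> b \<in> carrier B \<Longrightarrow> x \<in> carrier E \<Longrightarrow> y \<in> carrier E \<Longrightarrow>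
      f a b (q k x) (q k y) = D.tens k (s a \<otimes>\<^bsub>E\<^esub> x) (t b \<otimes>\<^bsub>E\<^esub> y)"
  shows "tlift (D.TG k) (\<lambda>a b. tlift (D.TG k) (f a b) X) Z
    = psiD k Z \<otimes>\<^bsub>D.TT k\<^esub> X"
proof -
  interpret T: cring "D.TT k" by (rule D.cring_TT)
  let ?G = "D.TG k"
  have inner: "balanced B (V k) (V k) ?G (f a b)" if "a \<in> carrier VB" "b \<in> carrier VO" for a b
  proof (rule balancedI)
    fix u c v assume *: "u \<in> carrier (V k)" "c \<in> carrier B" "v \<in> carrier (V k)"
    then obtain x y where "x \<in> carrier E" "y \<in> carrier E" "u = q k x" "v = q k y"
      by (auto elim!: q_cases)
    with * that show "f a b (rsmult (V k) u c) v = f a b u (c \<odot>\<^bsub>V k\<^esub> v)"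
      using D.tens_balanced[of "s a \<otimes>\<^bsub>E\<^esub> x" "t b \<otimes>\<^bsub>E\<^esub> y" c k] by (simp add: f_q E.m_lcomm)
  qed (use that in \<open>auto simp: f_q E.r_distr D.tens_add_left D.tens_add_right elim!: q_cases\<close>)
  have outer: "balanced K VB VO ?G (\<lambda>a b. f a b u v)" if "u \<in> carrier (V k)" "v \<in> carrier (V k)" for u v
  proof -
    have "u \<in> carrier (Q k)" "v \<in> carrier (Q k)"
      using that by simp_all
    from this(1) obtain x where x: "x \<in> carrier E" "u = q k x" by (rule q_cases)
    from \<open>v \<in> carrier (Q k)\<close> obtain y where y: "y \<in> carrier E" "v = q k y" by (rule q_cases)
    note xy = x y
    show ?thesis
    proof (rule balancedI)
      fix a c b assume *: "a \<in> carrier VB" "c \<in> carrier K" "b \<in> carrier VO"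
      then have "s (c \<odot>\<^bsub>B\<^esub> a) = t (c \<odot>\<^bsub>B\<^esub> \<one>\<^bsub>B\<^esub>) \<otimes>\<^bsub>E\<^esub> s a" "t (c \<odot>\<^bsub>B\<^esub> b) = s (c \<odot>\<^bsub>B\<^esub> \<one>\<^bsub>B\<^esub>) \<otimes>\<^bsub>E\<^esub> t b"
        by (simp_all add: smult_one_mult[of c a] smult_one_mult[of c b] src_simps tgt_simps scal_unit)
      with * xy show "f (rsmult VB a c) b u v = f a (c \<odot>\<^bsub>VO\<^esub> b) u v"
        using D.tens_balanced[of "s a \<otimes>\<^bsub>E\<^esub> x" "t b \<otimes>\<^bsub>E\<^esub> y" "c \<odot>\<^bsub>B\<^esub> \<one>\<^bsub>B\<^esub>" k] by (simp add: f_q E.m_assoc)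
    qed (use xy in \<open>simp_all add: f_q src_simps tgt_simps E.l_distr D.tens_add_left D.tens_add_right\<close>)
  qed
  define h where "h = (\<lambda>Z X. tlift ?G (\<lambda>a b. tlift ?G (f a b) X) Z)"
  note tt = tlift_tlift[OF EA.P EA.Q D.L_right_act D.R_left_act D.abelian_TT inner outer]
  have h_left: "X \<in> carrier ?G \<Longrightarrow> (\<lambda>Z. h Z X) \<in> add_hom E ?G" for X
    using tt(1)[of X] unfolding h_def by (simp add: add_hom_def env_simps(1,2))
  have h_right: "Z \<in> carrier (tensor_group K VB VO) \<Longrightarrow> h Z \<in> add_hom ?G ?G" for Z
    unfolding h_def by (rule tt(2))
  have h_pure: "h (ee a b) (D.tens k x y) = D.tens k (s a \<otimes>\<^bsub>E\<^esub> x) (t b \<otimes>\<^bsub>E\<^esub> y)"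
    if "a \<in> carrier B" "b \<in> carrier B" "x \<in> carrier E" "y \<in> carrier E" for a b x y
    unfolding h_def env_elem_def using that tt(3)[of a b "q k x" "q k y"] by (simp add: f_q)
  have "h Z X = psiD k Z \<otimes>\<^bsub>D.TT k\<^esub> X"
    using Z X
  proof (induction arbitrary: X rule: env_induct)
    case (pure a b)
    from pure(3) show ?case
    proof (induction rule: D.TT_induct)
      case (pure x y)
      then show ?case
        using \<open>a \<in> carrier B\<close> \<open>b \<in> carrier B\<close> by (simp add: h_pure psiD_ee D.tens_mult)
    next
      case (add X Y)
      have "ee a b \<in> carrier (tensor_group K VB VO)"
        using pure(1,2) ee_closed env_simps(1) by blast
      with add pure(1,2) show ?case
        using add_hom_add[OF h_right, of "ee a b" X Y] T.r_distr[of X Y "psiD k (ee a b)"] by simp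
    qed
  next
    case (add Z Z')
    then show ?case
      using add_hom_add[OF h_left, of X Z Z'] T.l_distr[of "psiD k Z" "psiD k Z'" X]
      by (simp add: ring_hom_add[OF psiD_hom])
  qed
  then show ?thesis by (simp add: h_def)
qed

lemma dia_smult:
  assumes Z: "Z \<in> carrier E" and X: "X \<in> carrier (D.TG k)"
  shows "Z \<odot>\<^bsub>DD k\<^esub> X = psiD k Z \<otimes>\<^bsub>D.TT k\<^esub> X" "rsmult (DD k) X Z = psiD k Z \<otimes>\<^bsub>D.TT k\<^esub> X"
proof -
  show "Z \<odot>\<^bsub>DD k\<^esub> X = psiD k Z \<otimes>\<^bsub>D.TT k\<^esub> X"
    using dia_tlift[OF Z X, of "\<lambda>a b u v. tensor B (V k) (V k) (s a \<odot>\<^bsub>J k\<^esub> u) (t b \<odot>\<^bsub>J k\<^esub> v)"]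
    by (simp add: dia_def Let_def)
  show "rsmult (DD k) X Z = psiD k Z \<otimes>\<^bsub>D.TT k\<^esub> X"
    using dia_tlift[OF Z X, of "\<lambda>a b u v. tensor B (V k) (V k) (rsmult (J k) u (s a)) (rsmult (J k) v (t b))"]
    by (simp add: dia_def Let_def E.m_comm)
qed

lemma DD_biact: "biact E E (DD k)"
proof -
  interpret T: cring "D.TT k" by (rule D.cring_TT)
  have closed: "psiD k Z \<otimes>\<^bsub>D.TT k\<^esub> X \<in> carrier (D.TG k)"
    if "Z \<in> carrier E" "X \<in> carrier (D.TG k)" for X Z
    using that T.m_closed[of "psiD k Z" X] by simp
  have distr: "psiD k Z \<otimes>\<^bsub>D.TT k\<^esub> (X \<oplus>\<^bsub>D.TG k\<^esub> Y)
      = psiD k Z \<otimes>\<^bsub>D.TT k\<^esub> X \<oplus>\<^bsub>D.TG k\<^esub> psiD k Z \<otimes>\<^bsub>D.TT k\<^esub> Y"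
    if "Z \<in> carrier E" "X \<in> carrier (D.TG k)" "Y \<in> carrier (D.TG k)" for X Y Z
    using that T.r_distr[of X Y "psiD k Z"] by simp
  have sum: "X \<oplus>\<^bsub>D.TG k\<^esub> Y \<in> carrier (D.TG k)"
    if "X \<in> carrier (D.TG k)" "Y \<in> carrier (D.TG k)" for X Y
    using that T.a_closed[of X Y] by simp
  have "abelian_group (DD k)"
    by (rule abelian_group_cong[OF D.abelian_TT]) simp_all
  then show ?thesis
    unfolding biact_def left_act_def right_act_def add_hom_def
    using T.m_lcomm by (simp add: dia_smult closed distr sum)
qed

text \<open>Left and right multiplication on \<open>J\<close> agree, so \<open>p t(b) \<diamond> q = p \<diamond> q s(b)\<close> is a defining relation of \<open>J \<diamond> J\<close>
  rather than a condition on its elements.\<close>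

lemma takeuchi_eq_dia: "takeuchi K B (J k) (J k) = DD k"
proof -
  let ?t = "tensor B (V k) (V k)" and ?G = "D.TG k"
  have DD: "abelian_group (DD k)" by (rule left_actD(1)[OF biactD(1)[OF DD_biact]])
  have bal: "balanced B (V k) (V k) (DD k) (\<lambda>u v. ?t (rsmult (J k) u (t b)) v)"
    "balanced B (V k) (V k) (DD k) (\<lambda>u v. ?t u (rsmult (J k) v (s b)))" if b: "b \<in> carrier B" for b
  proof -
    show "balanced B (V k) (V k) (DD k) (\<lambda>u v. ?t (rsmult (J k) u (t b)) v)"
    proof (rule balancedI)
      fix u c v assume *: "u \<in> carrier (V k)" "c \<in> carrier B" "v \<in> carrier (V k)"
      then obtain x y where "x \<in> carrier E" "y \<in> carrier E" "u = q k x" "v = q k y"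
        by (auto elim!: q_cases)
      with * b show "?t (rsmult (J k) (rsmult (V k) u c) (t b)) v = ?t (rsmult (J k) u (t b)) (c \<odot>\<^bsub>V k\<^esub> v)"
        using D.tens_balanced[of "x \<otimes>\<^bsub>E\<^esub> t b" y c k] by (simp add: E.m_assoc)
    qed (use b in \<open>auto simp: E.l_distr D.tens_add_left D.tens_add_right elim!: q_cases\<close>)
    show "balanced B (V k) (V k) (DD k) (\<lambda>u v. ?t u (rsmult (J k) v (s b)))"
    proof (rule balancedI)
      fix u c v assume *: "u \<in> carrier (V k)" "c \<in> carrier B" "v \<in> carrier (V k)"
      then obtain x y where "x \<in> carrier E" "y \<in> carrier E" "u = q k x" "v = q k y"
        by (auto elim!: q_cases)
      with * b show "?t (rsmult (V k) u c) (rsmult (J k) v (s b)) = ?t u (rsmult (J k) (c \<odot>\<^bsub>V k\<^esub> v) (s b))"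
        using D.tens_balanced[of x "y \<otimes>\<^bsub>E\<^esub> s b" c k] by (simp add: E.m_assoc)
    qed (use b in \<open>auto simp: E.l_distr D.tens_add_left D.tens_add_right elim!: q_cases\<close>)
  qed
  have "tlift (DD k) (\<lambda>u v. ?t (rsmult (J k) u (t b)) v) X = tlift (DD k) (\<lambda>u v. ?t u (rsmult (J k) v (s b))) X"
    if b: "b \<in> carrier B" and X: "X \<in> carrier ?G" for b X
  proof -
    note l1 = tensorable.tlift_universal[OF D.tensorable_TT DD bal(1)[OF b]]
    note l2 = tensorable.tlift_universal[OF D.tensorable_TT DD bal(2)[OF b]]
    show ?thesis
    proof (rule D.TT_eqI[OF l1(1) l2(1) _ X])
      fix x y assume "x \<in> carrier E" "y \<in> carrier E"
      then show "tlift (DD k) (\<lambda>u v. ?t (rsmult (J k) u (t b)) v) (D.tens k x y)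
          = tlift (DD k) (\<lambda>u v. ?t u (rsmult (J k) v (s b))) (D.tens k x y)"
        using l1(2)[of "q k x" "q k y"] l2(2)[of "q k x" "q k y"] b D.tens_balanced[of x y b k]
        by (simp add: E.m_comm)
    qed
  qed
  then have "{X \<in> carrier (DD k). \<forall>b \<in> carrier B. tlift (DD k) (\<lambda>u v. ?t (rsmult (J k) u (t b)) v) X
      = tlift (DD k) (\<lambda>u v. ?t u (rsmult (J k) v (s b))) X} = carrier (DD k)"
    by auto
  then show ?thesis
    by (simp add: takeuchi_def Let_def)
qed

lemma cop_res_bimod_hom:
  assumes "2 * k \<le> n"
  shows "(\<lambda>X. cop k (res (2 * k) X)) \<in> bimod_hom E E (J n) (DD k)"
    and "(\<lambda>X. cop k (res (2 * k) X)) \<in> bimod_hom B B (V n) (tensor_bimod B (V k) (V k))"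
proof -
  interpret T: cring "D.TT k" by (rule D.cring_TT)
  note hom = cop_res_add_hom[OF assms]
  note a = add_hom_closed[OF hom] add_hom_add[OF hom]
  have m: "psiD k (z \<otimes>\<^bsub>E\<^esub> x) = psiD k z \<otimes>\<^bsub>D.TT k\<^esub> psiD k x" if "x \<in> carrier E" "z \<in> carrier E" for x z
    using that by (rule ring_hom_mult[OF psiD_hom, rotated])
  show "(\<lambda>X. cop k (res (2 * k) X)) \<in> bimod_hom E E (J n) (DD k)"
    using a assms by (auto simp: bimod_hom_def cop_q dia_smult m E.m_comm[of _ "_"] elim!: q_cases)
  show "(\<lambda>X. cop k (res (2 * k) X)) \<in> bimod_hom B B (V n) (tensor_bimod B (V k) (V k))"
    using a assms by (auto simp: bimod_hom_def cop_q D_smult m psiD_src psiD_tgt elim!: q_cases)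
qed

end

section \<open>The pro-ring\<close>

text \<open>When one of the two indices bounds the other, the comparison can be made there.\<close>

lemma pro_eq_right:
  assumes "Idx F = nat_cat" "Idx G = nat_cat"
    and "\<And>n x. x \<in> carrier (Obj F n) \<Longrightarrow> Map F (n, n) x = x"
    and "\<And>k. fst g k \<le> fst f k"
    and "\<And>k x. x \<in> carrier (Obj F (fst f k)) \<Longrightarrow> snd f k x = snd g k (Map F (fst f k, fst g k) x)"
  shows "pro_eq F G f g"
  by (rule pro_eq_natI[OF assms(1,2)]) (metis assms(3-5) order_refl)

lemma pro_eq_left:
  assumes "Idx F = nat_cat" "Idx G = nat_cat"
    and "\<And>n x. x \<in> carrier (Obj F n) \<Longrightarrow> Map F (n, n) x = x"
    and "\<And>k. fst f k \<le> fst g k"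
    and "\<And>k x. x \<in> carrier (Obj F (fst g k)) \<Longrightarrow> snd f k (Map F (fst g k, fst f k) x) = snd g k x"
  shows "pro_eq F G f g"
  by (rule pro_eq_natI[OF assms(1,2)]) (metis assms(3-5) order_refl)

lemma pro_object_natI:
  assumes "Idx F = nat_cat" "\<And>k. bimodule K R S (Obj F k)"
    and "\<And>k n. k \<le> n \<Longrightarrow> Map F (n, k) \<in> bimod_hom R S (Obj F n) (Obj F k)"
    and "\<And>n x. x \<in> carrier (Obj F n) \<Longrightarrow> Map F (n, n) x = x"
    and "\<And>k n i x. k \<le> n \<Longrightarrow> n \<le> i \<Longrightarrow> x \<in> carrier (Obj F i) \<Longrightarrow> Map F (n, k) (Map F (i, n) x) = Map F (i, k) x"
  shows "pro_object K R S F"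
  unfolding pro_object_def Let_def assms(1) using assms(2-5) cofiltered_nat_cat by auto

lemma tensor_map_id:
  assumes "right_act S P" "left_act S Q"
    and "\<And>p. p \<in> carrier P \<Longrightarrow> f p = p" "\<And>q. q \<in> carrier Q \<Longrightarrow> g q = q"
    and X: "X \<in> carrier (tensor_group S P Q)"
  shows "tensor_map S P Q f g X = X"
proof -
  interpret T: tensorable S P Q by (rule tensorable.intro) fact+
  have f: "f \<in> right_lin S P P"
    using assms(3) right_actD(2)[OF assms(1)] by (auto simp: right_lin_def add_hom_def)
  have g: "g \<in> left_lin S Q Q"
    using assms(4) left_actD(2)[OF assms(2)] by (auto simp: left_lin_def add_hom_def)
  show ?thesis
    by (rule T.tensor_eqI[where g = "\<lambda>X. X", OF tensor_map_add_hom[OF assms(1,2,1,2) f g] _ _ X])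
      (simp_all add: add_hom_def tensor_map_tensor[OF assms(1,2,1,2) f g] assms(3,4))
qed

lemma nested_eqI:
  assumes PQ: "right_act S P" "left_act S Q" and UW: "right_act S' U" "left_act S' W"
    and U: "carrier U = carrier (tensor_group S P Q)" "add U = add (tensor_group S P Q)"
    and f: "f \<in> add_hom (tensor_group S' U W) M" and f': "f' \<in> add_hom (tensor_group S' U W) M"
    and pure: "\<And>p q w. p \<in> carrier P \<Longrightarrow> q \<in> carrier Q \<Longrightarrow> w \<in> carrier W \<Longrightarrow>
      f (tensor S' U W (tensor S P Q p q) w) = f' (tensor S' U W (tensor S P Q p q) w)"
    and X: "X \<in> carrier (tensor_group S' U W)"
  shows "f X = f' X"
proof -
  interpret T: tensorable S P Q by (rule tensorable.intro[OF PQ])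
  interpret T': tensorable S' U W by (rule tensorable.intro[OF UW])
  show ?thesis
  proof (rule T'.tensor_eqI[OF f f' _ X])
    fix Y w assume Y: "Y \<in> carrier U" and w: "w \<in> carrier W"
    from Y have "Y \<in> carrier (tensor_group S P Q)" by (simp add: U)
    then show "f (tensor S' U W Y w) = f' (tensor S' U W Y w)"
    proof (induction rule: T.tensor_induct)
      case (add Y Y')
      then show ?case
        using T'.tensor_add_left[of Y Y' w] w T'.tensor_closed
        by (simp add: U add_hom_add[OF f] add_hom_add[OF f'])
    qed (use w pure in simp)
  qed
qed

text \<open>In \<open>(p \<otimes> q) \<otimes> w \<mapsto> p \<otimes> \<tau> q w\<close> the outer tensor product is formed with the action \<open>r\<close> on \<open>q\<close>.\<close>

lemma assoc_map:
  assumes PQ: "right_act S P" "left_act S Q" and UW: "right_act S' U" "left_act S' W"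
    and U: "carrier U = carrier (tensor_group S P Q)" "add U = add (tensor_group S P Q)"
    and V: "left_act S V"
    and tau: "\<And>w. w \<in> carrier W \<Longrightarrow> (\<lambda>q. \<tau> q w) \<in> left_lin S Q V" "\<And>q. q \<in> carrier Q \<Longrightarrow> \<tau> q \<in> add_hom W V"
    and r: "\<And>p q e. p \<in> carrier P \<Longrightarrow> q \<in> carrier Q \<Longrightarrow> e \<in> carrier S' \<Longrightarrow>
        rsmult U (tensor S P Q p q) e = tensor S P Q p (r q e)"
      "\<And>q e. q \<in> carrier Q \<Longrightarrow> e \<in> carrier S' \<Longrightarrow> r q e \<in> carrier Q"
      "\<And>q e w. q \<in> carrier Q \<Longrightarrow> e \<in> carrier S' \<Longrightarrow> w \<in> carrier W \<Longrightarrow> \<tau> (r q e) w = \<tau> q (e \<odot>\<^bsub>W\<^esub> w)"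
  shows "assoc_map S P V \<tau> \<in> add_hom (tensor_group S' U W) (tensor_group S P V)"
    and "p \<in> carrier P \<Longrightarrow> q \<in> carrier Q \<Longrightarrow> w \<in> carrier W \<Longrightarrow>
      assoc_map S P V \<tau> (tensor S' U W (tensor S P Q p q) w) = tensor S P V p (\<tau> q w)"
proof -
  interpret T: tensorable S P V by (rule tensorable.intro) fact+
  note tau1 = add_hom_closed[OF left_lin_add_hom[OF tau(1)]] add_hom_add[OF left_lin_add_hom[OF tau(1)]]
    left_lin_smult[OF tau(1)] add_hom_add[OF tau(2)]
  have pq: "balanced S P Q T.G (\<lambda>p q. tensor S P V p (\<tau> q w))" if w: "w \<in> carrier W" for w
    by (rule balancedI) (simp_all add: w tau1 T.tensor_closed T.tensor_add_left T.tensor_add_right T.tensor_smult)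
  have w: "(\<lambda>w. tensor S P V p (\<tau> q w)) \<in> add_hom W T.G" if "p \<in> carrier P" "q \<in> carrier Q" for p q
    by (rule add_homI) (simp_all add: that tau1 T.tensor_closed T.tensor_add_right)
  have bal: "\<exists>p'\<in>carrier P. \<exists>q'\<in>carrier Q. rsmult U (tensor S P Q p q) e = tensor S P Q p' q' \<and>
      tensor S P V p' (\<tau> q' w) = tensor S P V p (\<tau> q (e \<odot>\<^bsub>W\<^esub> w))"
    if "p \<in> carrier P" "q \<in> carrier Q" "e \<in> carrier S'" "w \<in> carrier W" for p q e w
    using that r by metis
  note nt = nested_tlift[where f = "\<lambda>p q w. tensor S P V p (\<tau> q w)", OF PQ UW U T.abelian_G pq w bal, folded assoc_map_def]
  show "assoc_map S P V \<tau> \<in> add_hom (tensor_group S' U W) (tensor_group S P V)"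
    by (rule nt(1))
  show "assoc_map S P V \<tau> (tensor S' U W (tensor S P Q p q) w) = tensor S P V p (\<tau> q w)"
    if "p \<in> carrier P" "q \<in> carrier Q" "w \<in> carrier W"
    by (rule nt(2)) (simp_all add: that)
qed

lemma flip_assoc_map:
  assumes PQ: "right_act S P" "left_act S Q" and UW: "right_act S' U" "left_act S' W"
    and U: "carrier U = carrier (tensor_group S P Q)" "add U = add (tensor_group S P Q)"
    and V: "right_act S V"
    and tau: "\<And>w. w \<in> carrier W \<Longrightarrow> (\<lambda>p. \<tau> p w) \<in> right_lin S P V" "\<And>p. p \<in> carrier P \<Longrightarrow> \<tau> p \<in> add_hom W V"
    and r: "\<And>p q e. p \<in> carrier P \<Longrightarrow> q \<in> carrier Q \<Longrightarrow> e \<in> carrier S' \<Longrightarrow>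
        rsmult U (tensor S P Q p q) e = tensor S P Q (r p e) q"
      "\<And>p e. p \<in> carrier P \<Longrightarrow> e \<in> carrier S' \<Longrightarrow> r p e \<in> carrier P"
      "\<And>p e w. p \<in> carrier P \<Longrightarrow> e \<in> carrier S' \<Longrightarrow> w \<in> carrier W \<Longrightarrow> \<tau> (r p e) w = \<tau> p (e \<odot>\<^bsub>W\<^esub> w)"
  shows "flip_assoc_map S V Q \<tau> \<in> add_hom (tensor_group S' U W) (tensor_group S V Q)"
    and "p \<in> carrier P \<Longrightarrow> q \<in> carrier Q \<Longrightarrow> w \<in> carrier W \<Longrightarrow>
      flip_assoc_map S V Q \<tau> (tensor S' U W (tensor S P Q p q) w) = tensor S V Q (\<tau> p w) q"
proof -
  interpret T: tensorable S V Q by (rule tensorable.intro) fact+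
  note tau1 = add_hom_closed[OF right_lin_add_hom[OF tau(1)]] add_hom_add[OF right_lin_add_hom[OF tau(1)]]
    right_lin_rsmult[OF tau(1)] add_hom_add[OF tau(2)]
  have pq: "balanced S P Q T.G (\<lambda>p q. tensor S V Q (\<tau> p w) q)" if w: "w \<in> carrier W" for w
    by (rule balancedI) (simp_all add: w tau1 T.tensor_closed T.tensor_add_left T.tensor_add_right T.tensor_smult)
  have w: "(\<lambda>w. tensor S V Q (\<tau> p w) q) \<in> add_hom W T.G" if "p \<in> carrier P" "q \<in> carrier Q" for p q
    by (rule add_homI) (simp_all add: that tau1 T.tensor_closed T.tensor_add_left)
  have bal: "\<exists>p'\<in>carrier P. \<exists>q'\<in>carrier Q. rsmult U (tensor S P Q p q) e = tensor S P Q p' q' \<and>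
      tensor S V Q (\<tau> p' w) q' = tensor S V Q (\<tau> p (e \<odot>\<^bsub>W\<^esub> w)) q"
    if "p \<in> carrier P" "q \<in> carrier Q" "e \<in> carrier S'" "w \<in> carrier W" for p q e w
    using that r by metis
  note nt = nested_tlift[where f = "\<lambda>p q w. tensor S V Q (\<tau> p w) q", OF PQ UW U T.abelian_G pq w bal, folded flip_assoc_map_def]
  show "flip_assoc_map S V Q \<tau> \<in> add_hom (tensor_group S' U W) (tensor_group S V Q)"
    by (rule nt(1))
  show "flip_assoc_map S V Q \<tau> (tensor S' U W (tensor S P Q p q) w) = tensor S V Q (\<tau> p w) q"
    if "p \<in> carrier P" "q \<in> carrier Q" "w \<in> carrier W"
    by (rule nt(2)) (simp_all add: that)
qed

text \<open>The usual case: \<open>\<tau>\<close> is the universal balanced map.\<close>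

lemma assoc_map_tensor:
  assumes P: "biact R S P" and Q: "biact S T Q" and W: "biact T R' W"
  defines "\<alpha> \<equiv> assoc_map S P (tensor_bimod T Q W) (tensor T Q W)"
  shows "\<alpha> \<in> add_hom (tensor_group T (tensor_bimod S P Q) W) (tensor_group S P (tensor_bimod T Q W))"
    and "p \<in> carrier P \<Longrightarrow> q \<in> carrier Q \<Longrightarrow> w \<in> carrier W \<Longrightarrow>
      \<alpha> (tensor T (tensor_bimod S P Q) W (tensor S P Q p q) w) = tensor S P (tensor_bimod T Q W) p (tensor T Q W q w)"
proof -
  interpret T: tensorable T Q W by (rule tensorable.intro[OF biactD(2)[OF Q] biactD(1)[OF W]])
  have tau: "(\<lambda>q. tensor T Q W q w) \<in> left_lin S Q (tensor_bimod T Q W)" if "w \<in> carrier W" for w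
    using that tensor_bimod_smult[OF Q biactD(1)[OF W]]
    by (intro left_linI add_homI) (simp_all add: T.tensor_closed T.tensor_add_left)
  have tau': "tensor T Q W q \<in> add_hom W (tensor_bimod T Q W)" if "q \<in> carrier Q" for q
    using that by (intro add_homI) (simp_all add: T.tensor_closed T.tensor_add_right)
  note * = assoc_map[OF biactD(2)[OF P] biactD(1)[OF Q] tensor_bimod_right_act[OF biactD(2)[OF P] Q] biactD(1)[OF W] _ _
      tensor_bimod_left_act[OF Q biactD(1)[OF W]] tau tau' tensor_bimod_rsmult[OF biactD(2)[OF P] Q] right_actD(2)[OF biactD(2)[OF Q]]
      T.tensor_smult]
  show "\<alpha> \<in> add_hom (tensor_group T (tensor_bimod S P Q) W) (tensor_group S P (tensor_bimod T Q W))"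
    unfolding \<alpha>_def by (rule *(1)) simp_all
  show "\<alpha> (tensor T (tensor_bimod S P Q) W (tensor S P Q p q) w) = tensor S P (tensor_bimod T Q W) p (tensor T Q W q w)"
    if "p \<in> carrier P" "q \<in> carrier Q" "w \<in> carrier W"
    unfolding \<alpha>_def by (rule *(2)) (simp_all add: that)
qed

context pair_algebra
begin

lemma res_self [simp]: "X \<in> carrier (Q n) \<Longrightarrow> res n X = X"
  by (auto elim!: q_cases)

abbreviation "m k \<equiv> snd (JJ_mult K B) k"

lemma fst_mult [simp]: "fst (JJ_mult K B) k = k"
  by (simp add: JJ_mult_def)

lemma mult_eq: "m k = tlift (Q k) (\<lambda>x y. x \<otimes>\<^bsub>Q k\<^esub> y)"
  by (simp add: JJ_mult_def Let_def)

lemma abelian_Q: "abelian_group (Q k)"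
  using cring_Q by (simp add: cring_def ring_def)

lemma m_add_hom: "m k \<in> add_hom (EE.TG k) (Q k)"
  unfolding mult_eq by (rule tensorable.tlift_universal(1)[OF EE.tensorable_TT abelian_Q EE.mult_balanced]) simp

lemma m_tens [simp]: "x \<in> carrier E \<Longrightarrow> y \<in> carrier E \<Longrightarrow> m k (EE.tens k x y) = q k (x \<otimes>\<^bsub>E\<^esub> y)"
  unfolding mult_eq using tensorable.tlift_universal(2)[OF EE.tensorable_TT abelian_Q EE.mult_balanced, of "q k x" k "q k y"]
  by simp

abbreviation "AA n \<equiv> tensor_bimod E (J n) (J n)"

lemma J_acts [simp]: "left_act E (J n)" "right_act E (J n)"
  using J_biact biactD by blast+

lemma AA_biact: "biact E E (AA n)"
  by (rule tensor_bimod_biact[OF J_biact J_biact])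

lemma AA_acts [simp]: "left_act E (AA n)" "right_act E (AA n)"
  using AA_biact biactD by blast+

lemma AA_smult:
  assumes "e \<in> carrier E" "x \<in> carrier E" "y \<in> carrier E"
  shows "e \<odot>\<^bsub>AA n\<^esub> EE.tens n x y = EE.tens n (e \<otimes>\<^bsub>E\<^esub> x) y"
    and "rsmult (AA n) (EE.tens n x y) e = EE.tens n x (y \<otimes>\<^bsub>E\<^esub> e)"
  using assms tensor_bimod_smult[OF J_biact J_acts(1), where r = e and p = "q n x" and q = "q n y"]
    tensor_bimod_rsmult[OF J_acts(2) J_biact, where s = e and p = "q n x" and q = "q n y"] by simp_all

lemma m_res_bimod_hom:
  assumes "k \<le> n"
  shows "(\<lambda>X. m k (EE.transit k X)) \<in> bimod_hom E E (AA n) (J k)"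
proof -
  have hom: "(\<lambda>X. m k (EE.transit k X)) \<in> add_hom (AA n) (J k)"
    using add_hom_comp[OF m_add_hom EE.transit_add_hom[OF assms]] by (simp add: add_hom_def)
  show ?thesis
    unfolding bimod_hom_iff
  proof
    show "(\<lambda>X. m k (EE.transit k X)) \<in> left_lin E (AA n) (J k)"
      by (rule left_lin_tensorI[OF hom, where S = E and P = "J n" and Q = "J n"])
        (use assms in \<open>auto simp: AA_smult EE.transit_tens E.m_assoc elim!: q_cases\<close>)
    show "(\<lambda>X. m k (EE.transit k X)) \<in> right_lin E (AA n) (J k)"
      by (rule right_lin_tensorI[OF hom, where S = E and P = "J n" and Q = "J n"])
        (use assms in \<open>auto simp: AA_smult EE.transit_tens E.m_assoc elim!: q_cases\<close>)
  qed
qed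

lemma transit_self:
  "X \<in> carrier (EE.TG n) \<Longrightarrow> EE.transit n X = X"
  by (rule tensor_map_id) simp_all

lemma m_res_eq: "X \<in> carrier (EE.TG k) \<Longrightarrow> m k (EE.transit k X) = m k X"
  by (simp add: transit_self)

lemma m_bimod_hom: "m k \<in> bimod_hom E E (AA k) (J k)"
proof -
  have "X \<in> carrier (AA k) \<Longrightarrow> e \<in> carrier E \<Longrightarrow> e \<odot>\<^bsub>AA k\<^esub> X \<in> carrier (AA k) \<and> rsmult (AA k) X e \<in> carrier (AA k)"
    "X \<in> carrier (AA k) \<Longrightarrow> Y \<in> carrier (AA k) \<Longrightarrow> X \<oplus>\<^bsub>AA k\<^esub> Y \<in> carrier (AA k)" for X Y e
    using left_actD(2)[OF AA_acts(1)] right_actD(2)[OF AA_acts(2)] abelian_group_a_closed[OF left_actD(1)[OF AA_acts(1)]]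
    by blast+
  then show ?thesis
    using m_res_bimod_hom[of k k] by (simp add: bimod_hom_def m_res_eq)
qed

lemma q_bimod_hom: "q k \<in> bimod_hom E E (regular E) (J k)"
  by (simp add: bimod_hom_def)

lemma res_lin_E: "k \<le> n \<Longrightarrow> (\<lambda>X. res k X) \<in> left_lin E (J n) (J k)" "k \<le> n \<Longrightarrow> (\<lambda>X. res k X) \<in> right_lin E (J n) (J k)"
  using res_bimod_hom bimod_hom_iff by blast+

lemma regular_biact: "biact E E (regular E)"
  by (rule ring_bimod_biact[OF E.is_cring]) (simp add: ring_hom_def)

text \<open>The two sides of the associativity law are additive maps on \<open>(J \<otimes> J) \<otimes> J\<close> with the same values
  \<open>x y z\<close>; the second one starts with the rebracketing.\<close>

lemma mult_assoc_left:
  assumes "k \<le> n"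
  defines "f \<equiv> \<lambda>X. m k (tensor_map E (J k) (J k) (\<lambda>X. m k (EE.transit k X)) (\<lambda>X. res k X) X)"
  shows "f \<in> add_hom (tensor_group E (AA n) (J n)) (Q k)"
    and "x \<in> carrier E \<Longrightarrow> y \<in> carrier E \<Longrightarrow> z \<in> carrier E \<Longrightarrow>
      f (tensor E (AA n) (J n) (EE.tens n x y) (q n z)) = q k (x \<otimes>\<^bsub>E\<^esub> y \<otimes>\<^bsub>E\<^esub> z)"
proof -
  have ml: "(\<lambda>X. m k (EE.transit k X)) \<in> right_lin E (AA n) (J k)"
    using m_res_bimod_hom[OF assms(1)] bimod_hom_iff by blast
  note * = AA_acts(2) J_acts(1) J_acts(2) J_acts(1) ml res_lin_E(1)[OF assms(1)]
  show "f \<in> add_hom (tensor_group E (AA n) (J n)) (Q k)"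
    unfolding f_def by (rule add_hom_comp[OF m_add_hom tensor_map_add_hom[OF *]])
  show "f (tensor E (AA n) (J n) (EE.tens n x y) (q n z)) = q k (x \<otimes>\<^bsub>E\<^esub> y \<otimes>\<^bsub>E\<^esub> z)"
    if "x \<in> carrier E" "y \<in> carrier E" "z \<in> carrier E"
    using that assms(1) unfolding f_def by (subst tensor_map_tensor[OF *]) (simp_all add: EE.transit_tens)
qed

lemma mult_assoc_right:
  assumes "k \<le> n"
  defines "f \<equiv> \<lambda>X. m k (tensor_map E (J k) (J k) (\<lambda>X. res k X) (\<lambda>X. m k (EE.transit k X))
    (assoc_map E (J n) (AA n) (tensor E (J n) (J n)) X))"
  shows "f \<in> add_hom (tensor_group E (AA n) (J n)) (Q k)"
    and "x \<in> carrier E \<Longrightarrow> y \<in> carrier E \<Longrightarrow> z \<in> carrier E \<Longrightarrow>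
      f (tensor E (AA n) (J n) (EE.tens n x y) (q n z)) = q k (x \<otimes>\<^bsub>E\<^esub> y \<otimes>\<^bsub>E\<^esub> z)"
proof -
  have ml: "(\<lambda>X. m k (EE.transit k X)) \<in> left_lin E (AA n) (J k)"
    using m_res_bimod_hom[OF assms(1)] bimod_hom_iff by blast
  note * = J_acts(2) AA_acts(1) J_acts(2) J_acts(1) res_lin_E(2)[OF assms(1)] ml
  note nt = assoc_map_tensor[OF J_biact[of n] J_biact[of n] J_biact[of n]]
  show "f \<in> add_hom (tensor_group E (AA n) (J n)) (Q k)"
    unfolding f_def by (rule add_hom_comp[OF m_add_hom add_hom_comp[OF tensor_map_add_hom[OF *] nt(1)]])
  show "f (tensor E (AA n) (J n) (EE.tens n x y) (q n z)) = q k (x \<otimes>\<^bsub>E\<^esub> y \<otimes>\<^bsub>E\<^esub> z)"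
    if "x \<in> carrier E" "y \<in> carrier E" "z \<in> carrier E"
    using that assms(1) unfolding f_def
    by (subst nt(2), simp, simp, simp, subst tensor_map_tensor[OF *]) (simp_all add: EE.transit_tens E.m_assoc)
qed

lemma self_index: "k \<le> common_index k k"
  by (rule common_arrows_nat)

text \<open>Both sides send \<open>r \<otimes> x\<close> to the product of the class of \<open>r\<close> with \<open>x\<close>.\<close>

lemma mult_unit_left:
  assumes "k \<le> n" and X: "X \<in> carrier (tensor_group E (regular E) (J n))"
  shows "m k (tensor_map E (J k) (J k) (q k) (\<lambda>X. res k X) X)
    = tlift (J k) (\<lambda>r x. q k r \<otimes>\<^bsub>Q k\<^esub> x) (tensor_map E (regular E) (J k) (\<lambda>x. x) (\<lambda>X. res k X) X)"
proof -
  note re = biactD[OF regular_biact]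
  interpret T: tensorable E "regular E" "J n" by (rule tensorable.intro) (simp_all add: re)
  interpret T': tensorable E "regular E" "J k" by (rule tensorable.intro) (simp_all add: re)
  have ql: "q k \<in> right_lin E (regular E) (J k)"
    using q_bimod_hom bimod_hom_iff by blast
  have id: "(\<lambda>x. x) \<in> right_lin E (regular E) (regular E)"
    by (simp add: right_lin_def add_hom_def)
  note * = re(2) J_acts(1) J_acts(2) J_acts(1) ql res_lin_E(1)[OF assms(1)]
  note ** = re(2) J_acts(1) re(2) J_acts(1) id res_lin_E(1)[OF assms(1)]
  have bal: "balanced E (regular E) (J k) (J k) (\<lambda>r x. q k r \<otimes>\<^bsub>Q k\<^esub> x)"
    by (rule balancedI) (auto simp: E.l_distr E.r_distr E.m_assoc elim!: q_cases)
  note lift = T'.tlift_universal[OF left_actD(1)[OF J_acts(1)] bal]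
  have l: "(\<lambda>X. tlift (J k) (\<lambda>r x. q k r \<otimes>\<^bsub>Q k\<^esub> x) (tensor_map E (regular E) (J k) (\<lambda>x. x) (\<lambda>X. res k X) X)) \<in> add_hom T.G (Q k)"
    using add_hom_comp[OF lift(1) tensor_map_add_hom[OF **]] by (simp add: add_hom_def)
  show ?thesis
  proof (rule T.tensor_eqI[OF add_hom_comp[OF m_add_hom tensor_map_add_hom[OF *]] l _ X])
    fix e u assume e: "e \<in> carrier (regular E)" and "u \<in> carrier (J n)"
    then obtain x where x: "x \<in> carrier E" "u = q n x" by (auto elim!: q_cases)
    show "m k (tensor_map E (J k) (J k) (q k) (\<lambda>X. res k X) (tensor E (regular E) (J n) e u))
      = tlift (J k) (\<lambda>r x. q k r \<otimes>\<^bsub>Q k\<^esub> x) (tensor_map E (regular E) (J k) (\<lambda>x. x) (\<lambda>X. res k X) (tensor E (regular E) (J n) e u))"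
      using x e assms(1) lift(2)[of e "q k x"]
      by (subst tensor_map_tensor[OF *], simp, simp, subst tensor_map_tensor[OF **], simp_all)
  qed
qed

lemma mult_unit_right:
  assumes "k \<le> n" and X: "X \<in> carrier (tensor_group E (J n) (regular E))"
  shows "m k (tensor_map E (J k) (J k) (\<lambda>X. res k X) (q k) X)
    = tlift (J k) (\<lambda>x r. x \<otimes>\<^bsub>Q k\<^esub> q k r) (tensor_map E (J k) (regular E) (\<lambda>X. res k X) (\<lambda>x. x) X)"
proof -
  note re = biactD[OF regular_biact]
  interpret T: tensorable E "J n" "regular E" by (rule tensorable.intro) (simp_all add: re)
  interpret T': tensorable E "J k" "regular E" by (rule tensorable.intro) (simp_all add: re)
  have ql: "q k \<in> left_lin E (regular E) (J k)"
    using q_bimod_hom bimod_hom_iff by blast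
  have id: "(\<lambda>x. x) \<in> left_lin E (regular E) (regular E)"
    by (simp add: left_lin_def add_hom_def)
  note * = J_acts(2) re(1) J_acts(2) J_acts(1) res_lin_E(2)[OF assms(1)] ql
  note ** = J_acts(2) re(1) J_acts(2) re(1) res_lin_E(2)[OF assms(1)] id
  have bal: "balanced E (J k) (regular E) (J k) (\<lambda>x r. x \<otimes>\<^bsub>Q k\<^esub> q k r)"
    by (rule balancedI) (auto simp: E.l_distr E.r_distr E.m_assoc elim!: q_cases)
  note lift = T'.tlift_universal[OF left_actD(1)[OF J_acts(1)] bal]
  have l: "(\<lambda>X. tlift (J k) (\<lambda>x r. x \<otimes>\<^bsub>Q k\<^esub> q k r) (tensor_map E (J k) (regular E) (\<lambda>X. res k X) (\<lambda>x. x) X)) \<in> add_hom T.G (Q k)"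
    using add_hom_comp[OF lift(1) tensor_map_add_hom[OF **]] by (simp add: add_hom_def)
  show ?thesis
  proof (rule T.tensor_eqI[OF add_hom_comp[OF m_add_hom tensor_map_add_hom[OF *]] l _ X])
    fix e u assume e: "e \<in> carrier (regular E)" and "u \<in> carrier (J n)"
    then obtain x where x: "x \<in> carrier E" "u = q n x" by (auto elim!: q_cases)
    show "m k (tensor_map E (J k) (J k) (\<lambda>X. res k X) (q k) (tensor E (J n) (regular E) u e))
      = tlift (J k) (\<lambda>x r. x \<otimes>\<^bsub>Q k\<^esub> q k r) (tensor_map E (J k) (regular E) (\<lambda>X. res k X) (\<lambda>x. x) (tensor E (J n) (regular E) u e))"
      using x e assms(1) lift(2)[of "q k x" e]
      by (subst tensor_map_tensor[OF *], simp, simp, subst tensor_map_tensor[OF **], simp_all)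
  qed
qed

lemma pro_object_JJ: "pro_object K E E (JJ K B)"
  by (rule pro_object_natI) (auto simp: J_bimodule res_bimod_hom elim!: q_cases)

lemma pro_ring_JJ: "pro_ring K E (JJ K B) (JJ_mult K B) (JJ_unit K B)"
  unfolding pro_ring_def Let_def
proof (intro conjI pro_object_JJ)
  show "JJ_mult K B \<in> pro_mor E E (pro_tensor E (JJ K B) (JJ K B)) (JJ K B)"
  proof (rule pro_mor_natI)
    fix k n :: nat assume kn: "k \<le> n"
    have "res k (m n X) = m k (EE.transit k X)" if X: "X \<in> carrier (EE.TG n)" for X
    proof (rule EE.TT_eqI[OF _ _ _ X])
      show "(\<lambda>X. res k (m n X)) \<in> add_hom (EE.TG n) (Q k)"
        by (rule add_hom_comp[OF ring_hom_add_hom[OF res_hom[OF kn]] m_add_hom])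
      show "(\<lambda>X. m k (EE.transit k X)) \<in> add_hom (EE.TG n) (Q k)"
        by (rule add_hom_comp[OF m_add_hom EE.transit_add_hom[OF kn]])
    qed (use kn in \<open>simp add: EE.transit_tens\<close>)
    then show "\<exists>i. fst (JJ_mult K B) k \<le> i \<and> fst (JJ_mult K B) n \<le> i \<and>
        (\<forall>x\<in>carrier (Obj (pro_tensor E (JJ K B) (JJ K B)) i).
          Map (JJ K B) (n, k) (m n (Map (pro_tensor E (JJ K B) (JJ K B)) (i, fst (JJ_mult K B) n) x)) =
          m k (Map (pro_tensor E (JJ K B) (JJ K B)) (i, fst (JJ_mult K B) k) x))"
      using kn by (intro exI[of _ n]) (simp add: transit_self)
  qed (simp_all add: m_bimod_hom)
  show "JJ_unit K B \<in> pro_mor E E (const_pro (Idx (JJ K B)) (regular E)) (JJ K B)"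
    by (rule pro_mor_natI) (auto simp: JJ_unit_def q_bimod_hom)
  have self: "x \<in> carrier (tensor_group E (AA n) (J n)) \<Longrightarrow>
      tensor_map E (AA n) (J n) (EE.transit n) (\<lambda>X. res n X) x = x" for n x
    by (rule tensor_map_id) (simp_all add: transit_self)
  show "pro_eq (pro_tensor E (pro_tensor E (JJ K B) (JJ K B)) (JJ K B)) (JJ K B)
     (pro_comp (JJ_mult K B) (pro_tensor_mor E (pro_tensor E (JJ K B) (JJ K B)) (JJ K B) (JJ K B) (JJ K B) (JJ_mult K B) pro_id))
     (pro_comp (JJ_mult K B) (pro_comp (pro_tensor_mor E (JJ K B) (pro_tensor E (JJ K B) (JJ K B)) (JJ K B) (JJ K B) pro_id (JJ_mult K B))
        (pro_assoc E (JJ K B))))"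
    (is "pro_eq ?F _ ?f ?g")
  proof (rule pro_eq_right)
    fix k and X :: "((('b, 'b) tens set, ('b, 'b) tens set) tens, ('b, 'b) tens set) tens"
    let ?n = "common_index k k"
    have kn: "k \<le> ?n" by (rule common_arrows_nat)
    assume "X \<in> carrier (Obj ?F (fst ?f k))"
    then have X: "X \<in> carrier (tensor_group E (AA ?n) (J ?n))"
      by (simp add: pro_tensor_mor_nat)
    have "m k (tensor_map E (J k) (J k) (\<lambda>X. m k (EE.transit k X)) (\<lambda>X. res k X) X) =
      m k (tensor_map E (J k) (J k) (\<lambda>X. res k X) (\<lambda>X. m k (EE.transit k X))
        (assoc_map E (J ?n) (AA ?n) (tensor E (J ?n) (J ?n)) X))"
      by (rule nested_eqI[OF J_acts(2,1) AA_acts(2) J_acts(1) _ _ mult_assoc_left(1)[OF kn] mult_assoc_right(1)[OF kn] _ X])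
        (auto simp: mult_assoc_left(2)[OF kn] mult_assoc_right(2)[OF kn] elim!: q_cases)
    then show "snd ?f k X = snd ?g k (Map ?F (fst ?f k, fst ?g k) X)"
      using X by (simp add: pro_tensor_mor_nat Let_def pro_assoc_def self)
  qed (simp_all add: pro_tensor_mor_nat self pro_assoc_def)
  show "pro_eq (pro_tensor E (const_pro (Idx (JJ K B)) (regular E)) (JJ K B)) (JJ K B)
     (pro_comp (JJ_mult K B) (pro_tensor_mor E (const_pro (Idx (JJ K B)) (regular E)) (JJ K B) (JJ K B) (JJ K B) (JJ_unit K B) pro_id))
     (pro_lunit (JJ K B))"
  proof (rule pro_eq_right)
    show "Map (pro_tensor E (const_pro (Idx (JJ K B)) (regular E)) (JJ K B)) (n, n) x = x"
      if "x \<in> carrier (Obj (pro_tensor E (const_pro (Idx (JJ K B)) (regular E)) (JJ K B)) n)" for n x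
      using that by (simp, intro tensor_map_id) (simp_all add: biactD[OF regular_biact] const_pro_def)
  qed (simp_all add: pro_tensor_mor_nat JJ_unit_def pro_lunit_def Let_def common_arrows_nat mult_unit_left[OF self_index] const_pro_def)
  show "pro_eq (pro_tensor E (JJ K B) (const_pro (Idx (JJ K B)) (regular E))) (JJ K B)
     (pro_comp (JJ_mult K B) (pro_tensor_mor E (JJ K B) (const_pro (Idx (JJ K B)) (regular E)) (JJ K B) (JJ K B) pro_id (JJ_unit K B)))
     (pro_runit (JJ K B))"
  proof (rule pro_eq_right)
    show "Map (pro_tensor E (JJ K B) (const_pro (Idx (JJ K B)) (regular E))) (n, n) x = x"
      if "x \<in> carrier (Obj (pro_tensor E (JJ K B) (const_pro (Idx (JJ K B)) (regular E))) n)" for n x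
      using that by (simp, intro tensor_map_id) (simp_all add: biactD[OF regular_biact] const_pro_def)
  qed (simp_all add: pro_tensor_mor_nat JJ_unit_def pro_runit_def Let_def common_arrows_nat mult_unit_right[OF self_index] const_pro_def)
qed

end

section \<open>The pro-coring\<close>

lemma balanced_cong:
  assumes "balanced S P Q M g" "right_act S P" "left_act S Q"
    and "\<And>p q. p \<in> carrier P \<Longrightarrow> q \<in> carrier Q \<Longrightarrow> f p q = g p q"
  shows "balanced S P Q M f"
  using balancedD[OF assms(1)] right_actD(2)[OF assms(2)] left_actD(2)[OF assms(3)]
    abelian_group_a_closed[OF right_actD(1)[OF assms(2)]] abelian_group_a_closed[OF left_actD(1)[OF assms(3)]]
  by (intro balancedI) (simp_all add: assms(4))

context pair_algebra
begin

abbreviation "VV k \<equiv> tensor_bimod B (V k) (V k)"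

lemma V_acts [simp]: "left_act B (V k)" "right_act B (V k)"
  using V_biact biactD by blast+

lemma VV_biact: "biact B B (VV k)"
  by (rule tensor_bimod_biact[OF V_biact V_biact])

lemma VV_acts [simp]: "left_act B (VV k)" "right_act B (VV k)"
  using VV_biact biactD by blast+

lemma regular_B_biact: "biact B B (regular B)"
  by (rule ring_bimod_biact[OF cring_B]) (simp add: ring_hom_def)

lemma regular_B_acts [simp]: "left_act B (regular B)" "right_act B (regular B)"
  using regular_B_biact biactD by blast+

abbreviation "cou k \<equiv> snd (JJ_counit K B) k"

lemma fst_counit [simp]: "fst (JJ_counit K B) k = max k 1"
  by (simp add: JJ_counit_def)

lemma cou_q [simp]: "1 \<le> i \<Longrightarrow> x \<in> carrier E \<Longrightarrow> cou k (q i x) = pair_counit K B x"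
  by (simp add: JJ_counit_def counit_descend)

lemma cou_bimod_hom: "1 \<le> i \<Longrightarrow> cou k \<in> bimod_hom B B (V i) (regular B)"
  by (auto simp: bimod_hom_def ring_hom_add[OF counit_hom] ring_hom_mult[OF counit_hom] BR.m_comm elim!: q_cases)

lemma cou_res_bimod_hom:
  assumes "1 \<le> i" "i \<le> n"
  shows "(\<lambda>X. cou k (res i X)) \<in> bimod_hom B B (V n) (regular B)"
  using assms by (auto simp: bimod_hom_def ring_hom_add[OF counit_hom] ring_hom_mult[OF counit_hom] BR.m_comm elim!: q_cases)

lemma psiD_add_hom: "psiD k \<in> add_hom E (D.TG k)"
  using ring_hom_add_hom[OF psiD_hom] by (simp add: add_hom_def)

lemma env_eqI:
  assumes f: "f \<in> add_hom E M" and g: "g \<in> add_hom E M"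
    and "\<And>a b. a \<in> carrier B \<Longrightarrow> b \<in> carrier B \<Longrightarrow> f (ee a b) = g (ee a b)" and "x \<in> carrier E"
  shows "f x = g x"
  using assms(4) by (induction rule: env_induct) (simp_all add: assms(3) add_hom_add[OF f] add_hom_add[OF g])

lemma transit_psiD: "k \<le> n \<Longrightarrow> x \<in> carrier E \<Longrightarrow> D.transit k (psiD n x) = psiD k x"
  by (rule env_eqI[OF add_hom_comp[OF D.transit_add_hom psiD_add_hom] psiD_add_hom]) (simp_all add: psiD_ee D.transit_tens)

lemma V_res_lin: "k \<le> n \<Longrightarrow> (\<lambda>X. res k X) \<in> bimod_hom B B (V n) (V k)"
  using D.res_left_lin D.res_right_lin bimod_hom_iff by blast

lemma cop_bimod_hom:
  "cop k \<in> bimod_hom B B (V (2 * k)) (VV k)" "cop k \<in> bimod_hom E E (J (2 * k)) (DD k)"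
proof -
  have "X \<in> carrier (Q i) \<Longrightarrow> e \<in> carrier E \<Longrightarrow> q i e \<otimes>\<^bsub>Q i\<^esub> X \<in> carrier (Q i) \<and> X \<otimes>\<^bsub>Q i\<^esub> q i e \<in> carrier (Q i)"
    "X \<in> carrier (Q i) \<Longrightarrow> Y \<in> carrier (Q i) \<Longrightarrow> X \<oplus>\<^bsub>Q i\<^esub> Y \<in> carrier (Q i)" for X Y i e
    by (auto elim!: q_cases)
  then show "cop k \<in> bimod_hom B B (V (2 * k)) (VV k)" "cop k \<in> bimod_hom E E (J (2 * k)) (DD k)"
    using cop_res_bimod_hom[of k "2 * k"] by (simp_all add: bimod_hom_def)
qed

text \<open>Both sides send \<open>s(a) t(b)\<close> to \<open>s(a) \<diamond> 1 \<diamond> t(b)\<close>. They pass through different levels \<open>n\<close> and \<open>n'\<close>, because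
  two different tensor products of morphisms are involved.\<close>

lemma coassociativity:
  fixes k n n' :: nat
  assumes n: "2 * k \<le> n" "k \<le> n" and n': "k \<le> n'" "2 * k \<le> n'" and x: "x \<in> carrier E"
  shows "assoc_map B (V k) (VV k) (tensor B (V k) (V k))
      (tensor_map B (VV k) (V k) (\<lambda>X. cop k (res (2 * k) X)) (\<lambda>X. res k X) (psiD n x))
    = tensor_map B (V k) (VV k) (\<lambda>X. res k X) (\<lambda>X. cop k (res (2 * k) X)) (psiD n' x)"
proof (rule env_eqI[OF _ _ _ x])
  have res: "(\<lambda>X. res k X) \<in> left_lin B (V n) (V k)" "(\<lambda>X. res k X) \<in> right_lin B (V n') (V k)"
    using V_res_lin n n' bimod_hom_iff by blast+
  have cop: "(\<lambda>X. cop k (res (2 * k) X)) \<in> right_lin B (V n) (VV k)" "(\<lambda>X. cop k (res (2 * k) X)) \<in> left_lin B (V n') (VV k)"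
    using cop_res_bimod_hom(2) n n' bimod_hom_iff by blast+
  note l = V_acts(2) V_acts(1) VV_acts(2) V_acts(1) cop(1) res(1)
  note r = V_acts(2) V_acts(1) V_acts(2) VV_acts(1) res(2) cop(2)
  note assoc = assoc_map_tensor[OF V_biact[of k] V_biact[of k] V_biact[of k]]
  show "(\<lambda>x. assoc_map B (V k) (VV k) (tensor B (V k) (V k))
      (tensor_map B (VV k) (V k) (\<lambda>X. cop k (res (2 * k) X)) (\<lambda>X. res k X) (psiD n x))) \<in> add_hom E (tensor_group B (V k) (VV k))"
    by (rule add_hom_comp[OF assoc(1) add_hom_comp[OF tensor_map_add_hom[OF l] psiD_add_hom]])
  show "(\<lambda>x. tensor_map B (V k) (VV k) (\<lambda>X. res k X) (\<lambda>X. cop k (res (2 * k) X)) (psiD n' x)) \<in> add_hom E (tensor_group B (V k) (VV k))"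
    by (rule add_hom_comp[OF tensor_map_add_hom[OF r] psiD_add_hom])
  fix a b assume ab: "a \<in> carrier B" "b \<in> carrier B"
  have "assoc_map B (V k) (VV k) (tensor B (V k) (V k))
      (tensor_map B (VV k) (V k) (\<lambda>X. cop k (res (2 * k) X)) (\<lambda>X. res k X) (psiD n (ee a b)))
    = tensor B (V k) (VV k) (q k (s a)) (D.tens k \<one>\<^bsub>E\<^esub> (t b))"
    using ab n assoc(2)[of "q k (s a)" "q k \<one>\<^bsub>E\<^esub>" "q k (t b)"]
    by (simp add: psiD_ee tensor_map_tensor[OF l] cop_q psiD_src)
  also have "\<dots> = tensor_map B (V k) (VV k) (\<lambda>X. res k X) (\<lambda>X. cop k (res (2 * k) X)) (psiD n' (ee a b))"
    using ab n' by (simp add: psiD_ee tensor_map_tensor[OF r] cop_q psiD_tgt)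
  finally show "assoc_map B (V k) (VV k) (tensor B (V k) (V k))
      (tensor_map B (VV k) (V k) (\<lambda>X. cop k (res (2 * k) X)) (\<lambda>X. res k X) (psiD n (ee a b)))
    = tensor_map B (V k) (VV k) (\<lambda>X. res k X) (\<lambda>X. cop k (res (2 * k) X)) (psiD n' (ee a b))" .
qed

text \<open>On \<open>s(a) \<diamond> t(b)\<close> the counit of the left factor is \<open>a\<close>, which acts on \<open>t(b)\<close> through the source.\<close>

lemma counit_left:
  assumes "1 \<le> i" "i \<le> n" "k \<le> n" and x: "x \<in> carrier E"
  shows "tlift (V k) (\<lambda>r X. q k (s r) \<otimes>\<^bsub>Q k\<^esub> X)
    (tensor_map B (regular B) (V k) (\<lambda>X. cou k' (res i X)) (\<lambda>X. res k X) (psiD n x)) = q k x"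
proof (rule env_eqI[OF _ _ _ x])
  have res: "(\<lambda>X. res k X) \<in> left_lin B (V n) (V k)"
    using V_res_lin assms bimod_hom_iff by blast
  have cou: "(\<lambda>X. cou k' (res i X)) \<in> right_lin B (V n) (regular B)"
    using cou_res_bimod_hom assms bimod_hom_iff by blast
  note l = V_acts(2) V_acts(1) regular_B_acts(2) V_acts(1) cou res
  have bal: "balanced B (regular B) (V k) (V k) (\<lambda>r X. q k (s r) \<otimes>\<^bsub>Q k\<^esub> X)"
    by (rule balancedI) (auto simp: src_simps E.l_distr E.r_distr E.m_assoc elim!: q_cases)
  note lift = tensorable.tlift_universal[OF tensorable.intro[OF regular_B_acts(2) V_acts(1)] left_actD(1)[OF V_acts(1)] bal]
  show "(\<lambda>x. tlift (V k) (\<lambda>r X. q k (s r) \<otimes>\<^bsub>Q k\<^esub> X)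
    (tensor_map B (regular B) (V k) (\<lambda>X. cou k' (res i X)) (\<lambda>X. res k X) (psiD n x))) \<in> add_hom E (V k)"
    by (rule add_hom_comp[OF lift(1) add_hom_comp[OF tensor_map_add_hom[OF l] psiD_add_hom]])
  show "q k \<in> add_hom E (V k)"
    by (simp add: add_hom_def)
  show "tlift (V k) (\<lambda>r X. q k (s r) \<otimes>\<^bsub>Q k\<^esub> X)
    (tensor_map B (regular B) (V k) (\<lambda>X. cou k' (res i X)) (\<lambda>X. res k X) (psiD n (ee a b))) = q k (ee a b)"
    if "a \<in> carrier B" "b \<in> carrier B" for a b
    using that assms lift(2)[of a "q k (t b)"]
    unfolding psiD_ee[OF that] by (simp add: tensor_map_tensor[OF l] ee_src_tgt)
qed

lemma counit_right:
  assumes "1 \<le> i" "i \<le> n" "k \<le> n" and x: "x \<in> carrier E"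
  shows "tlift (V k) (\<lambda>X r. q k (t r) \<otimes>\<^bsub>Q k\<^esub> X)
    (tensor_map B (V k) (regular B) (\<lambda>X. res k X) (\<lambda>X. cou k' (res i X)) (psiD n x)) = q k x"
proof (rule env_eqI[OF _ _ _ x])
  have res: "(\<lambda>X. res k X) \<in> right_lin B (V n) (V k)"
    using V_res_lin assms bimod_hom_iff by blast
  have cou: "(\<lambda>X. cou k' (res i X)) \<in> left_lin B (V n) (regular B)"
    using cou_res_bimod_hom assms bimod_hom_iff by blast
  note l = V_acts(2) V_acts(1) V_acts(2) regular_B_acts(1) res cou
  have bal: "balanced B (V k) (regular B) (V k) (\<lambda>X r. q k (t r) \<otimes>\<^bsub>Q k\<^esub> X)"
    by (rule balancedI) (auto simp: tgt_simps E.l_distr E.r_distr E.m_ac elim!: q_cases)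
  note lift = tensorable.tlift_universal[OF tensorable.intro[OF V_acts(2) regular_B_acts(1)] left_actD(1)[OF V_acts(1)] bal]
  show "(\<lambda>x. tlift (V k) (\<lambda>X r. q k (t r) \<otimes>\<^bsub>Q k\<^esub> X)
    (tensor_map B (V k) (regular B) (\<lambda>X. res k X) (\<lambda>X. cou k' (res i X)) (psiD n x))) \<in> add_hom E (V k)"
    by (rule add_hom_comp[OF lift(1) add_hom_comp[OF tensor_map_add_hom[OF l] psiD_add_hom]])
  show "q k \<in> add_hom E (V k)"
    by (simp add: add_hom_def)
  show "tlift (V k) (\<lambda>X r. q k (t r) \<otimes>\<^bsub>Q k\<^esub> X)
    (tensor_map B (V k) (regular B) (\<lambda>X. res k X) (\<lambda>X. cou k' (res i X)) (psiD n (ee a b))) = q k (ee a b)"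
    if "a \<in> carrier B" "b \<in> carrier B" for a b
    using that assms lift(2)[of "q k (s a)" b]
    unfolding psiD_ee[OF that] by (simp add: tensor_map_tensor[OF l] ee_src_tgt E.m_comm)
qed

abbreviation "JV \<equiv> pro_left_view K B (JJ K B)"

lemma pro_object_JV: "pro_object K B B JV"
  by (rule pro_object_natI) (auto simp: V_bimodule V_res_lin elim!: q_cases)

lemma coproduct_compat:
  assumes "k \<le> n" "X \<in> carrier (Q (2 * n))"
  shows "D.transit k (cop n X) = cop k (res (2 * k) X)"
  using assms by (auto simp: cop_q transit_psiD elim!: q_cases)

lemma pro_coring_JV: "pro_coring K B JV (JJ_coproduct K B) (JJ_counit K B)"
  unfolding pro_coring_def Let_def
proof (intro conjI pro_object_JV)
  show "JJ_coproduct K B \<in> pro_mor B B JV (pro_tensor B JV JV)"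
  proof (rule pro_mor_natI)
    show "\<exists>i. fst (JJ_coproduct K B) k \<le> i \<and> fst (JJ_coproduct K B) n \<le> i \<and>
        (\<forall>x\<in>carrier (Obj JV i).
          Map (pro_tensor B JV JV) (n, k) (cop n (Map JV (i, fst (JJ_coproduct K B) n) x)) =
          cop k (Map JV (i, fst (JJ_coproduct K B) k) x))" if "k \<le> n" for k n :: nat
      using that by (intro exI[of _ "2 * n"]) (simp add: coproduct_compat)
  qed (simp_all add: cop_bimod_hom)
  show "JJ_counit K B \<in> pro_mor B B JV (const_pro (Idx JV) (regular B))"
  proof (rule pro_mor_natI)
    fix k n :: nat assume kn: "k \<le> n"
    have "cou n (res (max n 1) X) = cou k (res (max k 1) X)" if "X \<in> carrier (Q (max n 1))" for X
      using that kn by (auto elim!: q_cases)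
    then show "\<exists>i. fst (JJ_counit K B) k \<le> i \<and> fst (JJ_counit K B) n \<le> i \<and>
        (\<forall>x\<in>carrier (Obj JV i).
          Map (const_pro (Idx JV) (regular B)) (n, k) (cou n (Map JV (i, fst (JJ_counit K B) n) x)) =
          cou k (Map JV (i, fst (JJ_counit K B) k) x))"
      using kn by (intro exI[of _ "max n 1"]) simp
  qed (simp_all add: cou_bimod_hom)
  show "pro_eq JV (pro_tensor B JV (pro_tensor B JV JV))
     (pro_comp (pro_assoc B JV) (pro_comp (pro_tensor_mor B JV JV (pro_tensor B JV JV) JV (JJ_coproduct K B) pro_id) (JJ_coproduct K B)))
     (pro_comp (pro_tensor_mor B JV JV JV (pro_tensor B JV JV) pro_id (JJ_coproduct K B)) (JJ_coproduct K B))"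
    (is "pro_eq _ _ ?f ?g")
  proof (rule pro_eq_natI)
    fix k
    let ?i = "common_index (2 * k) k" and ?j = "common_index k (2 * k)"
    have i: "2 * k \<le> ?i" "k \<le> ?i" and j: "k \<le> ?j" "2 * k \<le> ?j"
      by (rule common_arrows_nat)+
    have eq: "assoc_map B (V k) (VV k) (tensor B (V k) (V k))
        (tensor_map B (VV k) (V k) (\<lambda>X. cop k (res (2 * k) X)) (\<lambda>X. res k X) (cop ?i (res (2 * ?i) X)))
      = tensor_map B (V k) (VV k) (\<lambda>X. res k X) (\<lambda>X. cop k (res (2 * k) X)) (cop ?j (res (2 * ?j) X))"
      if "X \<in> carrier (Q (max (2 * ?i) (2 * ?j)))" for X
      using that by (rule q_cases) (simp add: cop_q coassociativity[OF i j])
    show "\<exists>n. fst ?f k \<le> n \<and>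
      fst ?g k \<le> n \<and>
      (\<forall>x\<in>carrier (Obj JV n). snd ?f k (Map JV (n, fst ?f k) x) = snd ?g k (Map JV (n, fst ?g k) x))"
      by (intro exI[of _ "max (2 * ?i) (2 * ?j)"]) (simp add: pro_tensor_mor_nat pro_assoc_def Let_def eq)
  qed simp_all
  show "pro_eq JV JV
     (pro_comp (pro_lunit JV) (pro_comp (pro_tensor_mor B JV JV (const_pro (Idx JV) (regular B)) JV (JJ_counit K B) pro_id) (JJ_coproduct K B)))
     pro_id"
    (is "pro_eq _ _ ?f _")
  proof (rule pro_eq_right)
    fix k X
    let ?n = "common_index (max k 1) k"
    have n: "max k 1 \<le> ?n" "k \<le> ?n" by (rule common_arrows_nat)+
    assume "X \<in> carrier (Obj JV (fst ?f k))"
    then have "X \<in> carrier (Q (2 * ?n))"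
      by (simp add: pro_lunit_def pro_tensor_mor_nat)
    then obtain x where "x \<in> carrier E" "X = q (2 * ?n) x" by (rule q_cases)
    then show "snd ?f k X
      = snd pro_id k (Map JV (fst ?f k, fst pro_id k) X)"
      using n counit_left[OF _ n] by (simp add: pro_lunit_def pro_tensor_mor_nat Let_def cop_q)
  qed (simp_all add: pro_lunit_def pro_tensor_mor_nat, metis common_arrows_nat(3) mult_2 trans_le_add1)
  show "pro_eq JV JV
     (pro_comp (pro_runit JV) (pro_comp (pro_tensor_mor B JV JV JV (const_pro (Idx JV) (regular B)) pro_id (JJ_counit K B)) (JJ_coproduct K B)))
     pro_id"
    (is "pro_eq _ _ ?f _")
  proof (rule pro_eq_right)
    fix k X
    let ?n = "common_index k (max k 1)"
    have n: "max k 1 \<le> ?n" "k \<le> ?n" by (rule common_arrows_nat)+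
    assume "X \<in> carrier (Obj JV (fst ?f k))"
    then have "X \<in> carrier (Q (2 * ?n))"
      by (simp add: pro_runit_def pro_tensor_mor_nat)
    then obtain x where "x \<in> carrier E" "X = q (2 * ?n) x" by (rule q_cases)
    then show "snd ?f k X
      = snd pro_id k (Map JV (fst ?f k, fst pro_id k) X)"
      using n counit_right[OF _ n] by (simp add: pro_runit_def pro_tensor_mor_nat Let_def cop_q)
  qed (simp_all add: pro_runit_def pro_tensor_mor_nat, metis common_arrows_nat(2) mult_2 trans_le_add1)
qed

end

section \<open>The pro-bialgebroid\<close>

context quotient_tensor
begin

text \<open>The product along \<open>S\<close> factors through the tensor product over the enveloping algebra.\<close>

lemma to_EE:
  fixes k :: nat
  assumes gh: "\<And>r. r \<in> carrier S \<Longrightarrow> g r = h r"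
  defines "f \<equiv> tlift (EE.TG k) (tensor E (J k) (J k))"
  shows "f \<in> add_hom (TG k) (EE.TG k)"
    and "x \<in> carrier E \<Longrightarrow> y \<in> carrier E \<Longrightarrow> f (tens k x y) = EE.tens k x y"
proof -
  have bal: "balanced S (L k) (R k) (EE.TG k) (tensor E (J k) (J k))"
  proof (rule balancedI)
    fix u r v assume "u \<in> carrier (L k)" "r \<in> carrier S" "v \<in> carrier (R k)"
    then obtain x y where "x \<in> carrier E" "u = q k x" "y \<in> carrier E" "v = q k y"
      by (auto simp: L R elim!: q_cases)
    then show "tensor E (J k) (J k) (rsmult (L k) u r) v = tensor E (J k) (J k) u (r \<odot>\<^bsub>R k\<^esub> v)"
      using \<open>r \<in> carrier S\<close> g[of r] EE.tens_balanced[of x y "g r" k] by (simp add: L_act R_act gh)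
  qed (auto simp: L R EE.tens_add_left EE.tens_add_right elim!: q_cases)
  note lift = tensorable.tlift_universal[OF tensorable_TT EE.abelian_TT bal, folded f_def]
  show "f \<in> add_hom (TG k) (EE.TG k)" by (rule lift(1))
  show "x \<in> carrier E \<Longrightarrow> y \<in> carrier E \<Longrightarrow> f (tens k x y) = EE.tens k x y"
    by (rule lift(2)) (simp_all add: L R)
qed

lemma mult_along:
  assumes gh: "\<And>r. r \<in> carrier S \<Longrightarrow> g r = h r"
  shows "snd (mult_along E (JJ K B) (JJ_mult K B)) k \<in> add_hom (TG k) (Q k)"
    and "x \<in> carrier E \<Longrightarrow> y \<in> carrier E \<Longrightarrow>
      snd (mult_along E (JJ K B) (JJ_mult K B)) k (tens k x y) = q k (x \<otimes>\<^bsub>E\<^esub> y)"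
proof -
  have eq: "snd (mult_along E (JJ K B) (JJ_mult K B)) k
      = (\<lambda>X. m k (tlift (EE.TG k) (tensor E (J k) (J k)) X))"
    by (rule ext) (simp add: mult_along_def)
  show "snd (mult_along E (JJ K B) (JJ_mult K B)) k \<in> add_hom (TG k) (Q k)"
    unfolding eq by (rule add_hom_comp[OF m_add_hom to_EE(1)[OF gh]])
  show "x \<in> carrier E \<Longrightarrow> y \<in> carrier E \<Longrightarrow>
      snd (mult_along E (JJ K B) (JJ_mult K B)) k (tens k x y) = q k (x \<otimes>\<^bsub>E\<^esub> y)"
    unfolding eq by (simp add: to_EE(2)[OF gh])
qed

end

lemma fst_mult_along [simp]: "fst (mult_along A L p) k = fst p k"
  by (simp add: mult_along_def)

context pair_algebra
begin

lemma DD_acts [simp]: "left_act E (DD k)" "right_act E (DD k)"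
  using DD_biact biactD by blast+

abbreviation "JT \<equiv> pro_takeuchi K B (JJ K B) (JJ K B)"

lemma D_transit_self:
  "X \<in> carrier (D.TG n) \<Longrightarrow> D.transit n X = X"
  by (rule tensor_map_id) simp_all

lemma coproduct_takeuchi: "JJ_coproduct K B \<in> pro_mor E E (JJ K B) JT"
proof (rule pro_mor_natI)
  show "\<exists>i. fst (JJ_coproduct K B) k \<le> i \<and> fst (JJ_coproduct K B) n \<le> i \<and>
      (\<forall>x\<in>carrier (Obj (JJ K B) i).
        Map JT (n, k) (cop n (Map (JJ K B) (i, fst (JJ_coproduct K B) n) x)) =
        cop k (Map (JJ K B) (i, fst (JJ_coproduct K B) k) x))" if "k \<le> n" for k n :: nat
    using that by (intro exI[of _ "2 * n"]) (simp add: coproduct_compat)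
qed (simp_all add: cop_bimod_hom takeuchi_eq_dia)

text \<open>As the Takeuchi product is everything, its factorwise product is the product of \<open>J \<diamond> J\<close>.\<close>

lemma takeuchi_product:
  assumes X: "X \<in> carrier (D.TG k)" and Y: "Y \<in> carrier (D.TG k)"
  shows "tlift (D.TG k) (\<lambda>p' q'. tlift (D.TG k) (\<lambda>p q.
      tensor B (V k) (V k) (m k (tensor E (J k) (J k) p p')) (m k (tensor E (J k) (J k) q q'))) X) Y
    = X \<otimes>\<^bsub>D.TT k\<^esub> Y"
proof -
  interpret T: cring "D.TT k" by (rule D.cring_TT)
  let ?G = "D.TG k"
  define f where "f = (\<lambda>p' q' p q. tensor B (V k) (V k) (m k (tensor E (J k) (J k) p p')) (m k (tensor E (J k) (J k) q q')))"
  have f_q: "f (q k x') (q k y') (q k x) (q k y) = D.tens k (x \<otimes>\<^bsub>E\<^esub> x') (y \<otimes>\<^bsub>E\<^esub> y')"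
    if "x \<in> carrier E" "y \<in> carrier E" "x' \<in> carrier E" "y' \<in> carrier E" for x y x' y'
    using that by (simp add: f_def)
  have bal: "balanced B (V k) (V k) ?G (f p' q')" "balanced B (V k) (V k) ?G (\<lambda>p q. f p q p' q')"
    if pq: "p' \<in> carrier (V k)" "q' \<in> carrier (V k)" for p' q'
  proof -
    obtain x' y' where x': "x' \<in> carrier E" "p' = q k x'" and y': "y' \<in> carrier E" "q' = q k y'"
      using pq by (auto elim!: q_cases)
    show "balanced B (V k) (V k) ?G (f p' q')"
    proof (rule balancedI)
      fix u b v assume "u \<in> carrier (V k)" and b: "b \<in> carrier B" and "v \<in> carrier (V k)"
      then obtain x y where x: "x \<in> carrier E" "u = q k x" and y: "y \<in> carrier E" "v = q k y"
        by (auto elim!: q_cases)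
      show "f p' q' (rsmult (V k) u b) v = f p' q' u (b \<odot>\<^bsub>V k\<^esub> v)"
        using x y b x' y' D.tens_balanced[of "x \<otimes>\<^bsub>E\<^esub> x'" "y \<otimes>\<^bsub>E\<^esub> y'" b k] by (simp add: f_q E.m_assoc)
    qed (use x' y' in \<open>auto simp: f_q E.l_distr D.tens_add_left D.tens_add_right elim!: q_cases\<close>)
    show "balanced B (V k) (V k) ?G (\<lambda>p q. f p q p' q')"
    proof (rule balancedI)
      fix u b v assume "u \<in> carrier (V k)" and b: "b \<in> carrier B" and "v \<in> carrier (V k)"
      then obtain x y where x: "x \<in> carrier E" "u = q k x" and y: "y \<in> carrier E" "v = q k y"
        by (auto elim!: q_cases)
      show "f (rsmult (V k) u b) v p' q' = f u (b \<odot>\<^bsub>V k\<^esub> v) p' q'"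
        using x y b x' y' D.tens_balanced[of "x' \<otimes>\<^bsub>E\<^esub> x" "y' \<otimes>\<^bsub>E\<^esub> y" b k] by (simp add: f_q E.m_lcomm)
    qed (use x' y' in \<open>auto simp: f_q E.r_distr D.tens_add_left D.tens_add_right elim!: q_cases\<close>)
  qed
  define h where "h = (\<lambda>Y X. tlift ?G (\<lambda>p' q'. tlift ?G (f p' q') X) Y)"
  note tt = tlift_tlift[OF D.L_right_act D.R_left_act D.L_right_act D.R_left_act D.abelian_TT bal]
  have h_left: "X \<in> carrier ?G \<Longrightarrow> (\<lambda>Y. h Y X) \<in> add_hom ?G ?G" for X
    unfolding h_def by (rule tt(1))
  have h_right: "Y \<in> carrier ?G \<Longrightarrow> h Y \<in> add_hom ?G ?G" for Y
    unfolding h_def by (rule tt(2))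
  have h_pure: "h (D.tens k x' y') (D.tens k x y) = D.tens k (x \<otimes>\<^bsub>E\<^esub> x') (y \<otimes>\<^bsub>E\<^esub> y')"
    if "x \<in> carrier E" "y \<in> carrier E" "x' \<in> carrier E" "y' \<in> carrier E" for x y x' y'
    unfolding h_def using that tt(3)[of "q k x'" "q k y'" "q k x" "q k y"] by (simp add: f_q)
  have "h Y X = X \<otimes>\<^bsub>D.TT k\<^esub> Y"
    using X
  proof (induction rule: D.TT_induct)
    case (pure x y)
    from Y show ?case
    proof (induction rule: D.TT_induct)
      case (pure x' y')
      then show ?case using \<open>x \<in> carrier E\<close> \<open>y \<in> carrier E\<close> by (simp add: h_pure D.tens_mult)
    next
      case (add Y Y')
      then show ?case
        using pure T.r_distr[of Y Y' "D.tens k x y"] by (simp add: add_hom_add[OF h_left])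
    qed
  next
    case (add X X')
    then show ?case
      using Y T.l_distr[of X X' Y] by (simp add: add_hom_add[OF h_right])
  qed
  then show ?thesis by (simp add: h_def f_def)
qed

text \<open>The product of \<open>J \<diamond> J\<close> is balanced over the enveloping algebra because the latter acts through the ring
  homomorphism \<open>psiD\<close> on either side.\<close>

lemma takeuchi_mult_DD:
  shows "snd (takeuchi_mult K B (JJ K B) (JJ_mult K B)) k \<in> add_hom (tensor_group E (DD k) (DD k)) (D.TG k)"
    and "X \<in> carrier (D.TG k) \<Longrightarrow> Y \<in> carrier (D.TG k) \<Longrightarrow>
      snd (takeuchi_mult K B (JJ K B) (JJ_mult K B)) k (tensor E (DD k) (DD k) X Y) = X \<otimes>\<^bsub>D.TT k\<^esub> Y"
proof -
  interpret T: cring "D.TT k" by (rule D.cring_TT)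
  let ?G = "D.TG k"
  have c: "X \<otimes>\<^bsub>D.TT k\<^esub> Y \<in> carrier ?G" if "X \<in> carrier ?G" "Y \<in> carrier ?G" for X Y
    using that T.m_closed[of X Y] by simp
  have "balanced E (DD k) (DD k) ?G (\<lambda>X Y. X \<otimes>\<^bsub>D.TT k\<^esub> Y)"
  proof (rule balancedI)
    show "(X \<oplus>\<^bsub>DD k\<^esub> X') \<otimes>\<^bsub>D.TT k\<^esub> Y = X \<otimes>\<^bsub>D.TT k\<^esub> Y \<oplus>\<^bsub>?G\<^esub> X' \<otimes>\<^bsub>D.TT k\<^esub> Y"
      if "X \<in> carrier (DD k)" "X' \<in> carrier (DD k)" "Y \<in> carrier (DD k)" for X X' Y
      using that T.l_distr[of X X' Y] by simp
    show "X \<otimes>\<^bsub>D.TT k\<^esub> (Y \<oplus>\<^bsub>DD k\<^esub> Y') = X \<otimes>\<^bsub>D.TT k\<^esub> Y \<oplus>\<^bsub>?G\<^esub> X \<otimes>\<^bsub>D.TT k\<^esub> Y'"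
      if "X \<in> carrier (DD k)" "Y \<in> carrier (DD k)" "Y' \<in> carrier (DD k)" for X Y Y'
      using that T.r_distr[of Y Y' X] by simp
    show "rsmult (DD k) X e \<otimes>\<^bsub>D.TT k\<^esub> Y = X \<otimes>\<^bsub>D.TT k\<^esub> (e \<odot>\<^bsub>DD k\<^esub> Y)"
      if "X \<in> carrier (DD k)" "e \<in> carrier E" "Y \<in> carrier (DD k)" for X e Y
      using that T.m_lcomm[of X "psiD k e" Y] T.m_assoc[of "psiD k e" X Y] by (simp add: dia_smult)
  qed (simp_all add: c)
  then have "balanced E (DD k) (DD k) ?G (\<lambda>X Y. tlift ?G (\<lambda>p' q'. tlift ?G (\<lambda>p q.
      tensor B (V k) (V k) (m k (tensor E (J k) (J k) p p')) (m k (tensor E (J k) (J k) q q'))) X) Y)"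
    by (rule balanced_cong) (simp_all add: takeuchi_product)
  note lift = tensorable.tlift_universal[OF tensorable.intro[OF DD_acts(2,1)] D.abelian_TT this]
  show "snd (takeuchi_mult K B (JJ K B) (JJ_mult K B)) k \<in> add_hom (tensor_group E (DD k) (DD k)) ?G"
    using lift(1) by (simp add: takeuchi_mult_def Let_def)
  show "snd (takeuchi_mult K B (JJ K B) (JJ_mult K B)) k (tensor E (DD k) (DD k) X Y) = X \<otimes>\<^bsub>D.TT k\<^esub> Y"
    if "X \<in> carrier ?G" "Y \<in> carrier ?G"
    using lift(2)[of X Y] that by (simp add: takeuchi_mult_def Let_def takeuchi_product)
qed

lemma fst_takeuchi_mult [simp]: "fst (takeuchi_mult K B L p) = fst p"
  by (simp add: takeuchi_mult_def)

text \<open>On pure tensors this is \<open>psiD k (x y) = psiD k x \<cdot> psiD k y\<close>.\<close>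

lemma coproduct_multiplicative:
  assumes n: "2 * k \<le> n" and X: "X \<in> carrier (EE.TG n)"
  shows "cop k (m (2 * k) (EE.transit (2 * k) X)) = snd (takeuchi_mult K B (JJ K B) (JJ_mult K B)) k
    (tensor_map E (DD k) (DD k) (\<lambda>X. cop k (res (2 * k) X)) (\<lambda>X. cop k (res (2 * k) X)) X)"
proof -
  have lin: "(\<lambda>X. cop k (res (2 * k) X)) \<in> right_lin E (J n) (DD k)" "(\<lambda>X. cop k (res (2 * k) X)) \<in> left_lin E (J n) (DD k)"
    using cop_res_bimod_hom(1)[OF n] bimod_hom_iff by blast+
  have cop: "cop k \<in> add_hom (Q (2 * k)) (D.TG k)"
    using cop_bimod_hom(2)[of k] by (simp add: bimod_hom_def add_hom_def)
  note l = J_acts(2,1) DD_acts(2,1) lin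
  show ?thesis
    by (rule EE.TT_eqI[OF add_hom_comp[OF cop add_hom_comp[OF m_add_hom EE.transit_add_hom[OF n]]]
          add_hom_comp[OF takeuchi_mult_DD(1) tensor_map_add_hom[OF l]] _ X])
      (use n in \<open>simp add: EE.transit_tens cop_q tensor_map_tensor[OF l] takeuchi_mult_DD(2) ring_hom_mult[OF psiD_hom]\<close>)
qed

abbreviation "RK k \<equiv> restr (\<lambda>x. x) (scal K B) (J k)"
abbreviation "LK k \<equiv> restr (scal K B) (\<lambda>x. x) (J k)"

text \<open>On pure tensors: \<open>\<epsilon>(x u(\<epsilon>(y))) = \<epsilon>(x) \<epsilon>(y) = \<epsilon>(x y)\<close>, since \<open>\<epsilon>\<close> is a ring homomorphism
  and \<open>\<epsilon>(u(b)) = b\<close>.\<close>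

lemma counit_multiplicative:
  assumes i: "1 \<le> i" "i \<le> n" "j \<le> n" "1 \<le> j" and X: "X \<in> carrier (KK.TG n)"
    and u: "u = s \<or> u = t"
  shows "cou k (snd (mult_along E (JJ K B) (JJ_mult K B)) i
      (tensor_map K (RK i) (LK i) (\<lambda>X. res i X) (\<lambda>X. q i (u (cou k' (res j X)))) X))
    = cou k (snd (mult_along E (JJ K B) (JJ_mult K B)) i (KK.transit i X))"
proof -
  have u_hom: "u \<in> ring_hom B E" using u src_hom tgt_hom by auto
  have u_scal: "u (c \<odot>\<^bsub>B\<^esub> \<one>\<^bsub>B\<^esub>) = scal K B c" if "c \<in> carrier K" for c
    using u scal_eq[OF that] by auto
  have counit_u: "pair_counit K B (u b) = b" if "b \<in> carrier B" for b
    using u that by auto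
  have scal_counit: "pair_counit K B (scal K B c) = c \<odot>\<^bsub>B\<^esub> \<one>\<^bsub>B\<^esub>" if "c \<in> carrier K" for c
    using that by (simp add: scal_eq(1))
  note u_cl [simp] = ring_hom_closed[OF u_hom]
  have lin: "(\<lambda>X. q i (u (cou k' (res j X)))) \<in> left_lin K (LK n) (LK i)"
  proof (rule left_linI, rule add_homI)
    fix c Y assume c: "c \<in> carrier K" and "Y \<in> carrier (LK n)"
    then obtain y where y: "y \<in> carrier E" "Y = q n y" by (auto elim!: q_cases)
    have "u (pair_counit K B (scal K B c \<otimes>\<^bsub>E\<^esub> y)) = scal K B c \<otimes>\<^bsub>E\<^esub> u (pair_counit K B y)"
      using c y by (simp add: ring_hom_mult[OF counit_hom] scal_counit ring_hom_mult[OF u_hom] u_scal)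
    then show "q i (u (cou k' (res j (c \<odot>\<^bsub>LK n\<^esub> Y)))) = c \<odot>\<^bsub>LK i\<^esub> q i (u (cou k' (res j Y)))"
      using c y i by simp
  qed (use i in \<open>auto simp: ring_hom_add[OF counit_hom] ring_hom_add[OF u_hom] elim!: q_cases\<close>)
  note l = KK.L_right_act KK.R_left_act KK.L_right_act KK.R_left_act KK.res_right_lin[OF i(2)] lin
  have cou: "cou k \<in> add_hom (Q i) B"
    using cou_bimod_hom[OF i(1), of k] by (simp add: bimod_hom_def add_hom_def)
  show ?thesis
    by (rule KK.TT_eqI[OF add_hom_comp[OF cou add_hom_comp[OF KK.mult_along(1) tensor_map_add_hom[OF l]]]
          add_hom_comp[OF cou add_hom_comp[OF KK.mult_along(1) KK.transit_add_hom[OF i(2)]]] _ X])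
      (use i in \<open>simp_all add: tensor_map_tensor[OF l] KK.mult_along(2) KK.transit_tens ring_hom_mult[OF counit_hom] counit_u\<close>)
qed

lemma KK_transit_self:
  "X \<in> carrier (KK.TG n) \<Longrightarrow> KK.transit n X = X"
  by (rule tensor_map_id[OF KK.L_right_act KK.R_left_act]) simp_all

lemma pro_left_bialgebroid_JJ:
  "pro_left_bialgebroid K B (JJ K B) (JJ_mult K B) (JJ_unit K B) (JJ_coproduct K B) (JJ_counit K B)"
  unfolding pro_left_bialgebroid_def Let_def
proof (intro conjI k_algebra_B pro_ring_JJ pro_coring_JV coproduct_takeuchi)
  show "pro_eq (pro_tensor E (JJ K B) (JJ K B)) JT (pro_comp (JJ_coproduct K B) (JJ_mult K B))
     (pro_comp (takeuchi_mult K B (JJ K B) (JJ_mult K B)) (pro_tensor_mor E (JJ K B) (JJ K B) JT JT (JJ_coproduct K B) (JJ_coproduct K B)))"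
    by (rule pro_eq_left)
      (simp_all add: transit_self pro_tensor_mor_nat Let_def common_arrows_nat takeuchi_eq_dia
        coproduct_multiplicative[OF self_index])
  let ?s = "pro_comp (JJ_unit K B) (pro_level (\<lambda>k. s))" and ?t = "pro_comp (JJ_unit K B) (pro_level (\<lambda>k. t))"
  let ?em = "pro_comp (JJ_counit K B) (mult_along E (JJ K B) (JJ_mult K B))"
  let ?R = "pro_restr (\<lambda>x. x) (scal K B) (JJ K B)" and ?L = "pro_restr (scal K B) (\<lambda>x. x) (JJ K B)"
  let ?p = "\<lambda>u. pro_comp ?em (pro_tensor_mor K ?R ?L ?R ?L pro_id (pro_comp (pro_comp (JJ_unit K B) (pro_level (\<lambda>k. u))) (JJ_counit K B)))"
  have fst_em: "fst ?em k = max k 1" for k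
    by simp
  have snd_em: "snd ?em k X = cou k (snd (mult_along E (JJ K B) (JJ_mult K B)) (max k 1) X)" for k X
    by simp
  have fst_p: "fst (?p u) k = common_index (max k 1) (max k 1)" for u k
    by (simp add: pro_tensor_mor_nat JJ_unit_def)
  have snd_p: "snd (?p u) k X = cou k (snd (mult_along E (JJ K B) (JJ_mult K B)) (max k 1)
      (KK.transit (max k 1) X))"
    if "X \<in> carrier (KK.TG (common_index (max k 1) (max k 1)))"
      "u = s \<or> u = t" for u k X
    using that common_arrows_nat(2)[of "max k 1" "max k 1"]
      counit_multiplicative[of "max k 1" "common_index (max k 1) (max k 1)" "max k 1" X u k]
    by (simp add: pro_tensor_mor_nat JJ_unit_def Let_def)
  show "pro_eq (pro_tensor_along K (scal K B) (JJ K B)) (const_pro (Idx (JJ K B)) (regular B)) ?em (?p s)"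
  proof (rule pro_eq_left)
    show "fst ?em k \<le> fst (?p s) k" for k
      unfolding fst_p fst_em by (rule self_index)
    fix k X assume "X \<in> carrier (Obj (pro_tensor_along K (scal K B) (JJ K B)) (fst (?p s) k))"
    then have X: "X \<in> carrier (KK.TG (common_index (max k 1) (max k 1)))"
      unfolding fst_p by (simp add: pro_tensor_along_def)
    show "snd ?em k (Map (pro_tensor_along K (scal K B) (JJ K B)) (fst (?p s) k, fst ?em k) X) = snd (?p s) k X"
      unfolding fst_p fst_em snd_em snd_p[OF X disjI1[OF refl]] by (simp add: pro_tensor_along_def)
  qed (simp_all add: pro_tensor_along_def KK_transit_self)
  show "pro_eq (pro_tensor_along K (scal K B) (JJ K B)) (const_pro (Idx (JJ K B)) (regular B)) (?p s) (?p t)"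
  proof (rule pro_eq_left)
    show "fst (?p s) k \<le> fst (?p t) k" for k
      unfolding fst_p ..
    fix k X assume X': "X \<in> carrier (Obj (pro_tensor_along K (scal K B) (JJ K B)) (fst (?p t) k))"
    then have X: "X \<in> carrier (KK.TG (common_index (max k 1) (max k 1)))"
      unfolding fst_p by (simp add: pro_tensor_along_def)
    have "Map (pro_tensor_along K (scal K B) (JJ K B)) (fst (?p t) k, fst (?p s) k) X = X"
      unfolding fst_p using X by (simp add: pro_tensor_along_def KK_transit_self)
    then show "snd (?p s) k (Map (pro_tensor_along K (scal K B) (JJ K B)) (fst (?p t) k, fst (?p s) k) X) = snd (?p t) k X"
      by (simp only: snd_p[OF X] simp_thms)
  qed (simp_all add: pro_tensor_along_def KK_transit_self)
qed

end

section \<open>The two Hopf maps on a common footing\<close>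

text \<open>The two Hopf maps are mirror images of each other: \<open>flip\<close> exchanges source and target and the
  factors of \<open>J \<diamond> J\<close>. In terms of the map \<open>c\<close> along which the domain is formed and the other one, \<open>d\<close>,
  both are \<open>d(a) c(b) \<otimes> y \<mapsto> d(a) \<diamond> c(b) y\<close>, with the factors exchanged on the right hand side in one case.\<close>

locale hopf_side = pair_algebra K B
  for K :: "('k, 'x) ring_scheme" and B :: "('k, 'b, 'y) module_scheme" +
  fixes S :: "('b, 'z) ring_scheme" and c d :: "'b \<Rightarrow> ('b, 'b) tens" and flip :: bool
  assumes carrier_S: "carrier S = carrier B"
    and c: "c = (if flip then src K B else tgt K B)" and d: "d = (if flip then tgt K B else src K B)"
begin

lemma d_hom: "d \<in> ring_hom B E"
  by (simp add: d src_hom tgt_hom)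

lemma cd_closed [simp]: "a \<in> carrier B \<Longrightarrow> c a \<in> carrier E" "a \<in> carrier B \<Longrightarrow> d a \<in> carrier E"
  by (simp_all add: c d)

lemma cd_scal: "k \<in> carrier K \<Longrightarrow> c (k \<odot>\<^bsub>B\<^esub> \<one>\<^bsub>B\<^esub>) = d (k \<odot>\<^bsub>B\<^esub> \<one>\<^bsub>B\<^esub>)"
  by (simp add: c d scal_unit)

lemma cd_mu: "a \<in> carrier B \<Longrightarrow> c a \<ominus>\<^bsub>E\<^esub> d a \<in> mu 1" "a \<in> carrier B \<Longrightarrow> d a \<ominus>\<^bsub>E\<^esub> c a \<in> mu 1"
  by (simp_all only: c d src_tgt_mu tgt_src_mu split: if_splits) simp_all

abbreviation "CR k \<equiv> restr (\<lambda>x. x) c (J k)"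
abbreviation "CF k \<equiv> restr c (\<lambda>x. x) (J k)"

sublocale quotient_tensor K B S c c CR CF
  by unfold_locales (simp_all add: E.m_comm carrier_S)

lemma CR_biact: "biact E S (CR k)"
  by (rule restr_biact[OF J_biact]) (simp_all add: carrier_S)

abbreviation "WW k \<equiv> left_view K B (tensor_bimod S (CR k) (CF k))"

text \<open>The left action on the domain of a Hopf map is multiplication in the commutative ring that it forms, so
  linearity can be checked by ring computations.\<close>

lemma left_mult:
  assumes e: "e \<in> carrier E" and X: "X \<in> carrier (TG k)"
  shows "e \<odot>\<^bsub>tensor_bimod S (CR k) (CF k)\<^esub> X = tens k e \<one>\<^bsub>E\<^esub> \<otimes>\<^bsub>TT k\<^esub> X"
  using X
proof (induction rule: TT_induct)
  case (pure x y)
  then show ?case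
    using e tensor_bimod_smult[OF CR_biact R_left_act, where r = e and p = "q k x" and q = "q k y"]
    by (simp add: tens_mult)
next
  case (add X Y)
  interpret T: cring "TT k" by (rule cring_TT)
  show ?case
    using add e left_actD(3)[OF tensor_bimod_left_act[OF CR_biact R_left_act], where r = e and x = X and y = Y]
      T.r_distr[of X Y "tens k e \<one>\<^bsub>E\<^esub>"] by simp
qed

lemma WW_biact: "biact B B (WW k)"
proof (rule left_view_biact[OF tensor_bimod_left_act[OF CR_biact R_left_act]])
  interpret T: cring "TT k" by (rule cring_TT)
  fix e e' X assume *: "e \<in> carrier E" "e' \<in> carrier E" "X \<in> carrier (tensor_bimod S (CR k) (CF k))"
  then have "tens k e' \<one>\<^bsub>E\<^esub> \<otimes>\<^bsub>TT k\<^esub> X \<in> carrier (TG k)"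
    "tens k e \<one>\<^bsub>E\<^esub> \<otimes>\<^bsub>TT k\<^esub> X \<in> carrier (TG k)"
    using T.m_closed[of _ X] by simp_all
  with * show "e \<odot>\<^bsub>tensor_bimod S (CR k) (CF k)\<^esub> (e' \<odot>\<^bsub>tensor_bimod S (CR k) (CF k)\<^esub> X) =
       e' \<odot>\<^bsub>tensor_bimod S (CR k) (CF k)\<^esub> (e \<odot>\<^bsub>tensor_bimod S (CR k) (CF k)\<^esub> X)"
    by (simp add: left_mult T.m_lcomm)
qed

lemma WW_acts [simp]: "left_act B (WW k)" "right_act B (WW k)"
  using WW_biact biactD by blast+

lemma mult_along_transit:
  assumes "k \<le> n"
  shows "(\<lambda>X. snd (mult_along E (JJ K B) (JJ_mult K B)) k (transit k X)) \<in> bimod_hom B B (WW n) (V k)"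
proof -
  let ?f = "\<lambda>X. snd (mult_along E (JJ K B) (JJ_mult K B)) k (transit k X)"
  have hom: "?f \<in> add_hom (WW n) (V k)"
    using add_hom_comp[OF mult_along(1) transit_add_hom[OF assms]] by (simp add: add_hom_def)
  have pure: "?f (tens n e \<one>\<^bsub>E\<^esub> \<otimes>\<^bsub>TT n\<^esub> tens n x y) = q k e \<otimes>\<^bsub>Q k\<^esub> ?f (tens n x y)"
    if "e \<in> carrier E" "x \<in> carrier E" "y \<in> carrier E" for e x y
    using that by (simp add: tens_mult transit_tens[OF assms] mult_along(2) E.m_assoc)
  show ?thesis
    unfolding bimod_hom_iff
  proof
    show "?f \<in> left_lin B (WW n) (V k)"
      by (rule left_lin_tensorI[OF hom L_right_act R_left_act])
        (auto simp: left_mult pure elim!: q_cases)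
    show "?f \<in> right_lin B (WW n) (V k)"
      by (rule right_lin_tensorI[OF hom L_right_act R_left_act])
        (auto simp: left_mult pure elim!: q_cases)
  qed
qed

lemma C_transit_self: "X \<in> carrier (TG n) \<Longrightarrow> transit n X = X"
  by (rule tensor_map_id[OF L_right_act R_left_act]) simp_all

text \<open>The homomorphism with \<open>\<psi>(d(b)) = d(b) \<otimes> 1\<close> and \<open>\<psi>(c(b)) = 1 \<otimes> d(b)\<close>: since \<open>c(b) \<diamond> y = 1 \<diamond> d(b) y\<close>, this is
  how the inverse of \<open>d(a) c(b) \<otimes> y \<mapsto> d(a) \<diamond> c(b) y\<close> has to act on the first factor.\<close>

definition psi :: "nat \<Rightarrow> _" where
  "psi k = env_lift (TT k)
     (\<lambda>a. if flip then tens k \<one>\<^bsub>E\<^esub> (d a) else tens k (d a) \<one>\<^bsub>E\<^esub>)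
     (\<lambda>b. if flip then tens k (d b) \<one>\<^bsub>E\<^esub> else tens k \<one>\<^bsub>E\<^esub> (d b))"

lemma tens_c: "b \<in> carrier B \<Longrightarrow> tens k (c b) \<one>\<^bsub>E\<^esub> = tens k \<one>\<^bsub>E\<^esub> (c b)"
  using tens_balanced[of "\<one>\<^bsub>E\<^esub>" "\<one>\<^bsub>E\<^esub>" b k] by (simp add: carrier_S)

lemma psi:
  shows psi_hom: "psi k \<in> ring_hom E (TT k)"
    and psi_c: "b \<in> carrier B \<Longrightarrow> psi k (c b) = tens k \<one>\<^bsub>E\<^esub> (d b)"
    and psi_d: "b \<in> carrier B \<Longrightarrow> psi k (d b) = tens k (d b) \<one>\<^bsub>E\<^esub>"
proof -
  note l = ring_hom_trans[OF d_hom tens_left_hom, unfolded comp_def]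
    and r = ring_hom_trans[OF d_hom tens_right_hom, unfolded comp_def]
  have bal: "tens k (d (a \<odot>\<^bsub>B\<^esub> \<one>\<^bsub>B\<^esub>)) \<one>\<^bsub>E\<^esub> = tens k \<one>\<^bsub>E\<^esub> (d (a \<odot>\<^bsub>B\<^esub> \<one>\<^bsub>B\<^esub>))" if "a \<in> carrier K" for a
    using tens_c[of "a \<odot>\<^bsub>B\<^esub> \<one>\<^bsub>B\<^esub>"] that by (simp add: cd_scal)
  note * = env_lift[OF cring_TT r l bal[symmetric]] env_lift[OF cring_TT l r bal]
  show "psi k \<in> ring_hom E (TT k)"
    unfolding psi_def using *(1,5) by (cases flip) simp_all
  show "b \<in> carrier B \<Longrightarrow> psi k (c b) = tens k \<one>\<^bsub>E\<^esub> (d b)" "b \<in> carrier B \<Longrightarrow> psi k (d b) = tens k (d b) \<one>\<^bsub>E\<^esub>"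
    unfolding psi_def using *(3,4,7,8) by (cases flip; simp add: c d)+
qed

lemma psi_closed [simp]: "x \<in> carrier E \<Longrightarrow> psi k x \<in> carrier (TG k)"
  using ring_hom_closed[OF psi_hom, of x k] by simp

text \<open>As for the coproduct, except that the element that moves across the tensor sign is \<open>c(a)\<close>.\<close>

lemma psi_vanish:
  assumes "z \<in> mu (2 * k)"
  shows "psi k z = \<zero>\<^bsub>TT k\<^esub>"
proof (rule vanish_mu_double[OF cring_TT tens_left_hom tens_right_hom psi_hom tens_left_vanish tens_right_vanish _ assms])
  interpret T: cring "TT k" by (rule cring_TT)
  fix a assume a: "a \<in> carrier B"
  have left: "tens k x \<one>\<^bsub>E\<^esub> = tens k (x \<ominus>\<^bsub>E\<^esub> y) \<one>\<^bsub>E\<^esub> \<oplus>\<^bsub>TT k\<^esub> tens k y \<one>\<^bsub>E\<^esub>"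
    and right: "tens k \<one>\<^bsub>E\<^esub> x = tens k \<one>\<^bsub>E\<^esub> (x \<ominus>\<^bsub>E\<^esub> y) \<oplus>\<^bsub>TT k\<^esub> tens k \<one>\<^bsub>E\<^esub> y"
    if "x \<in> carrier E" "y \<in> carrier E" for x y
    using that tens_add_left[of "x \<ominus>\<^bsub>E\<^esub> y" y "\<one>\<^bsub>E\<^esub>" k] tens_add_right[of "\<one>\<^bsub>E\<^esub>" "x \<ominus>\<^bsub>E\<^esub> y" y k]
    by (simp_all add: diff_add)
  have d: "psi k (d a) = tens k (d a \<ominus>\<^bsub>E\<^esub> c a) \<one>\<^bsub>E\<^esub> \<oplus>\<^bsub>TT k\<^esub> tens k \<one>\<^bsub>E\<^esub> (c a \<ominus>\<^bsub>E\<^esub> d a) \<oplus>\<^bsub>TT k\<^esub> psi k (c a)"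
    using a left[of "d a" "c a"] right[of "c a" "d a"]
      T.a_assoc[of "tens k (d a \<ominus>\<^bsub>E\<^esub> c a) \<one>\<^bsub>E\<^esub>" "tens k \<one>\<^bsub>E\<^esub> (c a \<ominus>\<^bsub>E\<^esub> d a)" "tens k \<one>\<^bsub>E\<^esub> (d a)"]
    by (simp add: psi_c psi_d tens_c)
  have c: "psi k (c a) = tens k (c a \<ominus>\<^bsub>E\<^esub> d a) \<one>\<^bsub>E\<^esub> \<oplus>\<^bsub>TT k\<^esub> tens k \<one>\<^bsub>E\<^esub> (d a \<ominus>\<^bsub>E\<^esub> c a) \<oplus>\<^bsub>TT k\<^esub> psi k (d a)"
    using a right[of "d a" "c a"] left[of "c a" "d a"]
      T.a_comm[of "tens k (c a \<ominus>\<^bsub>E\<^esub> d a) \<one>\<^bsub>E\<^esub>" "tens k \<one>\<^bsub>E\<^esub> (d a \<ominus>\<^bsub>E\<^esub> c a)"]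
      T.a_assoc[of "tens k \<one>\<^bsub>E\<^esub> (d a \<ominus>\<^bsub>E\<^esub> c a)" "tens k (c a \<ominus>\<^bsub>E\<^esub> d a) \<one>\<^bsub>E\<^esub>" "tens k (d a) \<one>\<^bsub>E\<^esub>"]
    by (simp add: psi_c psi_d tens_c)
  show "\<exists>u\<in>mu 1. \<exists>v\<in>mu 1. psi k (s a) = tens k u \<one>\<^bsub>E\<^esub> \<oplus>\<^bsub>TT k\<^esub> tens k \<one>\<^bsub>E\<^esub> v \<oplus>\<^bsub>TT k\<^esub> psi k (t a)"
  proof (cases flip)
    case True
    then have "s = c" "t = d" by (simp_all add: hopf_side.c[OF hopf_side_axioms] hopf_side.d[OF hopf_side_axioms])
    then show ?thesis using c cd_mu[OF a] by blast
  next
    case False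
    then have "s = d" "t = c" by (simp_all add: hopf_side.c[OF hopf_side_axioms] hopf_side.d[OF hopf_side_axioms])
    then show ?thesis using d cd_mu[OF a] by blast
  qed
qed

lemma psi_descend: "x \<in> carrier E \<Longrightarrow> psi k (SOME y. y \<in> q (2 * k) x) = psi k x"
  by (rule descend[OF _ abelian_TT])
    (use ring_hom_add_hom[OF psi_hom] psi_vanish in \<open>simp_all add: add_hom_def\<close>)

text \<open>The pure tensor of \<open>J \<diamond> J\<close> with \<open>x\<close> in the factor to which the coproduct sends \<open>d(a)\<close>.\<close>

definition dtens :: "nat \<Rightarrow> _" where
  "dtens k x y = (if flip then D.tens k y x else D.tens k x y)"

lemma dtens_closed [simp]: "x \<in> carrier E \<Longrightarrow> y \<in> carrier E \<Longrightarrow> dtens k x y \<in> carrier (D.TG k)"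
  by (simp add: dtens_def)

lemma dtens_mult: "x \<in> carrier E \<Longrightarrow> y \<in> carrier E \<Longrightarrow> x' \<in> carrier E \<Longrightarrow> y' \<in> carrier E \<Longrightarrow>
    dtens k x y \<otimes>\<^bsub>D.TT k\<^esub> dtens k x' y' = dtens k (x \<otimes>\<^bsub>E\<^esub> x') (y \<otimes>\<^bsub>E\<^esub> y')"
  by (simp add: dtens_def D.tens_mult)

lemma dtens_balanced: "x \<in> carrier E \<Longrightarrow> y \<in> carrier E \<Longrightarrow> b \<in> carrier B \<Longrightarrow>
    dtens k (c b \<otimes>\<^bsub>E\<^esub> x) y = dtens k x (d b \<otimes>\<^bsub>E\<^esub> y)"
  using D.tens_balanced[of x y b k] D.tens_balanced[of y x b k] by (simp add: dtens_def c d)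

lemma transit_dtens: "k \<le> n \<Longrightarrow> x \<in> carrier E \<Longrightarrow> y \<in> carrier E \<Longrightarrow> D.transit k (dtens n x y) = dtens k x y"
  by (simp add: dtens_def D.transit_tens)

lemma psiD_c: "b \<in> carrier B \<Longrightarrow> psiD k (c b) = dtens k \<one>\<^bsub>E\<^esub> (c b)"
  and psiD_d: "b \<in> carrier B \<Longrightarrow> psiD k (d b) = dtens k (d b) \<one>\<^bsub>E\<^esub>"
  by (simp_all add: dtens_def c d psiD_src psiD_tgt)

lemma ee_dc: "a \<in> carrier B \<Longrightarrow> b \<in> carrier B \<Longrightarrow> ee a b = (if flip then d b \<otimes>\<^bsub>E\<^esub> c a else d a \<otimes>\<^bsub>E\<^esub> c b)"
  by (simp add: c d ee_src_tgt E.m_comm)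

lemma D_eqI:
  assumes "f \<in> add_hom (D.TG k) M" "f' \<in> add_hom (D.TG k) M"
    and pure: "\<And>a b y. a \<in> carrier B \<Longrightarrow> b \<in> carrier B \<Longrightarrow> y \<in> carrier E \<Longrightarrow>
      f (dtens k (d a \<otimes>\<^bsub>E\<^esub> c b) y) = f' (dtens k (d a \<otimes>\<^bsub>E\<^esub> c b) y)"
    and "X \<in> carrier (D.TG k)"
  shows "f X = f' X"
proof (cases flip)
  case True
  show ?thesis
    by (rule D.TT_eqI_right[OF assms(1,2) _ assms(4)]) (use True pure[unfolded dtens_def] in \<open>auto simp: ee_dc\<close>)
next
  case False
  show ?thesis
    by (rule D.TT_eqI_left[OF assms(1,2) _ assms(4)]) (use False pure[unfolded dtens_def] in \<open>auto simp: ee_dc\<close>)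
qed

lemma C_eqI:
  assumes "f \<in> add_hom (TG k) M" "f' \<in> add_hom (TG k) M"
    and pure: "\<And>a b y. a \<in> carrier B \<Longrightarrow> b \<in> carrier B \<Longrightarrow> y \<in> carrier E \<Longrightarrow>
      f (tens k (d a \<otimes>\<^bsub>E\<^esub> c b) y) = f' (tens k (d a \<otimes>\<^bsub>E\<^esub> c b) y)"
    and "X \<in> carrier (TG k)"
  shows "f X = f' X"
  by (rule TT_eqI_left[OF assms(1,2) _ assms(4)]) (use pure in \<open>auto simp: ee_dc\<close>)

text \<open>The inverse is \<open>x \<diamond> y \<mapsto> \<psi>(x) (1 \<otimes> y)\<close>, again with the factors exchanged in one case.\<close>

definition inv_pure :: "nat \<Rightarrow> _" where
  "inv_pure k u v = psi k (SOME x. x \<in> u) \<otimes>\<^bsub>TT k\<^esub> tensor S (CR k) (CF k) (q k \<one>\<^bsub>E\<^esub>) (res k v)"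

definition hopf_inv :: "nat \<Rightarrow> _" where
  "hopf_inv k = tlift (TG k) (\<lambda>u v. if flip then inv_pure k v u else inv_pure k u v)"

lemma inv_pure_q: "x \<in> carrier E \<Longrightarrow> y \<in> carrier E \<Longrightarrow>
    inv_pure k (q (2 * k) x) (q (2 * k) y) = psi k x \<otimes>\<^bsub>TT k\<^esub> tens k \<one>\<^bsub>E\<^esub> y"
  by (simp add: inv_pure_def psi_descend)

lemma hopf_inv:
  shows hopf_inv_add_hom: "hopf_inv k \<in> add_hom (D.TG (2 * k)) (TG k)"
    and hopf_inv_dtens: "x \<in> carrier E \<Longrightarrow> y \<in> carrier E \<Longrightarrow>
      hopf_inv k (dtens (2 * k) x y) = psi k x \<otimes>\<^bsub>TT k\<^esub> tens k \<one>\<^bsub>E\<^esub> y"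
proof -
  interpret T: cring "TT k" by (rule cring_TT)
  let ?G = "TG k"
  have cl: "inv_pure k u v \<in> carrier ?G" if "u \<in> carrier (Q (2 * k))" "v \<in> carrier (Q (2 * k))" for u v
    using that T.m_closed by (auto simp: inv_pure_q elim!: q_cases)
  have add1: "inv_pure k (u \<oplus>\<^bsub>Q (2 * k)\<^esub> u') v = inv_pure k u v \<oplus>\<^bsub>?G\<^esub> inv_pure k u' v"
    if "u \<in> carrier (Q (2 * k))" "u' \<in> carrier (Q (2 * k))" "v \<in> carrier (Q (2 * k))" for u u' v
    using that T.l_distr by (auto simp: inv_pure_q ring_hom_add[OF psi_hom] elim!: q_cases)
  have add2: "inv_pure k u (v \<oplus>\<^bsub>Q (2 * k)\<^esub> v') = inv_pure k u v \<oplus>\<^bsub>?G\<^esub> inv_pure k u v'"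
    if "u \<in> carrier (Q (2 * k))" "v \<in> carrier (Q (2 * k))" "v' \<in> carrier (Q (2 * k))" for u v v'
    using that T.r_distr by (auto simp: inv_pure_q tens_add_right elim!: q_cases)
  have bal: "inv_pure k (q (2 * k) (c b) \<otimes>\<^bsub>Q (2 * k)\<^esub> u) v = inv_pure k u (q (2 * k) (d b) \<otimes>\<^bsub>Q (2 * k)\<^esub> v)"
    if uv: "u \<in> carrier (Q (2 * k))" "v \<in> carrier (Q (2 * k))" and b: "b \<in> carrier B" for u v b
  proof -
    from uv(1) obtain x where x: "x \<in> carrier E" "u = q (2 * k) x" by (rule q_cases)
    from uv(2) obtain y where y: "y \<in> carrier E" "v = q (2 * k) y" by (rule q_cases)
    have "psi k (c b \<otimes>\<^bsub>E\<^esub> x) \<otimes>\<^bsub>TT k\<^esub> tens k \<one>\<^bsub>E\<^esub> y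
        = psi k x \<otimes>\<^bsub>TT k\<^esub> (tens k \<one>\<^bsub>E\<^esub> (d b) \<otimes>\<^bsub>TT k\<^esub> tens k \<one>\<^bsub>E\<^esub> y)"
      using b x y by (simp add: ring_hom_mult[OF psi_hom] psi_c T.m_ac)
    then show ?thesis
      using b x y by (simp add: inv_pure_q tens_mult)
  qed
  \<comment> \<open>With a name for \<open>inv_pure k\<close>, which depends on \<open>flip\<close>, a case distinction on \<open>flip\<close> leaves it untouched.\<close>
  define F where "F = inv_pure k"
  note F = cl[folded F_def] add1[folded F_def] add2[folded F_def] bal[folded F_def]
  have "balanced B (V (2 * k)) (V (2 * k)) ?G (\<lambda>u v. if flip then F v u else F u v)"
  proof (rule balancedI)
    fix u b v assume "u \<in> carrier (V (2 * k))" "b \<in> carrier B" "v \<in> carrier (V (2 * k))"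
    then show "(if flip then F v (rsmult (V (2 * k)) u b) else F (rsmult (V (2 * k)) u b) v)
        = (if flip then F (b \<odot>\<^bsub>V (2 * k)\<^esub> v) u else F u (b \<odot>\<^bsub>V (2 * k)\<^esub> v))"
      using F(4)[of u v b] F(4)[of v u b] by (cases flip) (simp_all add: c d)
  qed (simp_all add: F(1-3))
  then have "balanced B (V (2 * k)) (V (2 * k)) ?G (\<lambda>u v. if flip then inv_pure k v u else inv_pure k u v)"
    unfolding F_def .
  note lift = tensorable.tlift_universal[OF D.tensorable_TT abelian_TT this, folded hopf_inv_def]
  show "hopf_inv k \<in> add_hom (D.TG (2 * k)) ?G"
    by (rule lift(1))
  show "x \<in> carrier E \<Longrightarrow> y \<in> carrier E \<Longrightarrow> hopf_inv k (dtens (2 * k) x y) = psi k x \<otimes>\<^bsub>TT k\<^esub> tens k \<one>\<^bsub>E\<^esub> y"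
  proof -
    assume *: "x \<in> carrier E" "y \<in> carrier E"
    have "hopf_inv k (dtens (2 * k) x y) = inv_pure k (q (2 * k) x) (q (2 * k) y)"
      unfolding dtens_def
      using * lift(2)[of "q (2 * k) x" "q (2 * k) y"] lift(2)[of "q (2 * k) y" "q (2 * k) x"] by (cases flip) simp_all
    with * show ?thesis by (simp add: inv_pure_q)
  qed
qed

lemma hopf_inv_dc: "a \<in> carrier B \<Longrightarrow> b \<in> carrier B \<Longrightarrow> y \<in> carrier E \<Longrightarrow>
    hopf_inv k (dtens (2 * k) (d a \<otimes>\<^bsub>E\<^esub> c b) y) = tens k (d a) (d b \<otimes>\<^bsub>E\<^esub> y)"
  by (simp add: hopf_inv_dtens ring_hom_mult[OF psi_hom] psi_c psi_d tens_mult)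

lemma c_or_d: "e = s \<or> e = t \<Longrightarrow> e = c \<or> e = d"
  by (auto simp: c d)

text \<open>Source and target are treated at once, as \<open>d\<close> and \<open>c\<close>: \<open>d(b)\<close> acts on \<open>x\<close>, and \<open>c(b)\<close> acts on \<open>y\<close>, from where
  it moves to the left factor after the inverse has been applied.\<close>

lemma hopf_inv_scale:
  assumes e: "e = s \<or> e = t" and b: "b \<in> carrier B" and x: "x \<in> carrier E" and y: "y \<in> carrier E"
  shows "hopf_inv k (psiD (2 * k) (e b) \<otimes>\<^bsub>D.TT (2 * k)\<^esub> dtens (2 * k) x y)
    = tens k (e b) \<one>\<^bsub>E\<^esub> \<otimes>\<^bsub>TT k\<^esub> hopf_inv k (dtens (2 * k) x y)"
proof -
  interpret T: cring "TT k" by (rule cring_TT)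
  show ?thesis
    using c_or_d[OF e]
  proof
    assume "e = c"
    moreover have "tens k \<one>\<^bsub>E\<^esub> (c b \<otimes>\<^bsub>E\<^esub> y) = tens k (c b) \<one>\<^bsub>E\<^esub> \<otimes>\<^bsub>TT k\<^esub> tens k \<one>\<^bsub>E\<^esub> y"
      using b y by (simp add: tens_c tens_mult)
    ultimately show ?thesis
      using b x y T.m_lcomm[of "psi k x" "tens k (c b) \<one>\<^bsub>E\<^esub>" "tens k \<one>\<^bsub>E\<^esub> y"]
      by (simp add: psiD_c dtens_mult hopf_inv_dtens)
  next
    assume "e = d"
    then show ?thesis
      using b x y T.m_assoc[of "tens k (d b) \<one>\<^bsub>E\<^esub>" "psi k x" "tens k \<one>\<^bsub>E\<^esub> y"]
      by (simp add: psiD_d dtens_mult hopf_inv_dtens ring_hom_mult[OF psi_hom] psi_d)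
  qed
qed

lemma D_actions:
  assumes "b \<in> carrier B" "X \<in> carrier (D.TG k)"
  shows "b \<odot>\<^bsub>VV k\<^esub> X = psiD k (s b) \<otimes>\<^bsub>D.TT k\<^esub> X" "rsmult (VV k) X b = psiD k (t b) \<otimes>\<^bsub>D.TT k\<^esub> X"
  using assms by (simp_all add: D_smult psiD_src psiD_tgt)

lemma hopf_inv_bimod_hom: "hopf_inv k \<in> bimod_hom B B (VV (2 * k)) (WW k)"
  unfolding bimod_hom_iff
proof
  have hom: "hopf_inv k \<in> add_hom (VV (2 * k)) (WW k)"
    using hopf_inv_add_hom[of k] by (simp add: add_hom_def)
  have scale: "hopf_inv k (psiD (2 * k) (e b) \<otimes>\<^bsub>D.TT (2 * k)\<^esub> tensor B (V (2 * k)) (V (2 * k)) u v)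
      = tens k (e b) \<one>\<^bsub>E\<^esub> \<otimes>\<^bsub>TT k\<^esub> hopf_inv k (tensor B (V (2 * k)) (V (2 * k)) u v)"
    if "e = s \<or> e = t" "b \<in> carrier B" "u \<in> carrier (V (2 * k))" "v \<in> carrier (V (2 * k))" for e b u v
  proof -
    have uv: "u \<in> carrier (Q (2 * k))" "v \<in> carrier (Q (2 * k))" using that by simp_all
    from uv(1) obtain x where x: "x \<in> carrier E" "u = q (2 * k) x" by (rule q_cases)
    from uv(2) obtain y where y: "y \<in> carrier E" "v = q (2 * k) y" by (rule q_cases)
    have "tensor B (V (2 * k)) (V (2 * k)) u v \<in> {dtens (2 * k) x y, dtens (2 * k) y x}"
      unfolding dtens_def x y by simp
    then show ?thesis
      using hopf_inv_scale[OF that(1,2)] x(1) y(1) by auto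
  qed
  have cl: "tensor B (V (2 * k)) (V (2 * k)) u v \<in> carrier (D.TG (2 * k))"
    "hopf_inv k (tensor B (V (2 * k)) (V (2 * k)) u v) \<in> carrier (TG k)"
    if "u \<in> carrier (V (2 * k))" "v \<in> carrier (V (2 * k))" for u v
    using tensorable.tensor_closed[OF D.tensorable_TT that] add_hom_closed[OF hopf_inv_add_hom] by auto
  show "hopf_inv k \<in> left_lin B (VV (2 * k)) (WW k)"
  proof (rule left_lin_tensorI[OF hom D.L_right_act D.R_left_act])
    fix b u v assume b: "b \<in> carrier B" and uv: "u \<in> carrier (V (2 * k))" "v \<in> carrier (V (2 * k))"
    show "hopf_inv k (b \<odot>\<^bsub>VV (2 * k)\<^esub> tensor B (V (2 * k)) (V (2 * k)) u v)
        = b \<odot>\<^bsub>WW k\<^esub> hopf_inv k (tensor B (V (2 * k)) (V (2 * k)) u v)"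
      using D_actions(1)[OF b cl(1)[OF uv]] scale[OF _ b uv, of s] b left_mult[OF _ cl(2)[OF uv], of "s b"] by simp
  qed simp_all
  show "hopf_inv k \<in> right_lin B (VV (2 * k)) (WW k)"
  proof (rule right_lin_tensorI[OF hom D.L_right_act D.R_left_act])
    fix b u v assume b: "b \<in> carrier B" and uv: "u \<in> carrier (V (2 * k))" "v \<in> carrier (V (2 * k))"
    show "hopf_inv k (rsmult (VV (2 * k)) (tensor B (V (2 * k)) (V (2 * k)) u v) b)
        = rsmult (WW k) (hopf_inv k (tensor B (V (2 * k)) (V (2 * k)) u v)) b"
      using D_actions(2)[OF b cl(1)[OF uv]] scale[OF _ b uv, of t] b left_mult[OF _ cl(2)[OF uv], of "t b"] by simp
  qed simp_all
qed

abbreviation "JC \<equiv> pro_left_view K B (pro_tensor_along S c (JJ K B))"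
abbreviation "JD \<equiv> pro_tensor B JV JV"

lemma hopf_inv_pro_mor: "((\<lambda>k. 2 * k), hopf_inv) \<in> pro_mor B B JD JC" (is "?g \<in> _")
proof (rule pro_mor_natI)
  fix k n :: nat assume kn: "k \<le> n"
  then have kn2: "2 * k \<le> 2 * n" by simp
  have "transit k (hopf_inv n X) = hopf_inv k (D.transit (2 * k) X)"
    if X: "X \<in> carrier (D.TG (2 * n))" for X
    by (rule D_eqI[OF add_hom_comp[OF transit_add_hom[OF kn] hopf_inv_add_hom]
          add_hom_comp[OF hopf_inv_add_hom D.transit_add_hom[OF kn2]] _ X])
      (use kn kn2 in \<open>simp add: transit_dtens hopf_inv_dc transit_tens\<close>)
  then show "\<exists>i. fst ?g k \<le> i \<and> fst ?g n \<le> i \<and>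
      (\<forall>x\<in>carrier (Obj JD i). Map JC (n, k) (snd ?g n (Map JD (i, fst ?g n) x)) = snd ?g k (Map JD (i, fst ?g k) x))"
    using kn by (intro exI[of _ "2 * n"]) (simp add: pro_tensor_along_def D_transit_self)
qed (simp_all add: pro_tensor_along_def hopf_inv_bimod_hom)

end

text \<open>A representative of the Hopf map, at the indices \<open>N\<close> that result from the choices in its construction.\<close>

locale hopf_side_map = hopf_side K B S c d flip
  for K :: "('k, 'x) ring_scheme" and B :: "('k, 'b, 'y) module_scheme"
    and S :: "('b, 'z) ring_scheme" and c d :: "'b \<Rightarrow> ('b, 'b) tens" and flip :: bool +
  fixes N :: "nat \<Rightarrow> nat" and f
  assumes N: "k \<le> N k"
    and f_add_hom: "f k \<in> add_hom (TG (N k)) (D.TG k)"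
    and f_dc: "a \<in> carrier B \<Longrightarrow> b \<in> carrier B \<Longrightarrow> y \<in> carrier E \<Longrightarrow>
      f k (tens (N k) (d a \<otimes>\<^bsub>E\<^esub> c b) y) = dtens k (d a) (c b \<otimes>\<^bsub>E\<^esub> y)"
begin

text \<open>On general pure tensors the Hopf map is \<open>x \<otimes> y \<mapsto> \<Delta>(x) (1 \<diamond> y)\<close>, a product in the ring \<open>J \<diamond> J\<close>; bilinearity
  follows because \<open>\<Delta>\<close> is multiplicative.\<close>

lemma f_tens:
  assumes "x \<in> carrier E" and y: "y \<in> carrier E"
  shows "f k (tens (N k) x y) = psiD k x \<otimes>\<^bsub>D.TT k\<^esub> dtens k \<one>\<^bsub>E\<^esub> y"
  using assms(1)
proof (induction rule: env_induct)
  case (pure a b)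
  have "f k (tens (N k) (d a \<otimes>\<^bsub>E\<^esub> c b) y) = psiD k (d a \<otimes>\<^bsub>E\<^esub> c b) \<otimes>\<^bsub>D.TT k\<^esub> dtens k \<one>\<^bsub>E\<^esub> y"
    if "a \<in> carrier B" "b \<in> carrier B" for a b
    using that y by (simp add: f_dc ring_hom_mult[OF psiD_hom] psiD_c psiD_d dtens_mult)
  then show ?case using pure by (simp add: ee_dc)
next
  case (add X Y)
  interpret T: cring "D.TT k" by (rule D.cring_TT)
  show ?case
    using add y T.l_distr[of "psiD k X" "psiD k Y" "dtens k \<one>\<^bsub>E\<^esub> y"]
    by (simp add: tens_add_left add_hom_add[OF f_add_hom] ring_hom_add[OF psiD_hom])
qed

lemma f_bimod_hom: "f k \<in> bimod_hom B B (WW (N k)) (VV k)"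
  unfolding bimod_hom_iff
proof
  interpret T: cring "D.TT k" by (rule D.cring_TT)
  have hom: "f k \<in> add_hom (WW (N k)) (VV k)"
    using f_add_hom[of k] by (simp add: add_hom_def)
  have m: "psiD k (e \<otimes>\<^bsub>E\<^esub> x) \<otimes>\<^bsub>D.TT k\<^esub> dtens k \<one>\<^bsub>E\<^esub> y = psiD k e \<otimes>\<^bsub>D.TT k\<^esub> (psiD k x \<otimes>\<^bsub>D.TT k\<^esub> dtens k \<one>\<^bsub>E\<^esub> y)"
    "psiD k x \<otimes>\<^bsub>D.TT k\<^esub> dtens k \<one>\<^bsub>E\<^esub> y \<in> carrier (D.TG k)"
    if "e \<in> carrier E" "x \<in> carrier E" "y \<in> carrier E" for e x y
    using that T.m_assoc[of "psiD k e" "psiD k x" "dtens k \<one>\<^bsub>E\<^esub> y"] T.m_closed[of "psiD k x" "dtens k \<one>\<^bsub>E\<^esub> y"]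
    by (simp_all add: ring_hom_mult[OF psiD_hom])
  show "f k \<in> left_lin B (WW (N k)) (VV k)"
    by (rule left_lin_tensorI[OF hom L_right_act R_left_act])
      (auto simp: left_mult tens_mult f_tens m D_actions elim!: q_cases)
  show "f k \<in> right_lin B (WW (N k)) (VV k)"
    by (rule right_lin_tensorI[OF hom L_right_act R_left_act])
      (auto simp: left_mult tens_mult f_tens m D_actions elim!: q_cases)
qed

lemma f_pro_mor: "(N, f) \<in> pro_mor B B JC JD"
proof (rule pro_mor_natI)
  fix k n :: nat assume kn: "k \<le> n"
  let ?i = "max (N k) (N n)"
  have i: "N k \<le> ?i" "N n \<le> ?i" by simp_all
  have "D.transit k (f n (transit (N n) X)) = f k (transit (N k) X)"
    if X: "X \<in> carrier (TG ?i)" for X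
    by (rule C_eqI[OF add_hom_comp[OF D.transit_add_hom[OF kn] add_hom_comp[OF f_add_hom transit_add_hom[OF i(2)]]]
          add_hom_comp[OF f_add_hom transit_add_hom[OF i(1)]] _ X])
      (use i kn in \<open>simp add: transit_tens f_dc transit_dtens\<close>)
  then show "\<exists>i. fst (N, f) k \<le> i \<and> fst (N, f) n \<le> i \<and>
      (\<forall>x\<in>carrier (Obj JC i). Map JD (n, k) (snd (N, f) n (Map JC (i, fst (N, f) n) x)) =
         snd (N, f) k (Map JC (i, fst (N, f) k) x))"
    using i by (intro exI[of _ ?i]) (simp add: pro_tensor_along_def)
qed (simp_all add: pro_tensor_along_def f_bimod_hom)

text \<open>The composites are \<open>d(a) c(b) \<otimes> y \<mapsto> d(a) \<otimes> c(b) y\<close> and \<open>d(a) c(b) \<diamond> y \<mapsto> d(a) \<diamond> d(b) y\<close>, which by the balancing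
  relations are transition maps.\<close>

lemma f_invertible: "pro_invertible B B JC JD (N, f)"
  unfolding pro_invertible_def
proof (intro conjI f_pro_mor bexI[OF _ hopf_inv_pro_mor])
  let ?g = "((\<lambda>k. 2 * k), hopf_inv)"
  show "pro_eq JC JC (pro_comp ?g (N, f)) pro_id"
  proof (rule pro_eq_right)
    have le: "k \<le> N (2 * k)" for k using N[of "2 * k"] by simp
    show "fst pro_id k \<le> fst (pro_comp ?g (N, f)) k" for k
      using le by simp
    fix k X assume "X \<in> carrier (Obj JC (fst (pro_comp ?g (N, f)) k))"
    then have X: "X \<in> carrier (TG (N (2 * k)))"
      by (simp add: pro_tensor_along_def)
    have "hopf_inv k (f (2 * k) X) = transit k X"
    proof (rule C_eqI[OF add_hom_comp[OF hopf_inv_add_hom f_add_hom] transit_add_hom[OF le] _ X])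
      fix a b y assume *: "a \<in> carrier B" "b \<in> carrier B" "y \<in> carrier E"
      then have "hopf_inv k (f (2 * k) (tens (N (2 * k)) (d a \<otimes>\<^bsub>E\<^esub> c b) y)) = tens k (d a) (c b \<otimes>\<^bsub>E\<^esub> y)"
        by (simp add: f_dc hopf_inv_dtens psi_d tens_mult)
      also have "\<dots> = transit k (tens (N (2 * k)) (d a \<otimes>\<^bsub>E\<^esub> c b) y)"
        using * le[of k] tens_balanced[of "d a" y b k] by (simp add: transit_tens carrier_S E.m_comm)
      finally show "hopf_inv k (f (2 * k) (tens (N (2 * k)) (d a \<otimes>\<^bsub>E\<^esub> c b) y))
          = transit k (tens (N (2 * k)) (d a \<otimes>\<^bsub>E\<^esub> c b) y)" .
    qed
    then show "snd (pro_comp ?g (N, f)) k X = snd pro_id k (Map JC (fst (pro_comp ?g (N, f)) k, fst pro_id k) X)"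
      by (simp add: pro_tensor_along_def)
  qed (simp_all add: pro_tensor_along_def C_transit_self)
  show "pro_eq JD JD (pro_comp (N, f) ?g) pro_id"
  proof (rule pro_eq_right)
    have le: "k \<le> 2 * N k" for k using N[of k] by simp
    show "fst pro_id k \<le> fst (pro_comp (N, f) ?g) k" for k
      using le by simp
    fix k X assume "X \<in> carrier (Obj JD (fst (pro_comp (N, f) ?g) k))"
    then have X: "X \<in> carrier (D.TG (2 * N k))"
      by simp
    have "f k (hopf_inv (N k) X) = D.transit k X"
    proof (rule D_eqI[OF add_hom_comp[OF f_add_hom hopf_inv_add_hom] D.transit_add_hom[OF le] _ X])
      fix a b y assume *: "a \<in> carrier B" "b \<in> carrier B" "y \<in> carrier E"
      then have "f k (hopf_inv (N k) (dtens (2 * N k) (d a \<otimes>\<^bsub>E\<^esub> c b) y)) = dtens k (d a) (d b \<otimes>\<^bsub>E\<^esub> y)"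
        by (simp add: hopf_inv_dc f_tens psiD_d dtens_mult)
      also have "\<dots> = D.transit k (dtens (2 * N k) (d a \<otimes>\<^bsub>E\<^esub> c b) y)"
        using * le[of k] dtens_balanced[of "d a" y b k] by (simp add: transit_dtens E.m_comm)
      finally show "f k (hopf_inv (N k) (dtens (2 * N k) (d a \<otimes>\<^bsub>E\<^esub> c b) y))
          = D.transit k (dtens (2 * N k) (d a \<otimes>\<^bsub>E\<^esub> c b) y)" .
    qed
    then show "snd (pro_comp (N, f) ?g) k X = snd pro_id k (Map JD (fst (pro_comp (N, f) ?g) k, fst pro_id k) X)"
      by simp
  qed (simp_all add: D_transit_self)
qed

end

section \<open>The two Hopf maps\<close>

context pair_algebra
begin

sublocale H: hopf_side K B Bo t s False
  by (intro hopf_side.intro hopf_side_axioms.intro pair_algebra_axioms) simp_all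

sublocale A: hopf_side K B B s t True
  by (intro hopf_side.intro hopf_side_axioms.intro pair_algebra_axioms) simp_all

abbreviation "ma k \<equiv> snd (mult_along E (JJ K B) (JJ_mult K B)) k"

text \<open>The composite that defines the Hopf map, with arbitrary intermediate levels: the coproduct leads from \<open>n\<close>
  to \<open>i\<close>, the product from \<open>i\<close> to \<open>k\<close>. The rebracketing is legitimate because \<open>t(e)\<close> acts from the right on
  \<open>J \<diamond> J\<close> through the second factor.\<close>

lemma hopf_level:
  fixes k i n :: nat
  assumes k: "k \<le> i" and n: "2 * i \<le> n" "i \<le> n"
  defines "f \<equiv> \<lambda>X. tensor_map B (V k) (V k) (\<lambda>X. res k X) (\<lambda>X. ma k (H.transit k X))
    (assoc_map B (V i) (H.WW i) (tensor Bo (H.CR i) (H.CF i))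
      (tensor_map Bo (restr (\<lambda>x. x) t (DD i)) (H.CF i) (\<lambda>X. cop i (res (2 * i) X)) (\<lambda>X. res i X) X))"
  shows "f \<in> add_hom (H.TG n) (D.TG k)"
    and "a \<in> carrier B \<Longrightarrow> b \<in> carrier B \<Longrightarrow> y \<in> carrier E \<Longrightarrow>
      f (H.tens n (ee a b) y) = D.tens k (s a) (t b \<otimes>\<^bsub>E\<^esub> y)"
proof -
  let ?RD = "restr (\<lambda>x. x) t (DD i)"
  have RD: "biact E Bo ?RD"
    by (rule restr_biact[OF DD_biact]) simp_all
  have cop: "(\<lambda>X. cop i (res (2 * i) X)) \<in> right_lin Bo (H.CR n) ?RD"
    using restr_bimod_hom[OF cop_res_bimod_hom(1)[OF n(1)], of E "\<lambda>x. x" Bo t] by (simp add: bimod_hom_iff)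
  note c = H.L_right_act H.R_left_act biactD(2)[OF RD] H.R_left_act cop H.res_left_lin[OF n(2)]
  have res: "(\<lambda>X. res k X) \<in> right_lin B (V i) (V k)"
    using V_res_lin[OF k] bimod_hom_iff by blast
  have mul: "(\<lambda>X. ma k (H.transit k X)) \<in> left_lin B (H.WW i) (V k)"
    using H.mult_along_transit[OF k] bimod_hom_iff by blast
  note m = V_acts(2) H.WW_acts(1) V_acts(2) V_acts(1) res mul
  have tau: "(\<lambda>u. tensor Bo (H.CR i) (H.CF i) u v) \<in> left_lin B (V i) (H.WW i)" if "v \<in> carrier (H.CF i)" for v
  proof (rule left_linI, rule add_homI)
    fix b u assume "b \<in> carrier B" "u \<in> carrier (V i)"
    with that show "tensor Bo (H.CR i) (H.CF i) (b \<odot>\<^bsub>V i\<^esub> u) v = b \<odot>\<^bsub>H.WW i\<^esub> tensor Bo (H.CR i) (H.CF i) u v"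
      using tensor_bimod_smult[OF H.CR_biact H.R_left_act, where r = "s b" and p = u and q = v] by simp
  qed (use that in \<open>auto simp: H.tens_add_left elim!: q_cases\<close>)
  have tau': "tensor Bo (H.CR i) (H.CF i) u \<in> add_hom (H.CF i) (H.WW i)" if "u \<in> carrier (V i)" for u
    by (rule add_homI) (use that in \<open>auto simp: H.tens_add_right elim!: q_cases\<close>)
  have r: "rsmult ?RD (tensor B (V i) (V i) u v) e = tensor B (V i) (V i) u (q i (t e) \<otimes>\<^bsub>Q i\<^esub> v)"
    if "u \<in> carrier (V i)" "v \<in> carrier (V i)" "e \<in> carrier Bo" for u v e
    using that by (auto simp: dia_smult psiD_tgt D.tens_mult elim!: q_cases)
  have r': "q i (t e) \<otimes>\<^bsub>Q i\<^esub> v \<in> carrier (V i)" if "v \<in> carrier (V i)" "e \<in> carrier Bo" for v e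
    using that by (auto elim!: q_cases)
  have r'': "tensor Bo (H.CR i) (H.CF i) (q i (t e) \<otimes>\<^bsub>Q i\<^esub> v) w = tensor Bo (H.CR i) (H.CF i) v (e \<odot>\<^bsub>H.CF i\<^esub> w)"
    if "v \<in> carrier (V i)" "e \<in> carrier Bo" "w \<in> carrier (H.CF i)" for v e w
  proof -
    have "v \<in> carrier (Q i)" "w \<in> carrier (Q i)"
      using that by simp_all
    from this(1) obtain x where x: "x \<in> carrier E" "v = q i x" by (rule q_cases)
    from \<open>w \<in> carrier (Q i)\<close> obtain y where y: "y \<in> carrier E" "w = q i y" by (rule q_cases)
    show ?thesis
      using that x y H.tens_balanced[of x y e i] by simp
  qed
  note assoc = assoc_map[where r = "\<lambda>v e. q i (t e) \<otimes>\<^bsub>Q i\<^esub> v", OF V_acts(2,1) biactD(2)[OF RD] H.R_left_act _ _ H.WW_acts(1) tau tau' r r' r'']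
  show "f \<in> add_hom (H.TG n) (D.TG k)"
    unfolding f_def
  proof (rule add_hom_comp[OF tensor_map_add_hom[OF m]], rule add_hom_comp[OF _ tensor_map_add_hom[OF c]])
    show "assoc_map B (V i) (H.WW i) (tensor Bo (H.CR i) (H.CF i)) \<in>
      add_hom (tensor_group Bo ?RD (H.CF i)) (tensor_group B (V i) (H.WW i))"
      by (rule assoc(1)) simp_all
  qed
  show "f (H.tens n (ee a b) y) = D.tens k (s a) (t b \<otimes>\<^bsub>E\<^esub> y)"
    if "a \<in> carrier B" "b \<in> carrier B" "y \<in> carrier E"
  proof -
    have "f (H.tens n (ee a b) y) = tensor_map B (V k) (V k) (\<lambda>X. res k X) (\<lambda>X. ma k (H.transit k X))
        (assoc_map B (V i) (H.WW i) (tensor Bo (H.CR i) (H.CF i)) (tensor Bo ?RD (H.CF i) (D.tens i (s a) (t b)) (q i y)))"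
      unfolding f_def using that n by (subst tensor_map_tensor[OF c]) (simp_all add: cop_q psiD_ee)
    also have "\<dots> = tensor_map B (V k) (V k) (\<lambda>X. res k X) (\<lambda>X. ma k (H.transit k X))
        (tensor B (V i) (H.WW i) (q i (s a)) (H.tens i (t b) y))"
      using that by (subst assoc(2)) simp_all
    also have "\<dots> = D.tens k (s a) (t b \<otimes>\<^bsub>E\<^esub> y)"
      using that k by (subst tensor_map_tensor[OF m]) (simp_all add: H.transit_tens H.mult_along(2))
    finally show ?thesis .
  qed
qed

abbreviation "hm k \<equiv> snd (hopf_map K B (JJ K B) (JJ_mult K B) (JJ_coproduct K B)) k"
text \<open>The index at which the iterated choice of common indices places the Hopf maps.\<close>

abbreviation "ci k \<equiv> common_index (2 * common_index k k) (common_index k k)"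

lemma ci_le: "k \<le> ci k"
  using common_arrows_nat(2)[of k k] common_arrows_nat(3)[of "common_index k k" "2 * common_index k k"] le_trans by blast

lemma fst_hopf_map: "fst (hopf_map K B (JJ K B) (JJ_mult K B) (JJ_coproduct K B)) k = ci k"
  by (simp add: hopf_map_def Let_def pro_tensor_mor_nat)

lemma hm_add_hom: "hm k \<in> add_hom (H.TG (ci k)) (D.TG k)"
  and hm_ee: "a \<in> carrier B \<Longrightarrow> b \<in> carrier B \<Longrightarrow> y \<in> carrier E \<Longrightarrow>
      hm k (H.tens (ci k) (ee a b) y) = D.tens k (s a) (t b \<otimes>\<^bsub>E\<^esub> y)"
proof -
  let ?i = "common_index k k"
  have eq: "hm k = (\<lambda>X. tensor_map B (V k) (V k) (\<lambda>X. res k X) (\<lambda>X. ma k (H.transit k X))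
    (assoc_map B (V ?i) (H.WW ?i) (tensor Bo (H.CR ?i) (H.CF ?i))
      (tensor_map Bo (restr (\<lambda>x. x) t (DD ?i)) (H.CF ?i) (\<lambda>X. cop ?i (res (2 * ?i) X)) (\<lambda>X. res ?i X) X)))"
    by (rule ext) (simp add: hopf_map_def Let_def pro_tensor_mor_nat pro_tensor_along_def)
  note l = hopf_level[of k ?i "ci k", OF common_arrows_nat(2) common_arrows_nat(2) common_arrows_nat(3)]
  show "hm k \<in> add_hom (H.TG (ci k)) (D.TG k)"
    unfolding eq by (rule l(1))
  show "a \<in> carrier B \<Longrightarrow> b \<in> carrier B \<Longrightarrow> y \<in> carrier E \<Longrightarrow>
      hm k (H.tens (ci k) (ee a b) y) = D.tens k (s a) (t b \<otimes>\<^bsub>E\<^esub> y)"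
    unfolding eq by (rule l(2))
qed

text \<open>Here the third factor is attached to the first one, since \<open>s(e)\<close> acts from the right on \<open>J \<diamond> J\<close> through
  the first factor.\<close>

lemma anti_hopf_level:
  fixes k i n :: nat
  assumes k: "k \<le> i" and n: "2 * i \<le> n" "i \<le> n"
  defines "f \<equiv> \<lambda>X. tensor_map B (V k) (V k) (\<lambda>X. ma k (A.transit k X)) (\<lambda>X. res k X)
    (flip_assoc_map B (A.WW i) (V i) (tensor B (A.CR i) (A.CF i))
      (tensor_map B (restr (\<lambda>x. x) s (DD i)) (A.CF i) (\<lambda>X. cop i (res (2 * i) X)) (\<lambda>X. res i X) X))"
  shows "f \<in> add_hom (A.TG n) (D.TG k)"
    and "a \<in> carrier B \<Longrightarrow> b \<in> carrier B \<Longrightarrow> y \<in> carrier E \<Longrightarrow>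
      f (A.tens n (ee a b) y) = D.tens k (s a \<otimes>\<^bsub>E\<^esub> y) (t b)"
proof -
  let ?RD = "restr (\<lambda>x. x) s (DD i)"
  have RD: "biact E B ?RD"
    by (rule restr_biact[OF DD_biact]) simp_all
  have cop: "(\<lambda>X. cop i (res (2 * i) X)) \<in> right_lin B (A.CR n) ?RD"
    using restr_bimod_hom[OF cop_res_bimod_hom(1)[OF n(1)], of E "\<lambda>x. x" B s] by (simp add: bimod_hom_iff)
  note c = A.L_right_act A.R_left_act biactD(2)[OF RD] A.R_left_act cop A.res_left_lin[OF n(2)]
  have res: "(\<lambda>X. res k X) \<in> left_lin B (V i) (V k)"
    using V_res_lin[OF k] bimod_hom_iff by blast
  have mul: "(\<lambda>X. ma k (A.transit k X)) \<in> right_lin B (A.WW i) (V k)"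
    using A.mult_along_transit[OF k] bimod_hom_iff by blast
  note m = A.WW_acts(2) V_acts(1) V_acts(2) V_acts(1) mul res
  have tau: "(\<lambda>u. tensor B (A.CR i) (A.CF i) u v) \<in> right_lin B (V i) (A.WW i)" if "v \<in> carrier (A.CF i)" for v
  proof (rule right_linI, rule add_homI)
    fix b u assume "b \<in> carrier B" "u \<in> carrier (V i)"
    with that show "tensor B (A.CR i) (A.CF i) (rsmult (V i) u b) v = rsmult (A.WW i) (tensor B (A.CR i) (A.CF i) u v) b"
      using tensor_bimod_smult[OF A.CR_biact A.R_left_act, where r = "t b" and p = u and q = v] by simp
  qed (use that in \<open>auto simp: A.tens_add_left elim!: q_cases\<close>)
  have tau': "tensor B (A.CR i) (A.CF i) u \<in> add_hom (A.CF i) (A.WW i)" if "u \<in> carrier (V i)" for u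
    by (rule add_homI) (use that in \<open>auto simp: A.tens_add_right elim!: q_cases\<close>)
  have r: "rsmult ?RD (tensor B (V i) (V i) u v) e = tensor B (V i) (V i) (q i (s e) \<otimes>\<^bsub>Q i\<^esub> u) v"
    if "u \<in> carrier (V i)" "v \<in> carrier (V i)" "e \<in> carrier B" for u v e
    using that by (auto simp: dia_smult psiD_src D.tens_mult elim!: q_cases)
  have r': "q i (s e) \<otimes>\<^bsub>Q i\<^esub> u \<in> carrier (V i)" if "u \<in> carrier (V i)" "e \<in> carrier B" for u e
    using that by (auto elim!: q_cases)
  have r'': "tensor B (A.CR i) (A.CF i) (q i (s e) \<otimes>\<^bsub>Q i\<^esub> u) w = tensor B (A.CR i) (A.CF i) u (e \<odot>\<^bsub>A.CF i\<^esub> w)"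
    if "u \<in> carrier (V i)" "e \<in> carrier B" "w \<in> carrier (A.CF i)" for u e w
  proof -
    have "u \<in> carrier (Q i)" "w \<in> carrier (Q i)"
      using that by simp_all
    from this(1) obtain x where x: "x \<in> carrier E" "u = q i x" by (rule q_cases)
    from \<open>w \<in> carrier (Q i)\<close> obtain y where y: "y \<in> carrier E" "w = q i y" by (rule q_cases)
    show ?thesis
      using that x y A.tens_balanced[of x y e i] by simp
  qed
  note assoc = flip_assoc_map[where r = "\<lambda>u e. q i (s e) \<otimes>\<^bsub>Q i\<^esub> u", OF V_acts(2,1) biactD(2)[OF RD] A.R_left_act _ _ A.WW_acts(2) tau tau' r r' r'']
  show "f \<in> add_hom (A.TG n) (D.TG k)"
    unfolding f_def
  proof (rule add_hom_comp[OF tensor_map_add_hom[OF m]], rule add_hom_comp[OF _ tensor_map_add_hom[OF c]])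
    show "flip_assoc_map B (A.WW i) (V i) (tensor B (A.CR i) (A.CF i)) \<in>
      add_hom (tensor_group B ?RD (A.CF i)) (tensor_group B (A.WW i) (V i))"
      by (rule assoc(1)) simp_all
  qed
  show "f (A.tens n (ee a b) y) = D.tens k (s a \<otimes>\<^bsub>E\<^esub> y) (t b)"
    if "a \<in> carrier B" "b \<in> carrier B" "y \<in> carrier E"
  proof -
    have "f (A.tens n (ee a b) y) = tensor_map B (V k) (V k) (\<lambda>X. ma k (A.transit k X)) (\<lambda>X. res k X)
        (flip_assoc_map B (A.WW i) (V i) (tensor B (A.CR i) (A.CF i)) (tensor B ?RD (A.CF i) (D.tens i (s a) (t b)) (q i y)))"
      unfolding f_def using that n by (subst tensor_map_tensor[OF c]) (simp_all add: cop_q psiD_ee)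
    also have "\<dots> = tensor_map B (V k) (V k) (\<lambda>X. ma k (A.transit k X)) (\<lambda>X. res k X)
        (tensor B (A.WW i) (V i) (A.tens i (s a) y) (q i (t b)))"
      using that by (subst assoc(2)) simp_all
    also have "\<dots> = D.tens k (s a \<otimes>\<^bsub>E\<^esub> y) (t b)"
      using that k by (subst tensor_map_tensor[OF m]) (simp_all add: A.transit_tens A.mult_along(2))
    finally show ?thesis .
  qed
qed

abbreviation "am k \<equiv> snd (anti_hopf_map K B (JJ K B) (JJ_mult K B) (JJ_coproduct K B)) k"

lemma fst_anti_hopf_map: "fst (anti_hopf_map K B (JJ K B) (JJ_mult K B) (JJ_coproduct K B)) k = ci k"
  by (simp add: anti_hopf_map_def Let_def pro_tensor_mor_nat pro_tensor_along_def)

lemma am_add_hom: "am k \<in> add_hom (A.TG (ci k)) (D.TG k)"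
  and am_ee: "a \<in> carrier B \<Longrightarrow> b \<in> carrier B \<Longrightarrow> y \<in> carrier E \<Longrightarrow>
      am k (A.tens (ci k) (ee a b) y) = D.tens k (s a \<otimes>\<^bsub>E\<^esub> y) (t b)"
proof -
  let ?i = "common_index k k"
  have eq: "am k = (\<lambda>X. tensor_map B (V k) (V k) (\<lambda>X. ma k (A.transit k X)) (\<lambda>X. res k X)
    (flip_assoc_map B (A.WW ?i) (V ?i) (tensor B (A.CR ?i) (A.CF ?i))
      (tensor_map B (restr (\<lambda>x. x) s (DD ?i)) (A.CF ?i) (\<lambda>X. cop ?i (res (2 * ?i) X)) (\<lambda>X. res ?i X) X)))"
    by (rule ext) (simp add: anti_hopf_map_def Let_def pro_tensor_mor_nat pro_tensor_along_def)
  note l = anti_hopf_level[of k ?i "ci k", OF common_arrows_nat(2) common_arrows_nat(2) common_arrows_nat(3)]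
  show "am k \<in> add_hom (A.TG (ci k)) (D.TG k)"
    unfolding eq by (rule l(1))
  show "a \<in> carrier B \<Longrightarrow> b \<in> carrier B \<Longrightarrow> y \<in> carrier E \<Longrightarrow>
      am k (A.tens (ci k) (ee a b) y) = D.tens k (s a \<otimes>\<^bsub>E\<^esub> y) (t b)"
    unfolding eq by (rule l(2))
qed

lemma hopf_map_invertible:
  "pro_invertible B B H.JC H.JD (hopf_map K B (JJ K B) (JJ_mult K B) (JJ_coproduct K B))"
proof -
  interpret F: hopf_side_map K B Bo t s False ci "\<lambda>k. hm k"
    by (intro hopf_side_map.intro hopf_side_map_axioms.intro H.hopf_side_axioms)
      (simp_all add: ci_le hm_add_hom hm_ee H.dtens_def ee_src_tgt[symmetric])
  have "hopf_map K B (JJ K B) (JJ_mult K B) (JJ_coproduct K B) = (ci, \<lambda>k. hm k)"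
    by (rule prod_eqI) (simp_all add: fst_hopf_map fun_eq_iff)
  then show ?thesis using F.f_invertible by simp
qed

lemma anti_hopf_map_invertible:
  "pro_invertible B B A.JC A.JD (anti_hopf_map K B (JJ K B) (JJ_mult K B) (JJ_coproduct K B))"
proof -
  have tgt_src: "t a \<otimes>\<^bsub>E\<^esub> s b = ee b a" if "a \<in> carrier B" "b \<in> carrier B" for a b
    using that by (simp add: ee_src_tgt E.m_comm)
  interpret F: hopf_side_map K B B s t True ci "\<lambda>k. am k"
    by (intro hopf_side_map.intro hopf_side_map_axioms.intro A.hopf_side_axioms)
      (simp_all add: ci_le am_add_hom am_ee A.dtens_def tgt_src)
  have "anti_hopf_map K B (JJ K B) (JJ_mult K B) (JJ_coproduct K B) = (ci, \<lambda>k. am k)"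
    by (rule prod_eqI) (simp_all add: fst_anti_hopf_map fun_eq_iff)
  then show ?thesis using F.f_invertible by simp
qed

end

theorem theorem4p10:
  fixes K :: "('k, 'x) ring_scheme" and B :: "('k, 'b, 'y) module_scheme"
  assumes "field K" and "algebra K B"
  shows "pro_Hopf_algebroid K B (JJ K B) (JJ_mult K B) (JJ_unit K B) (JJ_coproduct K B) (JJ_counit K B)"
proof -
  interpret pair_algebra K B
    by (rule pair_algebra.intro) fact+
  show ?thesis
    unfolding pro_Hopf_algebroid_def pro_left_Hopf_algebroid_def pro_anti_left_Hopf_algebroid_def
    using pro_left_bialgebroid_JJ hopf_map_invertible anti_hopf_map_invertible by blast
qed

end
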